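(* Assume that $\mathbb{P}^{\alpha,y}(T_A<\infty)=1$ for all $y\in S_Y$, and that $\alpha>0$ and $\beta=\lambda^o$. Then the invariant measure $\Pi$ of $Y=(N,\Lambda)$ is given by the following: $\Pi(0,\cdot)$ is concentrated at $\lambda^o$ with $$\Pi(0,\{\lambda^o\})=K_0/\lambda^o,$$ and $$\Pi(n,d\lambda)=\pi(n,\lambda)\,d\lambda,\qquad n\ge1,\ \lambda\in(\lambda^o,A),$$ where $$\pi(1,\lambda)=\frac{K_0}{\alpha}\int\mathbf{1}_{\{\lambda<y+\lambda^o<A\}}\frac{F(\lambda^o+y)}{y\,F(\lambda)}\,dG_\ell(1,y),$$ $$\pi(n,\lambda)=\frac1\alpha\int_{\lambda-\lambda^o}^{A-\lambda^o}\frac{F(\lambda^o+y)}{y\,F(\lambda)}\,p(n-1,\lambda^o+y)\,dy,\qquad n\ge2,$$ with $F(\lambda)=\exp(-\lambda/\alpha)\,|\lambda-\beta|^{\frac{\alpha-\beta}{\alpha}}$ and, for $n\ge2$, $$p(n-1,\lambda)=\int\mathbf{1}_{\{u+\lambda^o<\lambda\}}(\lambda-u)\,\pi(n-1,\lambda-u)\,dG_\ell(n,u).$$ The constant $K_0$ is equal to $K_0=\sum_{n=1}^\infty\int_{[\lambda^o,A)}\lambda\,\bar G_\ell(n,(A-\lambda)-)\,\Pi(n-1,d\lambda)$.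
   Context: Constants: $\alpha\ge 0$, $\beta>0$, $A\in(\beta,\infty)$, $\lambda^o\in(0,\beta]$. $(Z_i)_{i\ge1}$ are i.i.d. $[0,\infty)$-valued random variables with distribution function $G$ and finite second moment. $\ell(n,z)$ ($n\ge1$, $z\ge0$) is a strictly positive function such that, for each $n$, $z\mapsto\ell(n,z)$ is non-decreasing and continuous. $G_\ell(n,\cdot)$ is the distribution function of $\ell(n,Z_n)$; $\bar G_\ell:=1-G_\ell$, and $\bar G_\ell(n,a-)$ is the left limit at $a$, i.e. the probability that $\ell(n,Z_n)\ge a$. $Y=(N,\Lambda)$ is the (first two components of the) self-exciting piecewise-deterministic Markov process with resetting: the right-continuous Markov process on $S_Y=(\mathbb{N}\cup\{0\})\times[\lambda^o,A)$ such that between jumps $d\Lambda_t=\alpha(\beta-\Lambda_t)dt$ and $N$ is constant; jumps occur at rate $\Lambda$; at a jump, with mark $Z$ freshly drawn from $G$, $(N,\Lambda)$ moves from $(n,\lambda)$ to $(n+1,\lambda+\ell(n+1,Z))$ if $\lambda+\ell(n+1,Z)<A$, and to $(0,\lambda^o)$ (a reset) otherwise. $T_A$ is the time of the first reset. $\mathbb{P}^{\alpha,y}$ is the law when $Y_0=y$. A measure on $S_Y$ is written $\Pi(n,d\lambda)$, and it is invariant if it is preserved by the transition semigroup of $Y$. The invariant measure is determined up to a multiplicative scaling (so that $K_0$ is fixed by the choice of scaling). *)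

theory Defs
  imports "HOL-Probability.Probability"
begin

text \<open>
  The marks \<open>Z\<^sub>i\<close> are i.i.d. with law \<open>G\<close>, a probability measure on \<open>[0,\<infinity>)\<close>;
  \<open>lo\<close> is the reset level of the intensity.
\<close>

locale resetting_self_exciting =
  fixes \<alpha> \<beta> A lo :: real and G :: "real measure" and l :: "nat \<Rightarrow> real \<Rightarrow> real"
  assumes alpha_nonneg: "0 \<le> \<alpha>"
    and beta_pos: "0 < \<beta>"
    and beta_less_A: "\<beta> < A"
    and lo_pos: "0 < lo"
    and lo_le_beta: "lo \<le> \<beta>"
    and prob_space_G: "prob_space G"
    and sets_G: "sets G = sets (restrict_space borel {0..})"
    and second_moment_G: "integrable G (\<lambda>z. z\<^sup>2)"
    and l_pos: "\<And>n z. 1 \<le> n \<Longrightarrow> 0 \<le> z \<Longrightarrow> 0 < l n z"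
    and l_mono: "\<And>n. 1 \<le> n \<Longrightarrow> mono_on {0..} (l n)"
    and l_cont: "\<And>n. 1 \<le> n \<Longrightarrow> continuous_on {0..} (l n)"
begin

definition SY :: "(nat \<times> real) measure" where
  "SY = restrict_space (count_space UNIV \<Otimes>\<^sub>M borel) (UNIV \<times> {lo..<A})"

text \<open>Solution at time \<open>t\<close> of \<open>x' = \<alpha> (\<beta> - x)\<close> started in \<open>x\<close>.\<close>

definition flow :: "real \<Rightarrow> real \<Rightarrow> real" where
  "flow x t = \<beta> + (x - \<beta>) * exp (- \<alpha> * t)"

text \<open>
  The process is built jump by jump from an i.i.d. sequence of pairs of a standard exponential
  variable and an independent mark: the next jump happens when the integrated intensity along the
  flow reaches the exponential variable, i.e. jumps occur at rate \<open>\<Lambda>\<close>.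
\<close>

definition noise :: "(nat \<Rightarrow> real \<times> real) measure" where
  "noise = PiM UNIV (\<lambda>_. density lborel (exponential_density 1) \<Otimes>\<^sub>M G)"

definition wait :: "real \<Rightarrow> real \<Rightarrow> real" where
  "wait x e = Inf {t. 0 \<le> t \<and> e \<le> integral {0..t} (flow x)}"

definition resets :: "nat \<times> real \<Rightarrow> real \<Rightarrow> bool" where
  "resets = (\<lambda>(n, x) z. A \<le> x + l (n + 1) z)"

definition jump :: "nat \<times> real \<Rightarrow> real \<Rightarrow> nat \<times> real" where
  "jump = (\<lambda>(n, x) z. if resets (n, x) z then (0, lo) else (n + 1, x + l (n + 1) z))"

definition drift :: "nat \<times> real \<Rightarrow> real \<Rightarrow> nat \<times> real" where
  "drift = (\<lambda>(n, x) t. (n, flow x t))"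

text \<open>
  \<open>skeleton y \<omega> k\<close> is the time of the \<open>k\<close>-th jump together with the state right after it;
  the \<open>0\<close>-th entry is the initial state \<open>y\<close> at time \<open>0\<close>.
\<close>

primrec skeleton :: "nat \<times> real \<Rightarrow> (nat \<Rightarrow> real \<times> real) \<Rightarrow> nat \<Rightarrow> real \<times> (nat \<times> real)" where
  "skeleton y \<omega> 0 = (0, y)"
| "skeleton y \<omega> (Suc k) =
    (let (t, s) = skeleton y \<omega> k; (e, z) = \<omega> k; w = wait (snd s) e
     in (t + w, jump (drift s w) z))"

definition jump_time :: "nat \<times> real \<Rightarrow> (nat \<Rightarrow> real \<times> real) \<Rightarrow> nat \<Rightarrow> real" where
  "jump_time y \<omega> k = fst (skeleton y \<omega> k)"

definition post_jump :: "nat \<times> real \<Rightarrow> (nat \<Rightarrow> real \<times> real) \<Rightarrow> nat \<Rightarrow> nat \<times> real" where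
  "post_jump y \<omega> k = snd (skeleton y \<omega> k)"

definition pre_jump :: "nat \<times> real \<Rightarrow> (nat \<Rightarrow> real \<times> real) \<Rightarrow> nat \<Rightarrow> nat \<times> real" where
  "pre_jump y \<omega> k = drift (post_jump y \<omega> k) (jump_time y \<omega> (Suc k) - jump_time y \<omega> k)"

text \<open>
  Number of jumps up to time \<open>t\<close>. The intensity is bounded by \<open>A\<close>, so almost surely the jump
  times do not accumulate; on the exceptional null set the junk value of \<open>card\<close> is immaterial.
\<close>

definition jump_count :: "nat \<times> real \<Rightarrow> (nat \<Rightarrow> real \<times> real) \<Rightarrow> real \<Rightarrow> nat" where
  "jump_count y \<omega> t = card {k. jump_time y \<omega> (Suc k) \<le> t}"

definition Y :: "nat \<times> real \<Rightarrow> real \<Rightarrow> (nat \<Rightarrow> real \<times> real) \<Rightarrow> nat \<times> real" where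
  "Y y t \<omega> = (let k = jump_count y \<omega> t in drift (post_jump y \<omega> k) (t - jump_time y \<omega> k))"

text \<open>The infimum is \<open>\<infinity>\<close> if there is no reset; \<open>pre_jump y \<omega> k\<close> is the state just before
  jump number \<open>k + 1\<close>, which uses the mark \<open>snd (\<omega> k)\<close>.\<close>

definition T_A :: "nat \<times> real \<Rightarrow> (nat \<Rightarrow> real \<times> real) \<Rightarrow> ereal" where
  "T_A y \<omega> = (INF k\<in>{k. resets (pre_jump y \<omega> k) (snd (\<omega> k))}. ereal (jump_time y \<omega> (Suc k)))"

definition transition :: "real \<Rightarrow> nat \<times> real \<Rightarrow> (nat \<times> real) measure" where
  "transition t y = distr noise SY (Y y t)"

text \<open>
  As usual, invariant measures are \<open>\<sigma>\<close>-finite (possibly of infinite total mass) and not identically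
  zero; without these two conditions uniqueness up to scaling fails for trivial reasons.
\<close>

definition invariant_measure :: "(nat \<times> real) measure \<Rightarrow> bool" where
  "invariant_measure \<mu> \<longleftrightarrow>
     sets \<mu> = sets SY \<and> sigma_finite_measure \<mu> \<and> emeasure \<mu> (space \<mu>) \<noteq> 0 \<and>
     (\<forall>t\<ge>0. \<forall>B\<in>sets SY. (\<integral>\<^sup>+y. emeasure (transition t y) B \<partial>\<mu>) = emeasure \<mu> B)"

text \<open>The measure \<open>\<mu>(n, \<cdot>)\<close> on \<open>[lo, A)\<close>.\<close>

definition component :: "(nat \<times> real) measure \<Rightarrow> nat \<Rightarrow> real measure" where
  "component \<mu> n =
     distr (restrict_space \<mu> ({n} \<times> {lo..<A})) (restrict_space borel {lo..<A}) snd"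

text \<open>\<open>Gl_law n\<close> is the law of \<open>l n Z\<^sub>n\<close>, i.e. the Stieltjes measure of its distribution function.\<close>

definition Gl_law :: "nat \<Rightarrow> real measure" where
  "Gl_law n = distr G borel (l n)"

definition Gl_bar :: "nat \<Rightarrow> real \<Rightarrow> real" where
  "Gl_bar n a = 1 - cdf (Gl_law n) a"

definition Gl_bar_left :: "nat \<Rightarrow> real \<Rightarrow> real" where
  "Gl_bar_left n a = Lim (at_left a) (Gl_bar n)"

lemma Gl_bar_left_eq:
  assumes "1 \<le> n"
  shows "Gl_bar_left n a = measure (Gl_law n) {a..}"
proof -
  interpret G: prob_space G by (rule prob_space_G)
  have "l n \<in> borel_measurable (restrict_space borel {0..})"
    using l_cont[OF assms] by (rule borel_measurable_continuous_on_restrict)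
  then have meas: "l n \<in> borel_measurable G"
    using measurable_cong_sets[OF sets_G refl] by blast
  interpret D: real_distribution "Gl_law n"
    unfolding Gl_law_def using meas by (rule G.real_distribution_distr)
  have "((\<lambda>x. 1 - cdf (Gl_law n) x) \<longlongrightarrow> 1 - measure (Gl_law n) {..<a}) (at_left a)"
    by (intro tendsto_intros D.cdf_at_left)
  then have "Gl_bar_left n a = 1 - measure (Gl_law n) {..<a}"
    unfolding Gl_bar_left_def Gl_bar_def by (intro tendsto_Lim) auto
  also have "\<dots> = measure (Gl_law n) (space (Gl_law n) - {..<a})"
    by (subst D.prob_compl) auto
  also have "space (Gl_law n) - {..<a} = {a..}" by auto
  finally show ?thesis .
qed

definition F :: "real \<Rightarrow> real" where
  "F x = exp (- x / \<alpha>) * \<bar>x - \<beta>\<bar> powr ((\<alpha> - \<beta>) / \<alpha>)"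

text \<open>
  All integrands below are nonnegative, so the integrals are taken in \<open>[0,\<infinity>]\<close>.
  \<open>jump_density n f\<close> is \<open>p(n-1, \<cdot>)\<close> when \<open>f\<close> is \<open>\<pi>(n-1, \<cdot>)\<close>.
\<close>

definition jump_density :: "nat \<Rightarrow> (real \<Rightarrow> ennreal) \<Rightarrow> real \<Rightarrow> ennreal" where
  "jump_density n f x =
     (\<integral>\<^sup>+u. indicator {u. u + lo < x} u * (ennreal (x - u) * f (x - u)) \<partial>Gl_law n)"

text \<open>\<open>pi_density K0 n\<close> is \<open>\<pi>(n, \<cdot>)\<close>; it is only used for \<open>n \<ge> 1\<close>, and on \<open>(lo, A)\<close>.\<close>

fun pi_density :: "real \<Rightarrow> nat \<Rightarrow> real \<Rightarrow> ennreal" where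
  "pi_density K0 0 x = 0"
| "pi_density K0 (Suc 0) x = ennreal (K0 / \<alpha>) *
     (\<integral>\<^sup>+y. indicator {y. x < y + lo \<and> y + lo < A} y * ennreal (F (lo + y) / (y * F x)) \<partial>Gl_law 1)"
| "pi_density K0 (Suc (Suc n)) x = ennreal (1 / \<alpha>) *
     (\<integral>\<^sup>+y\<in>{x - lo..A - lo}. ennreal (F (lo + y) / (y * F x)) *
        jump_density (Suc (Suc n)) (pi_density K0 (Suc n)) (lo + y) \<partial>lborel)"

end

end

theory Submission
  imports Defs
begin

text \<open>
  Conditioning on the first jump gives a renewal equation for the transition operators. Summing it
  along the chain of jumps up to the first reset shows that the expected occupation measure of a
  cycle, i.e. of the path from the atom \<open>(0, lo)\<close> to the first reset, is invariant: shifting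
  time by \<open>t\<close> exchanges a window of length \<open>t\<close> at the beginning of the cycle
  for one after its end, and both start in the atom because resets are certain.

  Conversely, let \<open>U q\<close> be the resolvent, \<open>V q\<close> the discounted integral along the flow
  up to the next jump, and \<open>L\<close> the jump operator weighted with the intensity. Expanding the resolvent
  over the jumps gives \<open>U q (L (V q f)) \<le> U q f\<close>, so an invariant \<open>\<mu>\<close> satisfies
  \<open>\<mu> (L (V q f)) \<le> \<mu> f\<close>, and also for \<open>q = 0\<close> by monotone convergence. Iterating this from
  the atom, \<open>\<mu>\<close> dominates the multiple of the cycle measure that has the same mass at the atom.
  The function \<open>U 1\<close> applied to the indicator of the atom is positive everywhere and has the same
  integral for both measures, so they agree.

  Level \<open>n\<close> of the cycle measure is reached from the atom by \<open>n\<close> steps \<open>L (V 0 _)\<close>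
  without reset. Replacing the time along the flow by the position turns such a step into the
  recursion for \<open>\<pi>(n, _)\<close>, with \<open>K\<^sub>0 / lo\<close> the mass of the atom.
\<close>

text \<open>Nothing bounds the expected length of a cycle, so the cycle measure may be infinite and
  sums over a cycle may equal \<infinity>. This shapes the proof: identities have all terms added
  instead of subtracted, they are proved for finitely many jumps, and cancellation is done only
  against a bounded quantity, namely the expected time spent in a set during [0, t], which is at
  most t. For the same reason the converse compares two measures through a function whose integral
  is finite. Discounting with q > 0 makes the expansion of the resolvent converge geometrically with
  ratio A / (q + A), since intensities stay below A. At q = 0 the resolvent of a constant is
  infinite, but V 0 maps 1 to a function bounded by 1 / lo, since intensities are at least lo. The
  assumption \<beta> = lo makes lo a rest point of the flow: the atom is held for an exponential
  time of rate lo, while the flow started above lo approaches it without reaching it. Hence the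
  levels n \<ge> 1 carry no mass at lo, and position can replace time as integration
  variable.\<close>

lemma half_power_bound_0:
  fixes x :: ennreal
  assumes "\<And>k. x \<le> ennreal ((1/2) ^ k)" shows "x = 0"
proof -
  have "(\<lambda>k. ennreal ((1/2) ^ k)) \<longlonglongrightarrow> ennreal 0"
    by (intro tendsto_ennrealI LIMSEQ_power_zero) auto
  then have "x \<le> ennreal 0"
    by (rule LIMSEQ_le_const) (use assms in auto)
  then show ?thesis by simp
qed

text \<open>Continuity from below of the measure with density \<open>h\<close>. It carries
  substitution rules, which are available on compact intervals, over to half-lines.\<close>

lemma set_nn_integral_UN:
  fixes h :: "'a \<Rightarrow> ennreal" and B :: "nat \<Rightarrow> 'a set"
  assumes [measurable]: "h \<in> borel_measurable M" "\<And>n. B n \<in> sets M" and "incseq B"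
  shows "(\<integral>\<^sup>+x\<in>(\<Union>n. B n). h x \<partial>M) = (SUP n. \<integral>\<^sup>+x\<in>B n. h x \<partial>M)"
proof -
  have "(SUP n. emeasure (density M h) (B n)) = emeasure (density M h) (\<Union>n. B n)"
    using assms by (intro SUP_emeasure_incseq) auto
  then show ?thesis by (simp add: emeasure_density)
qed

text \<open>The operators below are applied to functions that depend on a parameter themselves, such
  as \<open>trans_op (t - s) f\<close>. Joint measurability of the uncurried family is the form that
  survives substitution, so all measurability rules for operators assume it.\<close>

lemma measurable_param:
  assumes f: "(\<lambda>p. f (fst p) (snd p)) \<in> borel_measurable (M \<Otimes>\<^sub>M N)"
    and g: "g \<in> measurable K M" and h: "h \<in> measurable K N"
  shows "(\<lambda>x. f (g x) (h x) :: ennreal) \<in> borel_measurable K"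
proof -
  have "(\<lambda>x. (g x, h x)) \<in> measurable K (M \<Otimes>\<^sub>M N)" using g h by measurable
  from measurable_compose[OF this f] show ?thesis by simp
qed

lemma UN_atMost_nat: "(\<Union>n::nat. {0..real n}) = {0..}"
  using real_arch_simple by fastforce

subsection \<open>Functionals given by integration\<close>

text \<open>Measures and kernels are handled through their action on functions, so that sums,
  compositions and powers are operations on functions. The representing measure is unpacked only for
  additivity, monotone convergence and uniqueness.\<close>

definition integral_functional :: "'a measure \<Rightarrow> (('a \<Rightarrow> ennreal) \<Rightarrow> ennreal) \<Rightarrow> bool" where
  "integral_functional M \<Phi> \<longleftrightarrow>
    (\<exists>\<mu>. sets \<mu> = sets M \<and> (\<forall>f\<in>borel_measurable M. \<Phi> f = (\<integral>\<^sup>+x. f x \<partial>\<mu>)))"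

text \<open>The measure is \<open>\<Phi>\<close> on indicators: continuity along increasing
  sequences makes it countably additive, and induction over measurable functions extends the
  agreement. The condition \<open>cong\<close> is there because functions are total and their values
  outside \<open>space M\<close> must not matter.\<close>

lemma integral_functionalI:
  fixes \<Phi> :: "('a \<Rightarrow> ennreal) \<Rightarrow> ennreal"
  assumes add: "\<And>f g. f \<in> borel_measurable M \<Longrightarrow> g \<in> borel_measurable M \<Longrightarrow>
      \<Phi> (\<lambda>x. f x + g x) = \<Phi> f + \<Phi> g"
    and cmult: "\<And>c f. f \<in> borel_measurable M \<Longrightarrow> \<Phi> (\<lambda>x. c * f x) = c * \<Phi> f"
    and SUP: "\<And>F. (\<And>i::nat. F i \<in> borel_measurable M) \<Longrightarrow> incseq F \<Longrightarrow>
      \<Phi> (\<lambda>x. SUP i. F i x) = (SUP i. \<Phi> (F i))"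
    and cong: "\<And>f g. f \<in> borel_measurable M \<Longrightarrow> g \<in> borel_measurable M \<Longrightarrow>
      (\<And>x. x \<in> space M \<Longrightarrow> f x = g x) \<Longrightarrow> \<Phi> f = \<Phi> g"
  shows "integral_functional M \<Phi>"
proof -
  define \<mu> where "\<mu> = measure_of (space M) (sets M) (\<lambda>E. \<Phi> (indicator E))"
  have zero: "\<Phi> (\<lambda>x. 0) = 0" using cmult[of "\<lambda>x. 0" 0] by simp
  have sum: "\<Phi> (\<lambda>x. \<Sum>i<n. g i x) = (\<Sum>i<n. \<Phi> (g i))"
    if [measurable]: "\<And>i::nat. g i \<in> borel_measurable M" for g n
    by (induction n) (auto simp: zero add)
  have [simp, measurable_cong]: "sets \<mu> = sets M"
    by (simp add: \<mu>_def)
  have [simp]: "space \<mu> = space M" by (simp add: \<mu>_def)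
  have emeasure: "emeasure \<mu> E = \<Phi> (indicator E)" if "E \<in> sets M" for E
  proof (rule emeasure_measure_of[OF \<mu>_def])
    show "positive (sets \<mu>) (\<lambda>E. \<Phi> (indicator E))"
      using zero by (simp add: positive_def indicator_def[abs_def])
    show "countably_additive (sets \<mu>) (\<lambda>E. \<Phi> (indicator E))"
    proof (rule countably_additiveI)
      fix A :: "nat \<Rightarrow> 'a set"
      assume A: "range A \<subseteq> sets \<mu>" "disjoint_family A"
      then have [measurable]: "A i \<in> sets M" for i by auto
      have "indicator (\<Union>i. A i) x = (SUP n. \<Sum>i<n. indicator (A i) x :: ennreal)" for x
        using suminf_indicator[OF A(2), of x] by (simp add: suminf_eq_SUP)
      then have "indicator (\<Union>i. A i) = (\<lambda>x. SUP n. \<Sum>i<n. indicator (A i) x :: ennreal)"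
        by (rule ext)
      then have "\<Phi> (indicator (\<Union>i. A i)) = \<Phi> (\<lambda>x. SUP n. \<Sum>i<n. indicator (A i) x)"
        by (rule arg_cong)
      also have "\<dots> = (SUP n. \<Phi> (\<lambda>x. \<Sum>i<n. indicator (A i) x))"
        by (rule SUP) (auto simp: incseq_def le_fun_def intro!: sum_mono2)
      also have "\<dots> = (SUP n. \<Sum>i<n. \<Phi> (indicator (A i)))"
        by (subst sum) auto
      also have "\<dots> = (\<Sum>i. \<Phi> (indicator (A i)))" by (rule suminf_eq_SUP[symmetric])
      finally show "(\<Sum>i. \<Phi> (indicator (A i))) = \<Phi> (indicator (\<Union>i. A i))" ..
    qed
  qed (use that sets.space_closed in auto)
  have "\<Phi> f = (\<integral>\<^sup>+x. f x \<partial>\<mu>)" if "f \<in> borel_measurable M" for f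
    using that
  proof (induction f rule: borel_measurable_induct)
    case (cong f g)
    then show ?case using assms(4)[of f g] nn_integral_cong[of \<mu> f g] by simp
  next
    case (set E)
    then show ?case by (simp add: emeasure)
  next
    case (mult u c)
    then show ?case by (simp add: cmult nn_integral_cmult)
  next
    case (add u v)
    then show ?case by (simp add: assms(1) nn_integral_add add.commute)
  next
    case (seq U)
    then have "\<Phi> (\<lambda>x. SUP i. U i x) = (SUP i. \<Phi> (U i))"
      by (intro SUP) auto
    also have "\<dots> = (SUP i. \<integral>\<^sup>+x. U i x \<partial>\<mu>)" using seq by simp
    also have "\<dots> = (\<integral>\<^sup>+x. (SUP i. U i x) \<partial>\<mu>)"
      using seq by (intro nn_integral_monotone_convergence_SUP[symmetric]) auto
    finally show ?case by (simp add: image_comp SUP_apply)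
  qed
  then show ?thesis unfolding integral_functional_def by (intro exI[of _ \<mu>]) auto
qed

lemma integral_functional_measure:
  assumes "integral_functional M \<Phi>"
  obtains \<mu> where "sets \<mu> = sets M" "\<And>f. f \<in> borel_measurable M \<Longrightarrow> \<Phi> f = (\<integral>\<^sup>+x. f x \<partial>\<mu>)"
  using assms unfolding integral_functional_def by blast

context
  fixes M :: "'a measure" and \<Phi> assumes \<Phi>: "integral_functional M \<Phi>"
begin

lemma integral_functional_add:
  assumes "f \<in> borel_measurable M" "g \<in> borel_measurable M"
  shows "\<Phi> (\<lambda>x. f x + g x) = \<Phi> f + \<Phi> g"
proof -
  obtain \<mu> where [measurable_cong]: "sets \<mu> = sets M" and eq: "\<And>f. f \<in> borel_measurable M \<Longrightarrow> \<Phi> f = (\<integral>\<^sup>+x. f x \<partial>\<mu>)"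
    using integral_functional_measure[OF \<Phi>] by blast
  show ?thesis using assms by (simp add: eq nn_integral_add)
qed

lemma integral_functional_cmult:
  assumes "f \<in> borel_measurable M" shows "\<Phi> (\<lambda>x. c * f x) = c * \<Phi> f"
proof -
  obtain \<mu> where [measurable_cong]: "sets \<mu> = sets M" and eq: "\<And>f. f \<in> borel_measurable M \<Longrightarrow> \<Phi> f = (\<integral>\<^sup>+x. f x \<partial>\<mu>)"
    using integral_functional_measure[OF \<Phi>] by blast
  show ?thesis using assms by (simp add: eq nn_integral_cmult)
qed

lemma integral_functional_SUP:
  assumes "\<And>i::nat. F i \<in> borel_measurable M" "incseq F"
  shows "\<Phi> (\<lambda>x. SUP i. F i x) = (SUP i. \<Phi> (F i))"
proof -
  obtain \<mu> where [measurable_cong]: "sets \<mu> = sets M" and eq: "\<And>f. f \<in> borel_measurable M \<Longrightarrow> \<Phi> f = (\<integral>\<^sup>+x. f x \<partial>\<mu>)"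
    using integral_functional_measure[OF \<Phi>] by blast
  have "(\<integral>\<^sup>+x. (SUP i. F i x) \<partial>\<mu>) = (SUP i. \<integral>\<^sup>+x. F i x \<partial>\<mu>)"
    using assms by (intro nn_integral_monotone_convergence_SUP) auto
  then show ?thesis using assms by (simp add: eq)
qed

lemma integral_functional_mono:
  assumes "f \<in> borel_measurable M" "g \<in> borel_measurable M" "\<And>x. x \<in> space M \<Longrightarrow> f x \<le> g x"
  shows "\<Phi> f \<le> \<Phi> g"
proof -
  obtain \<mu> where s: "sets \<mu> = sets M" and eq: "\<And>f. f \<in> borel_measurable M \<Longrightarrow> \<Phi> f = (\<integral>\<^sup>+x. f x \<partial>\<mu>)"
    using integral_functional_measure[OF \<Phi>] by blast
  show ?thesis using assms sets_eq_imp_space_eq[OF s] by (auto simp: eq intro!: nn_integral_mono)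
qed

end

section \<open>Kernels as operators on functions\<close>

definition kernel_op :: "'a measure \<Rightarrow> (('a \<Rightarrow> ennreal) \<Rightarrow> 'a \<Rightarrow> ennreal) \<Rightarrow> bool" where
  "kernel_op M K \<longleftrightarrow> (\<forall>f\<in>borel_measurable M. K f \<in> borel_measurable M) \<and>
    (\<forall>y. integral_functional M (\<lambda>f. K f y))"

lemma kernel_op_measurable: "kernel_op M K \<Longrightarrow> f \<in> borel_measurable M \<Longrightarrow> K f \<in> borel_measurable M"
  by (simp add: kernel_op_def)

lemma kernel_op_functional: "kernel_op M K \<Longrightarrow> integral_functional M (\<lambda>f. K f y)"
  by (simp add: kernel_op_def)

lemmas kernel_op_add = integral_functional_add[OF kernel_op_functional]
  and kernel_op_cmult = integral_functional_cmult[OF kernel_op_functional]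
  and kernel_op_SUP = integral_functional_SUP[OF kernel_op_functional]
  and kernel_op_mono = integral_functional_mono[OF kernel_op_functional]

text \<open>An equality of functions on the whole type, because a kernel acts by integration at
  every point of the type and not only at points of the space.\<close>

lemma kernel_op_cong_space:
  assumes "kernel_op M K" "f \<in> borel_measurable M" "g \<in> borel_measurable M"
    "\<And>x. x \<in> space M \<Longrightarrow> f x = g x"
  shows "K f = K g"
  using kernel_op_mono[OF assms(1-3)] kernel_op_mono[OF assms(1,3,2)] assms(4)
  by (auto simp: fun_eq_iff intro!: antisym)

text \<open>The image of a measure under a kernel. Checking the criterion for functionals avoids
  constructing that measure explicitly.\<close>

lemma integral_functional_comp:
  assumes \<Phi>: "integral_functional M \<Phi>" and K: "kernel_op M K"
  shows "integral_functional M (\<lambda>f. \<Phi> (K f))"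
proof (rule integral_functionalI)
  note m = kernel_op_measurable[OF K]
  fix f g :: "'a \<Rightarrow> ennreal" assume f: "f \<in> borel_measurable M" and g: "g \<in> borel_measurable M"
  have "K (\<lambda>x. f x + g x) = (\<lambda>y. K f y + K g y)"
    using kernel_op_add[OF K f g] by (rule ext)
  then show "\<Phi> (K (\<lambda>x. f x + g x)) = \<Phi> (K f) + \<Phi> (K g)"
    using integral_functional_add[OF \<Phi> m[OF f] m[OF g]] by simp
  show "\<Phi> (K f) = \<Phi> (K g)" if "\<And>x. x \<in> space M \<Longrightarrow> f x = g x"
    using kernel_op_cong_space[OF K f g that] by simp
next
  note m = kernel_op_measurable[OF K]
  fix c and f :: "'a \<Rightarrow> ennreal" assume f: "f \<in> borel_measurable M"
  have "K (\<lambda>x. c * f x) = (\<lambda>y. c * K f y)"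
    using kernel_op_cmult[OF K f] by (rule ext)
  then show "\<Phi> (K (\<lambda>x. c * f x)) = c * \<Phi> (K f)"
    using integral_functional_cmult[OF \<Phi> m[OF f]] by simp
next
  note m = kernel_op_measurable[OF K]
  fix F :: "nat \<Rightarrow> 'a \<Rightarrow> ennreal" assume F: "\<And>i. F i \<in> borel_measurable M" "incseq F"
  have "K (\<lambda>x. SUP i. F i x) = (\<lambda>y. SUP i. K (F i) y)"
    using kernel_op_SUP[OF K F] by (rule ext)
  moreover have "incseq (\<lambda>i. K (F i))"
    using F by (auto simp: incseq_def le_fun_def intro!: kernel_op_mono[OF K])
  ultimately show "\<Phi> (K (\<lambda>x. SUP i. F i x)) = (SUP i. \<Phi> (K (F i)))"
    using integral_functional_SUP[OF \<Phi>, of "\<lambda>i. K (F i)"] m[OF F(1)] by simp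
qed

lemma kernel_op_comp:
  assumes "kernel_op M K" "kernel_op M K'"
  shows "kernel_op M (\<lambda>f. K (K' f))"
  using assms integral_functional_comp[OF kernel_op_functional[OF assms(1)] assms(2)]
  unfolding kernel_op_def[of _ "\<lambda>f. K (K' f)"] by (auto intro: kernel_op_measurable)

lemma integral_functional_point:
  assumes "y \<in> space M" shows "integral_functional M (\<lambda>f. f y)"
  unfolding integral_functional_def using assms
  by (intro exI[of _ "return M y"]) (auto simp: nn_integral_return)

text \<open>The zeroth power is evaluation at a point, which is integration against a point mass
  when the point lies in the space; \<open>space M = UNIV\<close> ensures this everywhere.\<close>

lemma kernel_op_power:
  assumes "kernel_op M K" "space M = UNIV" shows "kernel_op M (K ^^ n)"
proof (induction n)
  case 0
  show ?case using assms(2) by (auto simp: kernel_op_def intro: integral_functional_point)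
next
  case (Suc n)
  then show ?case using kernel_op_comp[OF assms(1) Suc] by (simp add: comp_def)
qed

lemma integral_functional_suminf_functional:
  assumes "\<And>n::nat. integral_functional M (\<Phi> n)"
  shows "integral_functional M (\<lambda>f. \<Sum>n. \<Phi> n f)"
proof (rule integral_functionalI)
  fix F :: "nat \<Rightarrow> 'a \<Rightarrow> ennreal" assume F: "\<And>i. F i \<in> borel_measurable M" "incseq F"
  have "incseq (\<lambda>i. \<Phi> n (F i))" for n
    using F by (auto simp: incseq_def le_fun_def intro!: integral_functional_mono[OF assms])
  then have "(\<Sum>n. SUP i. \<Phi> n (F i)) = (SUP i. \<Sum>n. \<Phi> n (F i))"
    by (intro ennreal_suminf_SUP_eq)
  then show "(\<Sum>n. \<Phi> n (\<lambda>x. SUP i. F i x)) = (SUP i. \<Sum>n. \<Phi> n (F i))"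
    using integral_functional_SUP[OF assms F] by simp
next
  fix f g :: "'a \<Rightarrow> ennreal"
  assume fg: "f \<in> borel_measurable M" "g \<in> borel_measurable M" "\<And>x. x \<in> space M \<Longrightarrow> f x = g x"
  then have "\<Phi> n f = \<Phi> n g" for n
    by (intro antisym integral_functional_mono[OF assms]) auto
  then show "(\<Sum>n. \<Phi> n f) = (\<Sum>n. \<Phi> n g)" by simp
qed (simp_all add: integral_functional_add[OF assms] integral_functional_cmult[OF assms]
      suminf_add[symmetric] ennreal_suminf_cmult)

section \<open>Fubini on triangles of times\<close>

lemma nn_integral_triangle:
  fixes k :: "real \<Rightarrow> real \<Rightarrow> ennreal"
  assumes [measurable]: "(\<lambda>p. k (fst p) (snd p)) \<in> borel_measurable (borel \<Otimes>\<^sub>M borel)"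
  shows "(\<integral>\<^sup>+t\<in>{0..}. (\<integral>\<^sup>+s\<in>{0..t}. k s (t - s) \<partial>lborel) \<partial>lborel) =
    (\<integral>\<^sup>+s\<in>{0..}. (\<integral>\<^sup>+r\<in>{0..}. k s r \<partial>lborel) \<partial>lborel)"
proof -
  have [measurable]: "(\<lambda>p. k (fst p) (snd p)) \<in> borel_measurable (lborel \<Otimes>\<^sub>M lborel)"
    using assms by (simp cong: measurable_cong_sets)
  have [measurable]: "(\<lambda>x. k (f x) (g x)) \<in> borel_measurable N"
    if [measurable]: "f \<in> borel_measurable N" "g \<in> borel_measurable N" for f g and N :: "'b measure"
    by (rule measurable_param[OF assms]) measurable
  have "(\<integral>\<^sup>+t\<in>{0..}. (\<integral>\<^sup>+s\<in>{0..t}. k s (t - s) \<partial>lborel) \<partial>lborel) =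
    (\<integral>\<^sup>+t. \<integral>\<^sup>+s. k s (t - s) * indicator {0..} s * indicator {0..} (t - s) \<partial>lborel \<partial>lborel)"
  proof (intro nn_integral_cong)
    fix t :: real
    show "(\<integral>\<^sup>+s\<in>{0..t}. k s (t - s) \<partial>lborel) * indicator {0..} t =
      (\<integral>\<^sup>+s. k s (t - s) * indicator {0..} s * indicator {0..} (t - s) \<partial>lborel)"
    proof -
      have "(\<integral>\<^sup>+s\<in>{0..t}. k s (t - s) \<partial>lborel) * indicator {0..} t =
        (\<integral>\<^sup>+s. k s (t - s) * indicator {0..t} s * indicator {0..} t \<partial>lborel)"
        by (rule nn_integral_multc[symmetric]) measurable
      also have "\<dots> = (\<integral>\<^sup>+s. k s (t - s) * indicator {0..} s * indicator {0..} (t - s) \<partial>lborel)"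
        by (intro nn_integral_cong) (auto simp: indicator_def)
      finally show ?thesis .
    qed
  qed
  also have "\<dots> = (\<integral>\<^sup>+s. \<integral>\<^sup>+t. k s (t - s) * indicator {0..} s * indicator {0..} (t - s) \<partial>lborel \<partial>lborel)"
    by (rule lborel_pair.Fubini') measurable
  \<comment> \<open>The substitution \<open>r = t - s\<close> turns the triangle
    \<open>s \<le> t\<close> into a quadrant, as for the Laplace transform of a convolution.\<close>
  also have "\<dots> = (\<integral>\<^sup>+s. \<integral>\<^sup>+r. k s r * indicator {0..} s * indicator {0..} r \<partial>lborel \<partial>lborel)"
  proof (rule nn_integral_cong)
    fix s :: real
    show "(\<integral>\<^sup>+t. k s (t - s) * indicator {0..} s * indicator {0..} (t - s) \<partial>lborel) =
      (\<integral>\<^sup>+r. k s r * indicator {0..} s * indicator {0..} r \<partial>lborel)"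
      by (subst nn_integral_real_affine[where c = 1 and t = s]) (auto simp: algebra_simps)
  qed
  also have "\<dots> = (\<integral>\<^sup>+s\<in>{0..}. (\<integral>\<^sup>+r\<in>{0..}. k s r \<partial>lborel) \<partial>lborel)"
  proof (intro nn_integral_cong)
    fix s :: real
    have "(\<integral>\<^sup>+r. k s r * indicator {0..} s * indicator {0..} r \<partial>lborel) =
        (\<integral>\<^sup>+r. k s r * indicator {0..} r * indicator {0..} s \<partial>lborel)"
      by (simp add: mult_ac)
    also have "\<dots> = (\<integral>\<^sup>+r\<in>{0..}. k s r \<partial>lborel) * indicator {0..} s"
      by (rule nn_integral_multc) measurable
    finally show "(\<integral>\<^sup>+r. k s r * indicator {0..} s * indicator {0..} r \<partial>lborel) =
        (\<integral>\<^sup>+r\<in>{0..}. k s r \<partial>lborel) * indicator {0..} s" .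
  qed
  finally show ?thesis .
qed

lemma pred_mem_Icc [measurable (raw)]:
  fixes f g h :: "'a \<Rightarrow> real"
  assumes [measurable]: "f \<in> borel_measurable M" "g \<in> borel_measurable M" "h \<in> borel_measurable M"
  shows "Measurable.pred M (\<lambda>x. f x \<in> {g x..h x})"
  unfolding atLeastAtMost_iff by measurable

text \<open>Both sides integrate \<open>k u r\<close> over \<open>u, r \<ge> 0\<close> with
  \<open>u + r \<le> t\<close>: on the left the slices have constant sum \<open>v = u + r\<close>,
  on the right constant \<open>r = t - s\<close>.\<close>

lemma nn_integral_triangle_flip:
  fixes k :: "real \<Rightarrow> real \<Rightarrow> ennreal"
  assumes k: "(\<lambda>p. k (fst p) (snd p)) \<in> borel_measurable (borel \<Otimes>\<^sub>M borel)"
  shows "(\<integral>\<^sup>+v\<in>{0..t}. (\<integral>\<^sup>+u\<in>{0..v}. k u (v - u) \<partial>lborel) \<partial>lborel) =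
    (\<integral>\<^sup>+s\<in>{0..t}. (\<integral>\<^sup>+u\<in>{0..s}. k u (t - s) \<partial>lborel) \<partial>lborel)"
proof -
  have [measurable (raw)]: "(\<lambda>x. k (f x) (g x)) \<in> borel_measurable N"
    if [measurable]: "f \<in> borel_measurable N" "g \<in> borel_measurable N" for f g and N :: "'b measure"
    by (rule measurable_param[OF k]) measurable
  have [measurable]: "(\<lambda>p. k (fst p) (snd p)) \<in> borel_measurable (lborel \<Otimes>\<^sub>M lborel)"
    by (rule measurable_param[OF k]) measurable
  \<comment> \<open>The cut-off moves the bound on \<open>v\<close> into the integrand, so that the
    integral over the full quadrant applies.\<close>
  let ?k = "\<lambda>u r. k u r * indicator {..t} (u + r)"
  have mk: "(\<lambda>p. ?k (fst p) (snd p)) \<in> borel_measurable (borel \<Otimes>\<^sub>M borel)"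
    using k by measurable
  have [measurable]: "(\<lambda>p. k (snd p) (t - fst p)) \<in> borel_measurable (lborel \<Otimes>\<^sub>M lborel)"
    by (rule measurable_param[OF k]) measurable
  have "(\<integral>\<^sup>+v\<in>{0..t}. (\<integral>\<^sup>+u\<in>{0..v}. k u (v - u) \<partial>lborel) \<partial>lborel) =
    (\<integral>\<^sup>+v\<in>{0..}. (\<integral>\<^sup>+u\<in>{0..v}. ?k u (v - u) \<partial>lborel) \<partial>lborel)"
    by (intro nn_integral_cong) (auto simp: indicator_def)
  also have "\<dots> = (\<integral>\<^sup>+u\<in>{0..}. (\<integral>\<^sup>+r\<in>{0..}. ?k u r \<partial>lborel) \<partial>lborel)"
    by (rule nn_integral_triangle[OF mk])
  also have "\<dots> = (\<integral>\<^sup>+u. (\<integral>\<^sup>+r. ?k u r * indicator {0..} r * indicator {0..} u \<partial>lborel) \<partial>lborel)"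
    by (subst nn_integral_multc) auto
  also have "\<dots> = (\<integral>\<^sup>+r. (\<integral>\<^sup>+u. ?k u r * indicator {0..} r * indicator {0..} u \<partial>lborel) \<partial>lborel)"
    by (rule lborel_pair.Fubini') (simp add: split_beta')
  also have "\<dots> = (\<integral>\<^sup>+s. (\<integral>\<^sup>+u. ?k u (t - s) * indicator {0..} (t - s) * indicator {0..} u \<partial>lborel) \<partial>lborel)"
    by (subst nn_integral_real_affine[where c = "-1" and t = t]) auto
  also have "\<dots> = (\<integral>\<^sup>+s\<in>{0..t}. (\<integral>\<^sup>+u\<in>{0..s}. k u (t - s) \<partial>lborel) \<partial>lborel)"
  proof (rule nn_integral_cong)
    fix s :: real
    have "(\<integral>\<^sup>+u\<in>{0..s}. k u (t - s) \<partial>lborel) * indicator {0..t} s =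
      (\<integral>\<^sup>+u. k u (t - s) * indicator {0..s} u * indicator {0..t} s \<partial>lborel)"
      by (rule nn_integral_multc[symmetric]) measurable
    also have "\<dots> = (\<integral>\<^sup>+u. ?k u (t - s) * indicator {0..} (t - s) * indicator {0..} u \<partial>lborel)"
      by (intro nn_integral_cong) (auto simp: indicator_def)
    finally show "(\<integral>\<^sup>+u. ?k u (t - s) * indicator {0..} (t - s) * indicator {0..} u \<partial>lborel) =
      (\<integral>\<^sup>+u\<in>{0..s}. k u (t - s) \<partial>lborel) * indicator {0..t} s" ..
  qed
  finally show ?thesis .
qed

lemma pred_mem_Ici [measurable (raw)]:
  fixes f g :: "'a \<Rightarrow> real"
  assumes [measurable]: "f \<in> borel_measurable M" "g \<in> borel_measurable M"
  shows "Measurable.pred M (\<lambda>x. f x \<in> {g x..})"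
  unfolding atLeast_iff by measurable

section \<open>The case of a reset level at which the flow rests\<close>

locale drift_to_reset_level = resetting_self_exciting +
  assumes alpha_pos: "0 < \<alpha>" and beta_eq: "\<beta> = lo"
begin

lemma lo_less_A: "lo < A"
  using beta_less_A beta_eq by simp

lemma A_pos: "0 < A"
  using lo_less_A lo_pos by simp

abbreviation (input) states :: "(nat \<times> real) set" where
  "states \<equiv> UNIV \<times> {lo..<A}"

text \<open>The ambient product space. Operators live on it and not on \<open>SY\<close>, which
  keeps restricted sigma-algebras out of the measurability proofs and makes every point a point of
  the space, as powers of kernels require.\<close>

abbreviation (input) SB :: "(nat \<times> real) measure" where
  "SB \<equiv> count_space UNIV \<Otimes>\<^sub>M borel"

abbreviation (input) origin :: "nat \<times> real" where
  "origin \<equiv> (0, lo)"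

lemma space_SY: "space SY = states"
  unfolding SY_def by (auto simp: space_restrict_space space_pair_measure)

lemma states_sets [measurable]: "states \<in> sets SB"
  by measurable

lemma sets_SY: "sets SY = sets (restrict_space SB states)"
  unfolding SY_def by simp

lemma sets_SY_iff: "E \<in> sets SY \<longleftrightarrow> E \<in> sets SB \<and> E \<subseteq> states"
  unfolding sets_SY using sets_restrict_space_iff[of states SB] states_sets by auto

lemma measurable_SY: "f \<in> measurable SB N \<Longrightarrow> f \<in> measurable SY N"
  unfolding SY_def by (rule measurable_restrict_space1)

lemma id_SY_SB: "(\<lambda>y. y) \<in> measurable SY SB"
  by (rule measurable_SY) measurable

subsection \<open>The flow and the waiting times\<close>

text \<open>The integral of the intensity along the flow over \<open>[0, t]\<close>, in closed form;
  \<open>exp (- cum x t)\<close> is the probability of no jump up to time \<open>t\<close> from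
  intensity \<open>x\<close>.\<close>

definition cum :: "real \<Rightarrow> real \<Rightarrow> real" where
  "cum x t = lo * t + (x - lo) * (1 - exp (- \<alpha> * t)) / \<alpha>"

lemma flow_eq: "flow x t = lo + (x - lo) * exp (- \<alpha> * t)"
  unfolding flow_def using beta_eq by simp

lemma cum_has_derivative: "(cum x has_real_derivative flow x t) (at t within S)"
  unfolding cum_def flow_eq using alpha_pos
  by (auto intro!: derivative_eq_intros)

lemma flow_0 [simp]: "flow x 0 = x"
  by (simp add: flow_eq)

lemma cum_0 [simp]: "cum x 0 = 0"
  by (simp add: cum_def)

lemma flow_lo [simp]: "flow lo t = lo"
  by (simp add: flow_eq)

lemma cum_lo [simp]: "cum lo t = lo * t"
  by (simp add: cum_def)

lemma flow_add: "flow (flow x s) t = flow x (s + t)"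
  by (simp add: flow_eq algebra_simps flip: exp_add)

lemma cum_add: "cum x (s + t) = cum x s + cum (flow x s) t"
proof -
  have "exp (- \<alpha> * (s + t)) = exp (- \<alpha> * s) * exp (- \<alpha> * t)"
    by (simp add: algebra_simps flip: exp_add)
  then show ?thesis
    unfolding cum_def flow_eq using alpha_pos by (simp only:) (simp add: field_simps)
qed

lemma continuous_on_flow: "continuous_on S (flow x)"
  unfolding flow_eq[abs_def] by (intro continuous_intros)

lemma integral_flow: "0 \<le> t \<Longrightarrow> integral {0..t} (flow x) = cum x t"
  using fundamental_theorem_of_calculus[of 0 t "cum x" "flow x"] cum_has_derivative[of x]
  by (auto simp: has_real_derivative_iff_has_vector_derivative integral_unique)

lemma flow_ge: "lo \<le> x \<Longrightarrow> lo \<le> flow x t"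
  by (simp add: flow_eq)

lemma flow_le:
  assumes "lo \<le> x" "0 \<le> t" shows "flow x t \<le> x"
proof -
  have "(x - lo) * exp (- \<alpha> * t) \<le> (x - lo) * 1"
    using assms alpha_pos by (intro mult_left_mono) auto
  then show ?thesis by (simp add: flow_eq)
qed

lemma flow_mem: "x \<in> {lo..<A} \<Longrightarrow> 0 \<le> t \<Longrightarrow> flow x t \<in> {lo..<A}"
  using flow_ge[of x t] flow_le[of x t] by auto

lemma drift_pair [simp]: "drift (n, x) t = (n, flow x t)"
  by (simp add: drift_def)

lemma drift_eq: "drift y t = (fst y, flow (snd y) t)"
  by (simp add: drift_def split_beta)

lemma drift_add: "drift (drift y s) t = drift y (s + t)"
  by (simp add: drift_eq flow_add)

lemma drift_mem: "y \<in> states \<Longrightarrow> 0 \<le> t \<Longrightarrow> drift y t \<in> states"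
  using flow_mem[of "snd y" t] by (auto simp: drift_eq)

lemma cum_strict_mono:
  assumes "lo \<le> x" "s < t" shows "cum x s < cum x t"
proof (rule DERIV_pos_imp_increasing[OF assms(2)])
  show "\<exists>d. (cum x has_real_derivative d) (at u) \<and> 0 < d" for u
    using cum_has_derivative[of x u UNIV] flow_ge[OF assms(1), of u] lo_pos by auto
qed

lemma cum_mono: "lo \<le> x \<Longrightarrow> s \<le> t \<Longrightarrow> cum x s \<le> cum x t"
  using cum_strict_mono[of x s t] by (cases "s = t") auto

lemma cum_le_iff: "lo \<le> x \<Longrightarrow> cum x s \<le> cum x t \<longleftrightarrow> s \<le> t"
  using cum_strict_mono[of x t s] cum_mono[of x s t] by fastforce

lemma cum_ge: "lo \<le> x \<Longrightarrow> 0 \<le> t \<Longrightarrow> lo * t \<le> cum x t"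
  using alpha_pos by (simp add: cum_def)

lemma cum_nonneg: "lo \<le> x \<Longrightarrow> 0 \<le> t \<Longrightarrow> 0 \<le> cum x t"
  using cum_ge[of x t] lo_pos by (smt (verit) mult_nonneg_nonneg)

lemma cum_upper:
  assumes "lo \<le> x" "x \<le> A" "0 \<le> t" shows "cum x t \<le> A * t"
proof -
  have "1 - exp (- \<alpha> * t) \<le> \<alpha> * t"
    using exp_ge_add_one_self[of "- \<alpha> * t"] by simp
  then have "(x - lo) * ((1 - exp (- \<alpha> * t)) / \<alpha>) \<le> (x - lo) * t"
    using assms alpha_pos by (intro mult_left_mono) (auto simp: field_simps)
  then have "cum x t \<le> x * t" by (simp add: cum_def algebra_simps)
  also have "\<dots> \<le> A * t" using assms by (intro mult_right_mono) auto
  finally show ?thesis .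
qed

lemma cum_onto:
  assumes "lo \<le> x" "0 \<le> e" shows "\<exists>w\<ge>0. cum x w = e"
proof -
  have "cum x 0 \<le> e" "e \<le> cum x (e / lo)"
    using assms cum_ge[of x "e / lo"] lo_pos by auto
  moreover have "continuous_on {0..e / lo} (cum x)"
    by (rule DERIV_continuous_on[OF cum_has_derivative])
  ultimately show ?thesis
    using IVT'[of "cum x" 0 e "e / lo"] assms lo_pos by auto
qed

text \<open>As the intensity is at least \<open>lo > 0\<close>, \<open>cum x\<close> is a strictly
  increasing bijection of the nonnegative half-line, and the infimum defining \<open>wait\<close> is
  attained at its inverse.\<close>

lemma wait_cum:
  assumes "lo \<le> x" "0 \<le> w" shows "wait x (cum x w) = w"
proof -
  have "{t. 0 \<le> t \<and> cum x w \<le> integral {0..t} (flow x)} = {w..}"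
    using assms by (auto simp: integral_flow cum_le_iff)
  then show ?thesis by (simp add: wait_def)
qed

text \<open>The exponential variables live on the whole real line. At negative values, a null set,
  the waiting time defaults to 0; thus the jump chain stays in the state space at every point of the
  noise space.\<close>

lemma wait_nonpos:
  assumes "lo \<le> x" "e \<le> 0" shows "wait x e = 0"
proof -
  have "{t. 0 \<le> t \<and> e \<le> integral {0..t} (flow x)} = {0..}"
    using assms by (auto simp: integral_flow intro: order_trans[OF _ cum_nonneg])
  then show ?thesis by (simp add: wait_def)
qed

lemma wait_nonneg: "lo \<le> x \<Longrightarrow> 0 \<le> wait x e"
  using cum_onto[of x e] wait_cum[of x] wait_nonpos[of x e] by (cases "0 \<le> e") auto

lemma wait_le_iff:
  assumes "lo \<le> x" "0 \<le> t" shows "wait x e \<le> t \<longleftrightarrow> e \<le> cum x t"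
proof (cases "0 \<le> e")
  case True
  then obtain w where "0 \<le> w" "cum x w = e" using cum_onto assms by blast
  then show ?thesis using wait_cum[of x w] cum_le_iff[of x w t] assms by auto
next
  case False
  then show ?thesis using assms cum_nonneg[of x t] wait_nonpos[of x e] by auto
qed

lemma wait_ge:
  assumes "x \<in> {lo..<A}" shows "max 0 e / A \<le> wait x e"
proof (cases "0 \<le> e")
  case True
  then obtain w where w: "0 \<le> w" "cum x w = e" using cum_onto assms by fastforce
  then show ?thesis using wait_cum[of x w] cum_upper[of x w] assms A_pos True
    by (auto simp: field_simps)
next
  case False
  then show ?thesis using wait_nonneg[of x e] assms by auto
qed

text \<open>The infimum disappears in the sublevel sets: for \<open>a \<ge> 0\<close>, waiting at
  most \<open>a\<close> means that the exponential variable is at most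
  \<open>cum x a\<close>.\<close>

lemma borel_measurable_wait [measurable (raw)]:
  assumes [measurable]: "f \<in> borel_measurable M" "g \<in> borel_measurable M"
    and f: "\<And>x. x \<in> space M \<Longrightarrow> lo \<le> f x"
  shows "(\<lambda>x. wait (f x) (g x)) \<in> borel_measurable M"
proof (rule borel_measurableI_le)
  fix a :: real
  show "{x \<in> space M. wait (f x) (g x) \<le> a} \<in> sets M"
  proof (cases "0 \<le> a")
    case True
    then have "{x \<in> space M. wait (f x) (g x) \<le> a} = {x \<in> space M. g x \<le> cum (f x) a}"
      using f wait_le_iff by auto
    also have "\<dots> \<in> sets M" unfolding cum_def by measurable
    finally show ?thesis .
  next
    case False
    have "\<not> wait (f x) (g x) \<le> a" if "x \<in> space M" for x
      using wait_nonneg[OF f[OF that], of "g x"] False by linarith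
    then have "{x \<in> space M. wait (f x) (g x) \<le> a} = {}" by blast
    then show ?thesis by (simp only: sets.empty_sets)
  qed
qed

lemma borel_measurable_flow [measurable (raw)]:
  assumes [measurable]: "f \<in> borel_measurable M" "g \<in> borel_measurable M"
  shows "(\<lambda>x. flow (f x) (g x)) \<in> borel_measurable M"
  unfolding flow_def by measurable

lemma borel_measurable_cum [measurable (raw)]:
  assumes [measurable]: "f \<in> borel_measurable M" "g \<in> borel_measurable M"
  shows "(\<lambda>x. cum (f x) (g x)) \<in> borel_measurable M"
  unfolding cum_def by measurable

lemma measurable_drift [measurable (raw)]:
  assumes [measurable]: "f \<in> measurable M SB" "g \<in> borel_measurable M"
  shows "(\<lambda>x. drift (f x) (g x)) \<in> measurable M SB"
  unfolding drift_eq by measurable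

subsection \<open>Jumps\<close>

lemma space_G: "space G = {0..}"
  using sets_eq_imp_space_eq[OF sets_G] by (simp add: space_restrict_space)

lemma measurable_l: "1 \<le> n \<Longrightarrow> l n \<in> borel_measurable G"
  using borel_measurable_continuous_on_restrict[OF l_cont] measurable_cong_sets[OF sets_G refl]
  by blast

lemma borel_measurable_l [measurable (raw)]:
  assumes [measurable]: "f \<in> measurable M (count_space UNIV)" "g \<in> measurable M G"
  shows "(\<lambda>x. l (Suc (f x)) (g x)) \<in> borel_measurable M"
proof (rule measurable_compose_countable[OF _ assms(1)])
  show "(\<lambda>x. l (Suc i) (g x)) \<in> borel_measurable M" for i
    using measurable_compose[OF assms(2) measurable_l[of "Suc i"]] by simp
qed

lemma resets_eq: "resets y z \<longleftrightarrow> A \<le> snd y + l (Suc (fst y)) z"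
  by (simp add: resets_def split_beta)

lemma jump_eq:
  "jump y z = (if resets y z then origin else (Suc (fst y), snd y + l (Suc (fst y)) z))"
  by (simp add: jump_def split_beta)

lemma pred_resets [measurable (raw)]:
  assumes [measurable]: "f \<in> measurable M SB" "g \<in> measurable M G"
  shows "Measurable.pred M (\<lambda>x. resets (f x) (g x))"
  unfolding resets_eq by measurable

lemma measurable_jump [measurable (raw)]:
  assumes [measurable]: "f \<in> measurable M SB" "g \<in> measurable M G"
  shows "(\<lambda>x. jump (f x) (g x)) \<in> measurable M SB"
  unfolding jump_eq by measurable

lemma jump_mem:
  assumes "y \<in> states" "0 \<le> z" shows "jump y z \<in> states"
  using assms l_pos[of "Suc (fst y)" z] lo_less_A by (auto simp: jump_eq resets_eq)

subsection \<open>The noise\<close>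

abbreviation (input) unit_exponential :: "real measure" where
  "unit_exponential \<equiv> density lborel (exponential_density 1)"

abbreviation (input) mark :: "(real \<times> real) measure" where
  "mark \<equiv> unit_exponential \<Otimes>\<^sub>M G"

lemma prob_space_unit_exponential: "prob_space unit_exponential"
  by (rule prob_space_exponential_density) simp

lemma prob_space_mark: "prob_space mark"
proof -
  interpret E: prob_space unit_exponential by (rule prob_space_unit_exponential)
  interpret G: prob_space G by (rule prob_space_G)
  interpret pair_prob_space unit_exponential G ..
  show ?thesis by unfold_locales
qed

lemma noise_eq: "noise = PiM UNIV (\<lambda>_. mark)"
  unfolding noise_def ..

lemma sequence_space_mark: "sequence_space mark"
proof -
  interpret prob_space mark by (rule prob_space_mark)
  show ?thesis by unfold_locales
qed

lemma prob_space_noise: "prob_space noise"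
proof -
  interpret sequence_space mark by (rule sequence_space_mark)
  show ?thesis unfolding noise_eq by unfold_locales
qed

lemma measurable_noise_component [measurable (raw)]:
  assumes g: "g \<in> measurable M noise"
  shows "(\<lambda>x. g x k) \<in> measurable M mark"
  using g unfolding noise_eq by measurable

lemma measurable_fst_noise [measurable (raw)]:
  assumes [measurable]: "g \<in> measurable M noise"
  shows "(\<lambda>x. fst (g x k)) \<in> borel_measurable M"
proof -
  have "(\<lambda>x. fst (g x k)) \<in> measurable M unit_exponential" by measurable
  then show ?thesis by simp
qed

lemma measurable_case_nat_noise [measurable (raw)]:
  assumes f: "f \<in> measurable M mark" and g: "g \<in> measurable M noise"
  shows "(\<lambda>x. case_nat (f x) (g x)) \<in> measurable M noise"
  using f g unfolding noise_eq by measurable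

text \<open>An i.i.d. sequence is a first entry followed by an independent copy of the sequence.
  Every decomposition at the first jump rests on this.\<close>

lemma nn_integral_noise:
  assumes [measurable]: "f \<in> borel_measurable noise"
  shows "(\<integral>\<^sup>+\<omega>. f \<omega> \<partial>noise) = (\<integral>\<^sup>+a. \<integral>\<^sup>+\<omega>. f (case_nat a \<omega>) \<partial>noise \<partial>mark)"
proof -
  interpret sequence_space mark by (rule sequence_space_mark)
  interpret N: prob_space noise by (rule prob_space_noise)
  have "(\<integral>\<^sup>+\<omega>. f \<omega> \<partial>noise) = (\<integral>\<^sup>+\<omega>. f \<omega> \<partial>distr (mark \<Otimes>\<^sub>M noise) noise (\<lambda>(s, \<omega>). case_nat s \<omega>))"
    using PiM_iter unfolding noise_eq by simp
  also have "\<dots> = (\<integral>\<^sup>+p. f (case_nat (fst p) (snd p)) \<partial>(mark \<Otimes>\<^sub>M noise))"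
    by (subst nn_integral_distr) (auto simp: split_beta')
  also have "\<dots> = (\<integral>\<^sup>+a. \<integral>\<^sup>+\<omega>. f (case_nat a \<omega>) \<partial>noise \<partial>mark)"
    by (subst N.nn_integral_fst[symmetric]) auto
  finally show ?thesis .
qed

lemma nn_integral_mark:
  assumes [measurable]: "f \<in> borel_measurable mark"
  shows "(\<integral>\<^sup>+a. f a \<partial>mark) =
    (\<integral>\<^sup>+e. ennreal (exponential_density 1 e) * (\<integral>\<^sup>+z. f (e, z) \<partial>G) \<partial>lborel)"
proof -
  interpret G: prob_space G by (rule prob_space_G)
  have "sets mark = sets (lborel \<Otimes>\<^sub>M G)" by (intro sets_pair_measure_cong) auto
  then have [measurable]: "f \<in> borel_measurable (lborel \<Otimes>\<^sub>M G)"
    using assms measurable_cong_sets by blast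
  have "(\<integral>\<^sup>+a. f a \<partial>mark) = (\<integral>\<^sup>+e. \<integral>\<^sup>+z. f (e, z) \<partial>G \<partial>unit_exponential)"
    by (subst G.nn_integral_fst) auto
  also have "\<dots> = (\<integral>\<^sup>+e. ennreal (exponential_density 1 e) * (\<integral>\<^sup>+z. f (e, z) \<partial>G) \<partial>lborel)"
    by (subst nn_integral_density) auto
  finally show ?thesis .
qed

lemma space_mark: "space mark = UNIV \<times> {0..}"
  by (simp add: space_pair_measure space_G)

lemma space_noise: "\<omega> \<in> space noise \<longleftrightarrow> (\<forall>k. 0 \<le> snd (\<omega> k))"
  unfolding noise_eq space_PiM space_mark by (auto simp: PiE_iff mem_Times_iff)

text \<open>Free of the initial state, so that one null set serves all starting points, including
  the random state after the first jump.\<close>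

definition diverging :: "(nat \<Rightarrow> real \<times> real) \<Rightarrow> bool" where
  "diverging \<omega> \<longleftrightarrow> (\<forall>t. \<exists>k. t < (\<Sum>i<k. max 0 (fst (\<omega> i))))"

text \<open>The Laplace transform of the unit exponential law at 1 is 1/2, and the summands are
  independent.\<close>

lemma nn_integral_exp_partial_sums:
  "(\<integral>\<^sup>+\<omega>. ennreal (exp (- (\<Sum>i<k. max 0 (fst (\<omega> i))))) \<partial>noise) = ennreal ((1/2) ^ k)"
proof (induction k)
  case 0
  interpret prob_space noise by (rule prob_space_noise)
  show ?case by (simp add: emeasure_space_1)
next
  case (Suc k)
  interpret G: prob_space G by (rule prob_space_G)
  interpret E2: prob_space "density lborel (exponential_density 2)"
    by (rule prob_space_exponential_density) simp
  have [simp]: "(\<Sum>i<Suc k. max 0 (fst (case_nat a \<omega> i :: real \<times> real)))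
      = max 0 (fst a) + (\<Sum>i<k. max 0 (fst (\<omega> i)))" for a \<omega>
    by (simp only: sum.lessThan_Suc_shift) simp
  have "(\<integral>\<^sup>+\<omega>. ennreal (exp (- (\<Sum>i<Suc k. max 0 (fst (\<omega> i))))) \<partial>noise)
    = (\<integral>\<^sup>+a. \<integral>\<^sup>+\<omega>. ennreal (exp (- max 0 (fst a))) *
         ennreal (exp (- (\<Sum>i<k. max 0 (fst (\<omega> i))))) \<partial>noise \<partial>mark)"
    by (subst nn_integral_noise)
       (auto simp flip: ennreal_mult exp_add simp del: sum.lessThan_Suc)
  also have "\<dots> = (\<integral>\<^sup>+a. ennreal (exp (- max 0 (fst a))) * ennreal ((1/2) ^ k) \<partial>mark)"
    by (subst nn_integral_cmult) (auto simp: Suc)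
  also have "\<dots> = (\<integral>\<^sup>+e. ennreal (exponential_density 1 e) *
      (ennreal (exp (- max 0 e)) * ennreal ((1/2) ^ k)) \<partial>lborel)"
    by (subst nn_integral_mark) (auto simp: G.emeasure_space_1)
  \<comment> \<open>The square of \<open>exp (- e)\<close> is half the exponential density of rate
    2.\<close>
  also have "\<dots> = (\<integral>\<^sup>+e. ennreal ((1/2) ^ Suc k) * ennreal (exponential_density 2 e) \<partial>lborel)"
    by (intro nn_integral_cong)
       (auto simp: exponential_density_def max_def simp flip: ennreal_mult exp_add)
  also have "\<dots> = ennreal ((1/2) ^ Suc k)"
    using E2.emeasure_space_1 by (subst nn_integral_cmult) (auto simp: emeasure_density)
  finally show ?case .
qed

text \<open>Markov's inequality for \<open>exp (- S)\<close>: if all partial sums stay below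
  \<open>n\<close>, then \<open>exp (- n)\<close> is at most \<open>exp (- S)\<close> for each of
  them, and the expectations of the latter tend to 0.\<close>

lemma AE_diverging: "AE \<omega> in noise. diverging \<omega>"
proof -
  let ?s = "\<lambda>k (\<omega> :: nat \<Rightarrow> real \<times> real). \<Sum>i<k. max 0 (fst (\<omega> i))"
  have "AE \<omega> in noise. \<exists>k. real n < ?s k \<omega>" for n :: nat
  proof -
    let ?N = "{\<omega> \<in> space noise. \<forall>k. ?s k \<omega> \<le> real n}"
    have "ennreal (exp (- real n)) * emeasure noise ?N \<le> ennreal ((1/2) ^ k)" for k
    proof -
      have "ennreal (exp (- real n)) * emeasure noise ?N
          = (\<integral>\<^sup>+\<omega>. ennreal (exp (- real n)) * indicator ?N \<omega> \<partial>noise)"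
        by (subst nn_integral_cmult_indicator) auto
      also have "\<dots> \<le> (\<integral>\<^sup>+\<omega>. ennreal (exp (- ?s k \<omega>)) \<partial>noise)"
        by (intro nn_integral_mono) (auto simp: indicator_def intro!: ennreal_leI)
      finally show ?thesis unfolding nn_integral_exp_partial_sums .
    qed
    then have "ennreal (exp (- real n)) * emeasure noise ?N = 0"
      by (rule half_power_bound_0)
    then have "emeasure noise ?N = 0" by simp
    then show ?thesis
      by (intro AE_I[where N = ?N]) (auto simp: not_less)
  qed
  then have "AE \<omega> in noise. \<forall>n::nat. \<exists>k. real n < ?s k \<omega>"
    by (simp add: AE_all_countable)
  then show ?thesis
  proof eventually_elim
    case (elim \<omega>)
    then show ?case
      unfolding diverging_def using reals_Archimedean2 less_trans by metis
  qed
qed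

subsection \<open>The jump chain\<close>

lemma jump_time_0 [simp]: "jump_time y \<omega> 0 = 0"
  by (simp add: jump_time_def)

lemma post_jump_0 [simp]: "post_jump y \<omega> 0 = y"
  by (simp add: post_jump_def)

lemma jump_time_Suc:
  "jump_time y \<omega> (Suc k) = jump_time y \<omega> k + wait (snd (post_jump y \<omega> k)) (fst (\<omega> k))"
  by (simp add: jump_time_def post_jump_def split_beta Let_def)

lemma post_jump_Suc:
  "post_jump y \<omega> (Suc k) =
    jump (drift (post_jump y \<omega> k) (wait (snd (post_jump y \<omega> k)) (fst (\<omega> k)))) (snd (\<omega> k))"
  by (simp add: jump_time_def post_jump_def split_beta Let_def)

lemma pre_jump_eq:
  "pre_jump y \<omega> k = drift (post_jump y \<omega> k) (wait (snd (post_jump y \<omega> k)) (fst (\<omega> k)))"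
  by (simp add: pre_jump_def jump_time_Suc)

lemma post_jump_mem:
  assumes "y \<in> states" "\<omega> \<in> space noise" shows "post_jump y \<omega> k \<in> states"
proof (induction k)
  case (Suc k)
  then show ?case using assms wait_nonneg[of "snd (post_jump y \<omega> k)" "fst (\<omega> k)"]
    unfolding post_jump_Suc by (intro jump_mem drift_mem) (auto simp: space_noise)
qed (use assms in auto)

lemma wait_post_jump_nonneg:
  assumes "y \<in> states" "\<omega> \<in> space noise" shows "0 \<le> wait (snd (post_jump y \<omega> k)) e"
  using post_jump_mem[OF assms, of k] by (intro wait_nonneg) auto

lemma measurable_post_jump [measurable (raw)]:
  assumes [measurable]: "f \<in> measurable M SB" "g \<in> measurable M noise"
    and f: "\<And>x. x \<in> space M \<Longrightarrow> f x \<in> states"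
  shows "(\<lambda>x. post_jump (f x) (g x) k) \<in> measurable M SB"
proof (induction k)
  case (Suc k)
  note [measurable] = Suc
  have [simp]: "x \<in> space M \<Longrightarrow> lo \<le> snd (post_jump (f x) (g x) k)" for x
    using post_jump_mem[OF f, of x "g x" k] measurable_space[OF assms(2)] by auto
  have [measurable]: "(\<lambda>x. wait (snd (post_jump (f x) (g x) k)) (fst (g x k))) \<in> borel_measurable M"
    by (rule borel_measurable_wait) auto
  show ?case unfolding post_jump_Suc by measurable
qed auto

lemma measurable_jump_time [measurable (raw)]:
  assumes [measurable]: "f \<in> measurable M SB" "g \<in> measurable M noise"
    and f: "\<And>x. x \<in> space M \<Longrightarrow> f x \<in> states"
  shows "(\<lambda>x. jump_time (f x) (g x) k) \<in> borel_measurable M"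
proof (induction k)
  case (Suc k)
  note [measurable] = Suc
  have [simp]: "x \<in> space M \<Longrightarrow> lo \<le> snd (post_jump (f x) (g x) k)" for x
    using post_jump_mem[OF f, of x "g x" k] measurable_space[OF assms(2)] by auto
  have [measurable]: "(\<lambda>x. post_jump (f x) (g x) k) \<in> measurable M SB"
    by (rule measurable_post_jump) (use assms in auto)
  have [measurable]: "(\<lambda>x. wait (snd (post_jump (f x) (g x) k)) (fst (g x k))) \<in> borel_measurable M"
    by (rule borel_measurable_wait) auto
  show ?case unfolding jump_time_Suc by measurable
qed auto

lemma incseq_jump_time:
  assumes "y \<in> states" "\<omega> \<in> space noise" shows "incseq (jump_time y \<omega>)"
  by (intro incseq_SucI) (use wait_post_jump_nonneg[OF assms] in \<open>simp add: jump_time_Suc\<close>)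

text \<open>Comparison with a Poisson process of rate \<open>A\<close>, which dominates the
  intensity; together with \<open>AE_diverging\<close> it excludes an accumulation of jumps.\<close>

lemma jump_time_ge:
  assumes "y \<in> states" "\<omega> \<in> space noise"
  shows "(\<Sum>i<k. max 0 (fst (\<omega> i))) / A \<le> jump_time y \<omega> k"
proof (induction k)
  case (Suc k)
  have "max 0 (fst (\<omega> k)) / A \<le> wait (snd (post_jump y \<omega> k)) (fst (\<omega> k))"
    using post_jump_mem[OF assms, of k] by (intro wait_ge) auto
  then show ?case using Suc by (simp add: jump_time_Suc add_divide_distrib)
qed simp

lemma jump_count_eqI:
  assumes "y \<in> states" "\<omega> \<in> space noise" "jump_time y \<omega> c \<le> t" "t < jump_time y \<omega> (Suc c)"
  shows "jump_count y \<omega> t = c"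
proof -
  have "jump_time y \<omega> (Suc k) \<le> t \<longleftrightarrow> k < c" for k
    using incseqD[OF incseq_jump_time[OF assms(1,2)], of "Suc k" c]
      incseqD[OF incseq_jump_time[OF assms(1,2)], of "Suc c" "Suc k"] assms(3,4)
    by (cases "k < c") auto
  then have "{k. jump_time y \<omega> (Suc k) \<le> t} = {..<c}" by auto
  then show ?thesis by (simp add: jump_count_def)
qed

lemma jump_count_exists:
  assumes "y \<in> states" "\<omega> \<in> space noise" "0 \<le> t" "t < jump_time y \<omega> k"
  obtains c where "jump_time y \<omega> c \<le> t" "t < jump_time y \<omega> (Suc c)"
proof -
  define m where "m = (LEAST k. t < jump_time y \<omega> k)"
  have m: "t < jump_time y \<omega> m" unfolding m_def using assms(4) by (rule LeastI)
  then obtain c where c: "m = Suc c" using assms(3) by (cases m) auto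
  then have "\<not> t < jump_time y \<omega> c"
    using not_less_Least[of c "\<lambda>k. t < jump_time y \<omega> k"] by (simp add: m_def)
  then show ?thesis using that m c by (simp add: not_less)
qed

lemma jump_time_count_le:
  assumes "y \<in> states" "\<omega> \<in> space noise" "0 \<le> t"
  shows "jump_time y \<omega> (jump_count y \<omega> t) \<le> t"
proof (cases "\<exists>k. t < jump_time y \<omega> k")
  case True
  then show ?thesis
    using jump_count_exists[OF assms] jump_count_eqI[OF assms(1,2)] by metis
next
  case False
  \<comment> \<open>Infinitely many jumps up to \<open>t\<close> give \<open>card\<close> the value
    0, and jump time number 0 is 0. So the process stays in the state space also on the exceptional
    null set.\<close>
  then have "{k. jump_time y \<omega> (Suc k) \<le> t} = UNIV" by (auto simp: not_less)
  then show ?thesis using assms by (simp add: jump_count_def)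
qed

lemma Y_eq: "Y y t \<omega> = drift (post_jump y \<omega> (jump_count y \<omega> t)) (t - jump_time y \<omega> (jump_count y \<omega> t))"
  by (simp add: Y_def Let_def)

lemma Y_mem:
  assumes "y \<in> states" "\<omega> \<in> space noise" "0 \<le> t" shows "Y y t \<omega> \<in> states"
  unfolding Y_eq using jump_time_count_le[OF assms]
  by (intro drift_mem post_jump_mem assms) auto

lemma measurable_Y [measurable (raw)]:
  assumes [measurable]: "f \<in> measurable M SB" "g \<in> measurable M noise" "h \<in> borel_measurable M"
    and f: "\<And>x. x \<in> space M \<Longrightarrow> f x \<in> states"
  shows "(\<lambda>x. Y (f x) (h x) (g x)) \<in> measurable M SB"
proof -
  have [measurable]: "(\<lambda>x. post_jump (f x) (g x) k) \<in> measurable M SB" for k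
    by (rule measurable_post_jump) (use assms in auto)
  have [measurable]: "(\<lambda>x. jump_time (f x) (g x) k) \<in> borel_measurable M" for k
    by (rule measurable_jump_time) (use assms in auto)
  have [measurable]: "(\<lambda>x. jump_count (f x) (g x) (h x)) \<in> measurable M (count_space UNIV)"
    unfolding jump_count_def by measurable
  show ?thesis unfolding Y_eq
    by (rule measurable_compose_countable[where g = "\<lambda>x. jump_count (f x) (g x) (h x)"]) measurable
qed

lemma shift_jump_chain:
  assumes "w = wait (snd y) (fst a)" "y' = jump (drift y w) (snd a)"
  shows "jump_time y (case_nat a \<omega>) (Suc k) = w + jump_time y' \<omega> k \<and>
    post_jump y (case_nat a \<omega>) (Suc k) = post_jump y' \<omega> k"
proof (induction k)
  case 0
  show ?case by (simp add: jump_time_Suc post_jump_Suc assms)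
next
  case (Suc k)
  then show ?case
    by (simp add: jump_time_Suc[of _ _ "Suc k"] jump_time_Suc[of _ _ k]
        post_jump_Suc[of _ _ "Suc k"] post_jump_Suc[of _ _ k])
qed

text \<open>The Markov property at the first jump, path by path: afterwards the process is driven by
  the shifted noise. Divergence ensures that \<open>jump_count\<close> is a genuine count for the
  shifted path.\<close>

lemma Y_case_nat:
  fixes y a
  defines "w \<equiv> wait (snd y) (fst a)"
  assumes y: "y \<in> states" and a: "0 \<le> snd a" and \<omega>: "\<omega> \<in> space noise" "diverging \<omega>" and t: "0 \<le> t"
  shows "Y y t (case_nat a \<omega>) = (if t < w then drift y t else Y (jump (drift y w) (snd a)) (t - w) \<omega>)"
proof -
  define y' where "y' = jump (drift y w) (snd a)"
  note shift = shift_jump_chain[OF w_def[THEN meta_eq_to_obj_eq] y'_def, of \<omega>]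
  have w: "0 \<le> w" unfolding w_def using y by (intro wait_nonneg) auto
  then have y': "y' \<in> states" unfolding y'_def using y a by (intro jump_mem drift_mem)
  have a\<omega>: "case_nat a \<omega> \<in> space noise" using a \<omega> by (auto simp: space_noise split: nat.split)
  show ?thesis
  proof (cases "t < w")
    case True
    then have "jump_count y (case_nat a \<omega>) t = 0"
      using t by (intro jump_count_eqI y a\<omega>) (auto simp: shift)
    then show ?thesis using True by (simp add: Y_eq)
  next
    case False
    \<comment> \<open>The factor \<open>A\<close> compensates the division by \<open>A\<close> in
      \<open>jump_time_ge\<close>.\<close>
    obtain k where "(t - w) * A < (\<Sum>i<k. max 0 (fst (\<omega> i)))"
      using \<omega>(2) unfolding diverging_def by blast
    then have "t - w < jump_time y' \<omega> k"
      using jump_time_ge[OF y' \<omega>(1), of k] A_pos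
      by (smt (verit) pos_less_divide_eq)
    then obtain c where c: "jump_time y' \<omega> c \<le> t - w" "t - w < jump_time y' \<omega> (Suc c)"
      using jump_count_exists[OF y' \<omega>(1), of "t - w" k] False by auto
    then have "jump_count y (case_nat a \<omega>) t = Suc c" "jump_count y' \<omega> (t - w) = c"
      by (auto intro!: jump_count_eqI y a\<omega> y' \<omega> simp: shift)
    then show ?thesis using False by (simp add: Y_eq shift y'_def[symmetric] algebra_simps)
  qed
qed

lemma measurable_const_SB [measurable (raw)]: "(\<lambda>_. y) \<in> measurable M SB"
  by (rule measurable_const) (simp add: space_pair_measure)

subsection \<open>The first jump\<close>

text \<open>The substitution \<open>e = cum x s\<close>, with \<open>flow x s\<close> as derivative,
  on the intervals up to \<open>cum x n\<close>, which exhaust the half-line. The weight on the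
  right is the density of the first jump time.\<close>

lemma nn_integral_wait:
  fixes g :: "real \<Rightarrow> ennreal"
  assumes x: "lo \<le> x" and [measurable]: "g \<in> borel_measurable borel"
  shows "(\<integral>\<^sup>+e. ennreal (exponential_density 1 e) * g (wait x e) \<partial>lborel) =
    (\<integral>\<^sup>+s\<in>{0..}. ennreal (exp (- cum x s) * flow x s) * g s \<partial>lborel)"
proof -
  have [measurable]: "wait x \<in> borel_measurable borel"
    by (rule borel_measurable_wait) (use x in auto)
  have [measurable]: "flow x \<in> borel_measurable borel" "cum x \<in> borel_measurable borel"
    by (auto intro: borel_measurable_flow borel_measurable_cum)
  have UN: "(\<Union>n::nat. {0..cum x n}) = {0..}"
  proof (intro equalityI subsetI)
    fix e :: real assume "e \<in> {0..}"
    obtain n :: nat where "e / lo \<le> n" using real_arch_simple by blast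
    then have "e \<le> cum x n" using cum_ge[OF x, of n] lo_pos by (simp add: field_simps)
    then show "e \<in> (\<Union>n::nat. {0..cum x n})" using \<open>e \<in> {0..}\<close> by auto
  qed auto
  have "(\<integral>\<^sup>+e. ennreal (exponential_density 1 e) * g (wait x e) \<partial>lborel)
    = (\<integral>\<^sup>+e\<in>{0..}. ennreal (exp (- e)) * g (wait x e) \<partial>lborel)"
    by (intro nn_integral_cong) (auto simp: exponential_density_def indicator_def)
  also have "\<dots> = (SUP n::nat. \<integral>\<^sup>+e\<in>{0..cum x n}. ennreal (exp (- e)) * g (wait x e) \<partial>lborel)"
    unfolding UN[symmetric]
    by (intro set_nn_integral_UN) (auto simp: incseq_def intro: order_trans[OF _ cum_mono[OF x]])
  also have "\<dots> = (SUP n::nat. \<integral>\<^sup>+s\<in>{0..real n}. ennreal (exp (- cum x s) * flow x s) * g s \<partial>lborel)"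
  proof (intro SUP_cong refl)
    fix n :: nat
    show "(\<integral>\<^sup>+e\<in>{0..cum x n}. ennreal (exp (- e)) * g (wait x e) \<partial>lborel)
      = (\<integral>\<^sup>+s\<in>{0..real n}. ennreal (exp (- cum x s) * flow x s) * g s \<partial>lborel)"
    \<comment> \<open>The substitution rule asks for a nondegenerate interval; for
      \<open>n = 0\<close> both integrals run over a single point.\<close>
    proof (cases "n = 0")
      case True
      have [simp]: "indicator {0::real} s = (if s = 0 then 1 else 0 :: ennreal)" for s
        by (simp add: indicator_def)
      show ?thesis using True x
        by (auto intro!: nn_integral_cong_AE AE_I[where N = "{0}"] split: if_splits)
    next
      case False
      have "(\<integral>\<^sup>+e\<in>{cum x 0..cum x n}. ennreal (exp (- e)) * g (wait x e) \<partial>lborel)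
        = (\<integral>\<^sup>+s\<in>{0..real n}. ennreal (exp (- cum x s)) * g (wait x (cum x s)) * ennreal (flow x s) \<partial>lborel)"
        using False cum_has_derivative[of x _ UNIV] flow_ge[OF x] lo_pos
        by (intro nn_integral_substitution_aux continuous_on_flow)
           (auto intro: order_trans[of 0 lo] less_imp_le)
      also have "\<dots> = (\<integral>\<^sup>+s\<in>{0..real n}. ennreal (exp (- cum x s) * flow x s) * g s \<partial>lborel)"
        using flow_ge[OF x] lo_pos
        by (intro nn_integral_cong)
           (auto simp: wait_cum[OF x] ennreal_mult'' mult_ac indicator_def order_trans[of 0 lo])
      finally show ?thesis by simp
    qed
  qed
  also have "\<dots> = (\<integral>\<^sup>+s\<in>{0..}. ennreal (exp (- cum x s) * flow x s) * g s \<partial>lborel)"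
    unfolding UN_atMost_nat[symmetric]
    by (intro set_nn_integral_UN[symmetric]) (auto simp: incseq_def)
  finally show ?thesis .
qed

lemma nn_integral_first_jump:
  fixes g :: "real \<times> real \<Rightarrow> ennreal"
  assumes x: "lo \<le> x" and [measurable]: "g \<in> borel_measurable (borel \<Otimes>\<^sub>M G)"
  shows "(\<integral>\<^sup>+a. g (wait x (fst a), snd a) \<partial>mark) =
    (\<integral>\<^sup>+s\<in>{0..}. ennreal (exp (- cum x s) * flow x s) * (\<integral>\<^sup>+z. g (s, z) \<partial>G) \<partial>lborel)"
proof -
  interpret G: prob_space G by (rule prob_space_G)
  have [measurable]: "(\<lambda>a. wait x (fst a)) \<in> borel_measurable mark"
  proof (rule borel_measurable_wait)
    have "fst \<in> measurable mark unit_exponential" by simp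
    then show "fst \<in> borel_measurable mark" by simp
  qed (use x in auto)
  have "(\<integral>\<^sup>+a. g (wait x (fst a), snd a) \<partial>mark) =
    (\<integral>\<^sup>+e. ennreal (exponential_density 1 e) * (\<integral>\<^sup>+z. g (wait x e, z) \<partial>G) \<partial>lborel)"
    by (subst nn_integral_mark) auto
  also have "\<dots> = (\<integral>\<^sup>+s\<in>{0..}. ennreal (exp (- cum x s) * flow x s) * (\<integral>\<^sup>+z. g (s, z) \<partial>G) \<partial>lborel)"
    by (intro nn_integral_wait[OF x]) measurable
  finally show ?thesis .
qed

lemma nn_integral_no_jump:
  assumes "lo \<le> x" "0 \<le> t"
  shows "(\<integral>\<^sup>+a. indicator {a. t < wait x (fst a)} a \<partial>mark) = ennreal (exp (- cum x t))"
proof -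
  interpret G: prob_space G by (rule prob_space_G)
  interpret E: prob_space unit_exponential by (rule prob_space_unit_exponential)
  have "(\<integral>\<^sup>+a. indicator {a. t < wait x (fst a)} a \<partial>mark) =
      (\<integral>\<^sup>+a. indicator {cum x t<..} (fst a) \<partial>mark)"
    using wait_le_iff[OF assms] by (intro nn_integral_cong) (auto simp: indicator_def not_le[symmetric])
  also have "\<dots> = emeasure unit_exponential {cum x t<..}"
    by (subst nn_integral_mark)
       (auto simp: G.emeasure_space_1 emeasure_density measurable_compose[OF measurable_fst])
  also have "\<dots> = ennreal (\<P>(e in unit_exponential. cum x t < e))"
    by (simp add: E.emeasure_eq_measure greaterThan_def)
  also have "\<P>(e in unit_exponential. cum x t < e) = exp (- cum x t * 1)"
    using cum_nonneg[OF assms] by (intro E.exponential_distributedD_gt)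
      (auto simp: distributed_def distr_id2)
  finally show ?thesis by simp
qed

subsection \<open>The transition operators and the renewal equation\<close>

text \<open>Outside the state space the junk values are moved to the reset level, which makes
  \<open>trans_op\<close> measurable everywhere.\<close>

definition clamp :: "nat \<times> real \<Rightarrow> nat \<times> real" where
  "clamp y = (fst y, if snd y \<in> {lo..<A} then snd y else lo)"

definition trans_op :: "real \<Rightarrow> (nat \<times> real \<Rightarrow> ennreal) \<Rightarrow> nat \<times> real \<Rightarrow> ennreal" where
  "trans_op t f y = (\<integral>\<^sup>+\<omega>. f (Y (clamp y) t \<omega>) \<partial>noise)"

text \<open>The contribution of the paths without a jump up to time \<open>s\<close>: the
  exponential is their probability, and they follow the flow.\<close>

definition survive :: "real \<Rightarrow> (nat \<times> real \<Rightarrow> ennreal) \<Rightarrow> nat \<times> real \<Rightarrow> ennreal" where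
  "survive s f y = ennreal (exp (- cum (snd y) s)) * f (drift y s)"

text \<open>The operator \<open>L\<close> of the overview. Because of the jump rate
  \<open>snd y\<close> in front, \<open>survive s (jump_op f) y\<close> is the density in
  \<open>s\<close> of the first jump time, multiplied by the expectation of \<open>f\<close> just
  after that jump.\<close>

definition jump_op :: "(nat \<times> real \<Rightarrow> ennreal) \<Rightarrow> nat \<times> real \<Rightarrow> ennreal" where
  "jump_op f y = ennreal (snd y) * (\<integral>\<^sup>+z. f (jump y z) \<partial>G)"

lemma clamp_id: "y \<in> states \<Longrightarrow> clamp y = y"
  by (auto simp: clamp_def prod_eq_iff)

lemma clamp_mem: "clamp y \<in> states"
  using lo_less_A by (auto simp: clamp_def)

lemma measurable_clamp [measurable]: "clamp \<in> measurable SB SB"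
  unfolding clamp_def by measurable

lemma measurable_survive [measurable (raw)]:
  assumes f: "(\<lambda>p. f (fst p) (snd p)) \<in> borel_measurable (M \<Otimes>\<^sub>M SB)"
    and [measurable]: "s \<in> borel_measurable M" "h \<in> measurable M SB"
  shows "(\<lambda>x. survive (s x) (f x) (h x)) \<in> borel_measurable M"
proof -
  have [measurable]: "(\<lambda>x. f x (drift (h x) (s x))) \<in> borel_measurable M"
    by (rule measurable_param[OF f]) measurable
  show ?thesis unfolding survive_def by measurable
qed

lemma measurable_jump_op [measurable (raw)]:
  assumes f: "(\<lambda>p. f (fst p) (snd p)) \<in> borel_measurable (M \<Otimes>\<^sub>M SB)"
    and [measurable]: "h \<in> measurable M SB"
  shows "(\<lambda>x. jump_op (f x) (h x)) \<in> borel_measurable M"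
proof -
  interpret G: prob_space G by (rule prob_space_G)
  have [measurable]: "(\<lambda>q. f (fst q) (jump (h (fst q)) (snd q))) \<in> borel_measurable (M \<Otimes>\<^sub>M G)"
    by (rule measurable_param[OF f]) measurable
  show ?thesis unfolding jump_op_def by measurable
qed

lemma measurable_trans_op [measurable (raw)]:
  assumes f: "(\<lambda>p. f (fst p) (snd p)) \<in> borel_measurable (M \<Otimes>\<^sub>M SB)"
    and [measurable]: "t \<in> borel_measurable M" "h \<in> measurable M SB"
  shows "(\<lambda>x. trans_op (t x) (f x) (h x)) \<in> borel_measurable M"
proof -
  interpret N: prob_space noise by (rule prob_space_noise)
  have [measurable]: "(\<lambda>q. Y (clamp (h (fst q))) (t (fst q)) (snd q)) \<in> measurable (M \<Otimes>\<^sub>M noise) SB"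
    by (rule measurable_Y) (auto intro: clamp_mem)
  have [measurable]: "(\<lambda>q. f (fst q) (Y (clamp (h (fst q))) (t (fst q)) (snd q)))
      \<in> borel_measurable (M \<Otimes>\<^sub>M noise)"
    by (rule measurable_param[OF f]) measurable
  show ?thesis unfolding trans_op_def by measurable
qed

text \<open>Either there is no jump up to \<open>t\<close>, or the first jump occurs at some
  \<open>s \<le> t\<close> and the process restarts from the new state with the time
  \<open>t - s\<close> left.\<close>

lemma renewal:
  assumes y: "y \<in> states" and t: "0 \<le> t" and [measurable]: "f \<in> borel_measurable SB"
  shows "trans_op t f y = survive t f y +
    (\<integral>\<^sup>+s\<in>{0..t}. survive s (jump_op (trans_op (t - s) f)) y \<partial>lborel)"
proof -
  interpret N: prob_space noise by (rule prob_space_noise)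
  interpret G: prob_space G by (rule prob_space_G)
  define x where "x = snd y"
  have x: "lo \<le> x" using y by (auto simp: x_def)
  \<comment> \<open>The value expected after a first jump at time \<open>fst p\<close> with mark
    \<open>snd p\<close>, set to 0 if that jump comes after \<open>t\<close>.\<close>
  define g where "g = (\<lambda>p. indicator {..t} (fst p) * trans_op (t - fst p) f (jump (drift y (fst p)) (snd p)))"
  have [measurable]: "g \<in> borel_measurable (borel \<Otimes>\<^sub>M G)" unfolding g_def by measurable
  have [measurable]: "(\<lambda>a. wait x (fst a)) \<in> borel_measurable mark"
  proof (rule borel_measurable_wait)
    have "fst \<in> measurable mark unit_exponential" by simp
    then show "fst \<in> borel_measurable mark" by simp
  qed (use x in auto)
  have mY: "(\<lambda>\<omega>. f (Y y t \<omega>)) \<in> borel_measurable noise"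
    by (rule measurable_compose[OF measurable_Y]) (use y in auto)
  have "trans_op t f y = (\<integral>\<^sup>+\<omega>. f (Y y t \<omega>) \<partial>noise)"
    by (simp add: trans_op_def clamp_id[OF y])
  also have "\<dots> = (\<integral>\<^sup>+a. \<integral>\<^sup>+\<omega>. f (Y y t (case_nat a \<omega>)) \<partial>noise \<partial>mark)"
    by (rule nn_integral_noise[OF mY])
  also have "\<dots> = (\<integral>\<^sup>+a. f (drift y t) * indicator {a. t < wait x (fst a)} a + g (wait x (fst a), snd a) \<partial>mark)"
  proof (intro nn_integral_cong)
    fix a assume "a \<in> space mark"
    then have a: "0 \<le> snd a" by (auto simp: space_mark)
    define w where "w = wait x (fst a)"
    have w: "0 \<le> w" unfolding w_def by (rule wait_nonneg[OF x])
    have j: "jump (drift y w) (snd a) \<in> states" by (intro jump_mem drift_mem y a w)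
    have "AE \<omega> in noise. f (Y y t (case_nat a \<omega>)) =
        f (if t < w then drift y t else Y (jump (drift y w) (snd a)) (t - w) \<omega>)"
      using AE_diverging AE_space
      by eventually_elim (simp add: Y_case_nat[OF y a _ _ t] w_def x_def)
    then have "(\<integral>\<^sup>+\<omega>. f (Y y t (case_nat a \<omega>)) \<partial>noise) =
      (\<integral>\<^sup>+\<omega>. f (if t < w then drift y t else Y (jump (drift y w) (snd a)) (t - w) \<omega>) \<partial>noise)"
      by (rule nn_integral_cong_AE)
    also have "\<dots> = f (drift y t) * indicator {a. t < wait x (fst a)} a + g (w, snd a)"
      unfolding g_def trans_op_def
      by (cases "t < w") (simp_all add: w_def[symmetric] clamp_id[OF j] N.emeasure_space_1)
    finally show "(\<integral>\<^sup>+\<omega>. f (Y y t (case_nat a \<omega>)) \<partial>noise) = f (drift y t) *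
        indicator {a. t < wait x (fst a)} a + g (wait x (fst a), snd a)"
      by (simp add: w_def)
  qed
  also have "\<dots> = (\<integral>\<^sup>+a. f (drift y t) * indicator {a. t < wait x (fst a)} a \<partial>mark) +
      (\<integral>\<^sup>+a. g (wait x (fst a), snd a) \<partial>mark)"
    by (intro nn_integral_add) measurable
  also have "(\<integral>\<^sup>+a. f (drift y t) * indicator {a. t < wait x (fst a)} a \<partial>mark) = survive t f y"
    unfolding survive_def x_def[symmetric]
    by (subst nn_integral_cmult, measurable) (simp add: nn_integral_no_jump[OF x t] mult_ac)
  also have "(\<integral>\<^sup>+a. g (wait x (fst a), snd a) \<partial>mark) =
      (\<integral>\<^sup>+s\<in>{0..}. ennreal (exp (- cum x s) * flow x s) * (\<integral>\<^sup>+z. g (s, z) \<partial>G) \<partial>lborel)"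
    by (rule nn_integral_first_jump[OF x]) measurable
  also have "\<dots> = (\<integral>\<^sup>+s\<in>{0..t}. survive s (jump_op (trans_op (t - s) f)) y \<partial>lborel)"
  proof (intro nn_integral_cong)
    fix s :: real
    have "(\<integral>\<^sup>+z. g (s, z) \<partial>G) = indicator {..t} s * (\<integral>\<^sup>+z. trans_op (t - s) f (jump (drift y s) z) \<partial>G)"
      unfolding g_def fst_conv snd_conv by (intro nn_integral_cmult) measurable
    moreover have "ennreal (exp (- cum x s) * flow x s) = ennreal (exp (- cum x s)) * ennreal (flow x s)"
      by (intro ennreal_mult') simp
    ultimately show "ennreal (exp (- cum x s) * flow x s) * (\<integral>\<^sup>+z. g (s, z) \<partial>G) * indicator {0..} s =
        survive s (jump_op (trans_op (t - s) f)) y * indicator {0..t} s"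
      by (auto simp: survive_def jump_op_def drift_eq x_def mult_ac indicator_def)
  qed
  finally show ?thesis .
qed

subsection \<open>Resolvent equations\<close>

text \<open>The restriction to nonnegative times is part of the weight, and
  \<open>discount 0\<close> is just that restriction; hence undiscounted operators are the case
  \<open>q = 0\<close>.\<close>

definition discount :: "real \<Rightarrow> real \<Rightarrow> ennreal" where
  "discount q s = ennreal (exp (- q * s)) * indicator {0..} s"

text \<open>The operator \<open>V q\<close> of the overview; \<open>resolvent q\<close> is
  \<open>U q\<close>. Values in \<open>[0,\<infinity>]\<close> allow \<open>q = 0\<close> for
  both.\<close>

definition sojourn :: "real \<Rightarrow> (nat \<times> real \<Rightarrow> ennreal) \<Rightarrow> nat \<times> real \<Rightarrow> ennreal" where
  "sojourn q f y = (\<integral>\<^sup>+s. discount q s * survive s f y \<partial>lborel)"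

definition resolvent :: "real \<Rightarrow> (nat \<times> real \<Rightarrow> ennreal) \<Rightarrow> nat \<times> real \<Rightarrow> ennreal" where
  "resolvent q f y = (\<integral>\<^sup>+t. discount q t * trans_op t f y \<partial>lborel)"

text \<open>The potential of a bounded time window. For \<open>f \<le> 1\<close> it is at most
  \<open>t\<close>, so unlike \<open>resolvent 0\<close> it can be cancelled in equations.\<close>

definition occupied :: "real \<Rightarrow> (nat \<times> real \<Rightarrow> ennreal) \<Rightarrow> nat \<times> real \<Rightarrow> ennreal" where
  "occupied t f y = (\<integral>\<^sup>+s. indicator {0..t} s * trans_op s f y \<partial>lborel)"

lemma borel_measurable_discount [measurable]: "discount q \<in> borel_measurable borel"
  unfolding discount_def by measurable

lemma measurable_sojourn [measurable (raw)]:
  assumes f: "(\<lambda>p. f (fst p) (snd p)) \<in> borel_measurable (M \<Otimes>\<^sub>M SB)"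
    and [measurable]: "h \<in> measurable M SB"
  shows "(\<lambda>x. sojourn q (f x) (h x)) \<in> borel_measurable M"
proof -
  have [measurable]: "(\<lambda>p. f (fst (fst p)) (snd p)) \<in> borel_measurable ((M \<Otimes>\<^sub>M lborel) \<Otimes>\<^sub>M SB)"
    by (rule measurable_param[OF f]) measurable
  show ?thesis unfolding sojourn_def by measurable
qed

lemma measurable_resolvent [measurable (raw)]:
  assumes f: "(\<lambda>p. f (fst p) (snd p)) \<in> borel_measurable (M \<Otimes>\<^sub>M SB)"
    and [measurable]: "h \<in> measurable M SB"
  shows "(\<lambda>x. resolvent q (f x) (h x)) \<in> borel_measurable M"
proof -
  have [measurable]: "(\<lambda>p. f (fst (fst p)) (snd p)) \<in> borel_measurable ((M \<Otimes>\<^sub>M lborel) \<Otimes>\<^sub>M SB)"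
    by (rule measurable_param[OF f]) measurable
  show ?thesis unfolding resolvent_def by measurable
qed

lemma measurable_occupied [measurable (raw)]:
  assumes f: "(\<lambda>p. f (fst p) (snd p)) \<in> borel_measurable (M \<Otimes>\<^sub>M SB)"
    and [measurable]: "h \<in> measurable M SB"
  shows "(\<lambda>x. occupied t (f x) (h x)) \<in> borel_measurable M"
proof -
  have [measurable]: "(\<lambda>p. f (fst (fst p)) (snd p)) \<in> borel_measurable ((M \<Otimes>\<^sub>M lborel) \<Otimes>\<^sub>M SB)"
    by (rule measurable_param[OF f]) measurable
  show ?thesis unfolding occupied_def by measurable
qed

lemma space_SB [simp]: "space SB = UNIV"
  by (simp add: space_pair_measure)

lemma kernel_op_trans_op: "kernel_op SB (trans_op t)"
  unfolding kernel_op_def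
proof (intro conjI ballI allI)
  fix y
  have "(\<lambda>\<omega>. Y (clamp y) t \<omega>) \<in> measurable noise SB"
    by (rule measurable_Y) (auto simp: clamp_mem)
  then show "integral_functional SB (\<lambda>f. trans_op t f y)"
    unfolding integral_functional_def trans_op_def
    by (intro exI[of _ "distr noise SB (\<lambda>\<omega>. Y (clamp y) t \<omega>)"]) (auto simp: nn_integral_distr)
next
  fix f :: "nat \<times> real \<Rightarrow> ennreal" assume [measurable]: "f \<in> borel_measurable SB"
  show "trans_op t f \<in> borel_measurable SB" by measurable
qed

lemma kernel_op_jump_op: "kernel_op SB jump_op"
  unfolding kernel_op_def
proof (intro conjI ballI allI)
  fix y
  have [measurable]: "jump y \<in> measurable G SB" by measurable
  show "integral_functional SB (\<lambda>f. jump_op f y)"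
    unfolding integral_functional_def jump_op_def
    by (intro exI[of _ "scale_measure (ennreal (snd y)) (distr G SB (jump y))"])
       (auto simp: nn_integral_distr nn_integral_scale_measure)
next
  fix f :: "nat \<times> real \<Rightarrow> ennreal" assume [measurable]: "f \<in> borel_measurable SB"
  show "jump_op f \<in> borel_measurable SB" by measurable
qed

lemma kernel_op_sojourn: "kernel_op SB (sojourn q)"
  unfolding kernel_op_def
proof (intro conjI ballI allI)
  fix y
  have [measurable]: "drift y \<in> measurable borel SB" by measurable
  have [measurable]: "(\<lambda>s. cum (snd y) s) \<in> borel_measurable borel" by measurable
  let ?w = "\<lambda>s. discount q s * ennreal (exp (- cum (snd y) s))"
  show "integral_functional SB (\<lambda>f. sojourn q f y)"
    unfolding integral_functional_def sojourn_def survive_def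
    by (intro exI[of _ "distr (density lborel ?w) SB (drift y)"])
       (auto simp: nn_integral_distr nn_integral_density mult_ac)
next
  fix f :: "nat \<times> real \<Rightarrow> ennreal" assume [measurable]: "f \<in> borel_measurable SB"
  show "sojourn q f \<in> borel_measurable SB" by measurable
qed

lemma survive_mono:
  assumes "\<And>y. y \<in> states \<Longrightarrow> f y \<le> g y" "y \<in> states" "0 \<le> s"
  shows "survive s f y \<le> survive s g y"
  unfolding survive_def by (intro mult_left_mono assms drift_mem) auto

lemma sojourn_mono:
  assumes "\<And>y. y \<in> states \<Longrightarrow> f y \<le> g y" "y \<in> states"
  shows "sojourn q f y \<le> sojourn q g y"
  unfolding sojourn_def
proof (intro nn_integral_mono)
  fix s show "discount q s * survive s f y \<le> discount q s * survive s g y"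
    using survive_mono[of f g y s] assms
    by (cases "0 \<le> s") (auto simp: discount_def intro!: mult_left_mono)
qed

lemma jump_op_mono:
  assumes "\<And>y. y \<in> states \<Longrightarrow> f y \<le> g y" "y \<in> states"
  shows "jump_op f y \<le> jump_op g y"
  unfolding jump_op_def
  by (intro mult_left_mono nn_integral_mono assms jump_mem) (auto simp: space_G)

lemma sojourn_cong:
  assumes "\<And>y. y \<in> states \<Longrightarrow> f y = g y" "y \<in> states"
  shows "sojourn q f y = sojourn q g y"
  using assms by (intro antisym sojourn_mono) auto

lemma survive_survive: "survive s (survive t f) y = survive (s + t) f y"
proof -
  have "ennreal (exp (- cum (snd y) s)) * ennreal (exp (- cum (flow (snd y) s) t)) =
      ennreal (exp (- cum (snd y) (s + t)))"
    unfolding cum_add by (simp add: mult_exp_exp flip: ennreal_mult')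
  then show ?thesis
    by (simp add: survive_def drift_add mult.assoc[symmetric]) (simp add: drift_eq)
qed

section \<open>Interchanging the operators with integrals over time\<close>

lemma survive_integral:
  fixes g :: "real \<Rightarrow> nat \<times> real \<Rightarrow> ennreal"
  assumes "(\<lambda>p. g (fst p) (snd p)) \<in> borel_measurable (borel \<Otimes>\<^sub>M SB)"
  shows "survive s (\<lambda>y. \<integral>\<^sup>+r. g r y \<partial>lborel) y = (\<integral>\<^sup>+r. survive s (g r) y \<partial>lborel)"
proof -
  have "(\<lambda>r. g r (drift y s)) \<in> borel_measurable borel"
    by (rule measurable_param[OF assms]) measurable
  then show ?thesis unfolding survive_def by (subst nn_integral_cmult) auto
qed

lemma jump_op_integral:
  fixes g :: "real \<Rightarrow> nat \<times> real \<Rightarrow> ennreal"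
  assumes g: "(\<lambda>p. g (fst p) (snd p)) \<in> borel_measurable (borel \<Otimes>\<^sub>M SB)"
  shows "jump_op (\<lambda>y. \<integral>\<^sup>+r. g r y \<partial>lborel) y = (\<integral>\<^sup>+r. jump_op (g r) y \<partial>lborel)"
proof -
  interpret G: prob_space G by (rule prob_space_G)
  interpret pair_sigma_finite lborel G ..
  have [measurable]: "(\<lambda>p. g (fst p) (jump y (snd p))) \<in> borel_measurable (lborel \<Otimes>\<^sub>M G)"
    by (rule measurable_param[OF g]) measurable
  have "(\<integral>\<^sup>+z. \<integral>\<^sup>+r. g r (jump y z) \<partial>lborel \<partial>G) = (\<integral>\<^sup>+r. \<integral>\<^sup>+z. g r (jump y z) \<partial>G \<partial>lborel)"
    by (rule Fubini') (simp add: split_beta')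
  then show ?thesis unfolding jump_op_def by (subst nn_integral_cmult) auto
qed

lemma sojourn_integral:
  fixes g :: "real \<Rightarrow> nat \<times> real \<Rightarrow> ennreal"
  assumes g: "(\<lambda>p. g (fst p) (snd p)) \<in> borel_measurable (borel \<Otimes>\<^sub>M SB)"
  shows "sojourn q (\<lambda>y. \<integral>\<^sup>+r. g r y \<partial>lborel) y = (\<integral>\<^sup>+r. sojourn q (g r) y \<partial>lborel)"
proof -
  have [measurable]: "(\<lambda>p. g (fst p) (drift y (snd p))) \<in> borel_measurable (lborel \<Otimes>\<^sub>M lborel)"
    by (rule measurable_param[OF g]) measurable
  have [measurable]: "(\<lambda>p. survive (snd p) (g (fst p)) y) \<in> borel_measurable (lborel \<Otimes>\<^sub>M lborel)"
    unfolding survive_def by measurable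
  have [measurable]: "(\<lambda>r. g r (drift y s)) \<in> borel_measurable borel" for s
    by (rule measurable_param[OF g]) measurable
  have [measurable]: "(\<lambda>r. survive s (g r) y) \<in> borel_measurable borel" for s
    unfolding survive_def by measurable
  have "sojourn q (\<lambda>y. \<integral>\<^sup>+r. g r y \<partial>lborel) y =
      (\<integral>\<^sup>+s. \<integral>\<^sup>+r. discount q s * survive s (g r) y \<partial>lborel \<partial>lborel)"
    unfolding sojourn_def survive_integral[OF g] by (subst nn_integral_cmult) auto
  also have "\<dots> = (\<integral>\<^sup>+r. \<integral>\<^sup>+s. discount q s * survive s (g r) y \<partial>lborel \<partial>lborel)"
    by (rule lborel_pair.Fubini') (simp add: split_beta', measurable)
  finally show ?thesis by (simp add: sojourn_def)
qed

lemma measurable_weighted: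
  fixes g :: "real \<Rightarrow> nat \<times> real \<Rightarrow> ennreal"
  assumes g: "(\<lambda>p. g (fst p) (snd p)) \<in> borel_measurable (borel \<Otimes>\<^sub>M SB)"
    and [measurable]: "w \<in> borel_measurable borel"
  shows "(\<lambda>p. w (fst p) * g (fst p) (snd p)) \<in> borel_measurable (borel \<Otimes>\<^sub>M SB)"
  by (intro borel_measurable_times_ennreal g) measurable

lemma section_measurable:
  fixes g :: "real \<Rightarrow> nat \<times> real \<Rightarrow> ennreal"
  assumes g: "(\<lambda>p. g (fst p) (snd p)) \<in> borel_measurable (borel \<Otimes>\<^sub>M SB)"
  shows "g r \<in> borel_measurable SB"
  by (rule measurable_param[OF g]) measurable

lemma jump_op_weighted_integral:
  fixes g :: "real \<Rightarrow> nat \<times> real \<Rightarrow> ennreal"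
  assumes g: "(\<lambda>p. g (fst p) (snd p)) \<in> borel_measurable (borel \<Otimes>\<^sub>M SB)"
    and w: "w \<in> borel_measurable borel"
  shows "jump_op (\<lambda>y. \<integral>\<^sup>+r. w r * g r y \<partial>lborel) = (\<lambda>y. \<integral>\<^sup>+r. w r * jump_op (g r) y \<partial>lborel)"
  by (rule ext, subst jump_op_integral[OF measurable_weighted[OF g w]])
     (simp add: kernel_op_cmult[OF kernel_op_jump_op section_measurable[OF g]])

lemma survive_cmult: "survive s (\<lambda>y. c * f y) y = c * survive s f y"
  by (simp add: survive_def mult_ac)

lemma survive_jump_op_weighted_integral:
  fixes g :: "real \<Rightarrow> nat \<times> real \<Rightarrow> ennreal"
  assumes g: "(\<lambda>p. g (fst p) (snd p)) \<in> borel_measurable (borel \<Otimes>\<^sub>M SB)"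
    and w: "w \<in> borel_measurable borel"
  shows "survive s (jump_op (\<lambda>y. \<integral>\<^sup>+r. w r * g r y \<partial>lborel)) y =
    (\<integral>\<^sup>+r. w r * survive s (jump_op (g r)) y \<partial>lborel)"
proof -
  have "(\<lambda>p. g (fst (fst p)) (snd p)) \<in> borel_measurable ((borel \<Otimes>\<^sub>M SB) \<Otimes>\<^sub>M SB)"
    by (rule measurable_param[OF g]) measurable
  then have m: "(\<lambda>p. jump_op (g (fst p)) (snd p)) \<in> borel_measurable (borel \<Otimes>\<^sub>M SB)"
    by measurable
  show ?thesis
    unfolding jump_op_weighted_integral[OF g w] survive_integral[OF measurable_weighted[OF m w]]
    by (simp add: survive_cmult)
qed

lemma sojourn_jump_op_weighted_integral:
  fixes g :: "real \<Rightarrow> nat \<times> real \<Rightarrow> ennreal"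
  assumes g: "(\<lambda>p. g (fst p) (snd p)) \<in> borel_measurable (borel \<Otimes>\<^sub>M SB)"
    and w: "w \<in> borel_measurable borel"
  shows "sojourn q (jump_op (\<lambda>y. \<integral>\<^sup>+r. w r * g r y \<partial>lborel)) y =
    (\<integral>\<^sup>+r. w r * sojourn q (jump_op (g r)) y \<partial>lborel)"
proof -
  have "(\<lambda>p. g (fst (fst p)) (snd p)) \<in> borel_measurable ((borel \<Otimes>\<^sub>M SB) \<Otimes>\<^sub>M SB)"
    by (rule measurable_param[OF g]) measurable
  then have m: "(\<lambda>p. jump_op (g (fst p)) (snd p)) \<in> borel_measurable (borel \<Otimes>\<^sub>M SB)"
    by measurable
  show ?thesis
    unfolding jump_op_weighted_integral[OF g w] sojourn_integral[OF measurable_weighted[OF m w]]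
    by (simp add: kernel_op_cmult[OF kernel_op_sojourn section_measurable[OF m]])
qed

text \<open>The discounted time integral of the renewal equation. Since \<open>exp (- q * t)\<close>
  splits into the discounts of \<open>s\<close> and \<open>t - s\<close>, the integral over the
  triangle factorises.\<close>

lemma resolvent_first_jump:
  assumes y: "y \<in> states" and [measurable]: "f \<in> borel_measurable SB"
  shows "resolvent q f y = sojourn q f y + sojourn q (jump_op (resolvent q f)) y"
proof -
  let ?k = "\<lambda>s r. ennreal (exp (- q * s)) * (ennreal (exp (- q * r)) * survive s (jump_op (trans_op r f)) y)"
  have "resolvent q f y = (\<integral>\<^sup>+t. discount q t * survive t f y +
      discount q t * (\<integral>\<^sup>+s\<in>{0..t}. survive s (jump_op (trans_op (t - s) f)) y \<partial>lborel) \<partial>lborel)"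
    unfolding resolvent_def
  proof (intro nn_integral_cong)
    fix t :: real
    show "discount q t * trans_op t f y = discount q t * survive t f y +
      discount q t * (\<integral>\<^sup>+s\<in>{0..t}. survive s (jump_op (trans_op (t - s) f)) y \<partial>lborel)"
      using renewal[OF y, of t f] by (cases "0 \<le> t") (auto simp: discount_def distrib_left)
  qed
  also have "\<dots> = sojourn q f y + (\<integral>\<^sup>+t. discount q t *
      (\<integral>\<^sup>+s\<in>{0..t}. survive s (jump_op (trans_op (t - s) f)) y \<partial>lborel) \<partial>lborel)"
    unfolding sojourn_def by (intro nn_integral_add) measurable
  also have "(\<integral>\<^sup>+t. discount q t * (\<integral>\<^sup>+s\<in>{0..t}. survive s (jump_op (trans_op (t - s) f)) y \<partial>lborel) \<partial>lborel)
      = (\<integral>\<^sup>+t\<in>{0..}. (\<integral>\<^sup>+s\<in>{0..t}. ?k s (t - s) \<partial>lborel) \<partial>lborel)"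
  proof (rule nn_integral_cong)
    fix t :: real
    have "exp (- q * s) * exp (- q * (t - s)) = exp (- q * t)" for s
      by (simp add: algebra_simps flip: exp_add)
    then have "?k s (t - s) = ennreal (exp (- q * t)) * survive s (jump_op (trans_op (t - s) f)) y" for s
      by (simp add: mult.assoc[symmetric] flip: ennreal_mult')
    then have "(\<integral>\<^sup>+s\<in>{0..t}. ?k s (t - s) \<partial>lborel) =
        ennreal (exp (- q * t)) * (\<integral>\<^sup>+s\<in>{0..t}. survive s (jump_op (trans_op (t - s) f)) y \<partial>lborel)"
      by (subst nn_integral_cmult[symmetric], measurable) (simp add: mult.assoc)
    then show "discount q t * (\<integral>\<^sup>+s\<in>{0..t}. survive s (jump_op (trans_op (t - s) f)) y \<partial>lborel) =
        (\<integral>\<^sup>+s\<in>{0..t}. ?k s (t - s) \<partial>lborel) * indicator {0..} t"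
      by (simp add: discount_def mult_ac)
  qed
  also have "\<dots> = (\<integral>\<^sup>+s\<in>{0..}. (\<integral>\<^sup>+r\<in>{0..}. ?k s r \<partial>lborel) \<partial>lborel)"
    by (rule nn_integral_triangle) measurable
  also have "\<dots> = sojourn q (jump_op (resolvent q f)) y"
    unfolding sojourn_def
  proof (rule nn_integral_cong)
    fix s :: real
    have "(\<integral>\<^sup>+r\<in>{0..}. ?k s r \<partial>lborel) = (\<integral>\<^sup>+r. ennreal (exp (- q * s)) *
        (discount q r * survive s (jump_op (trans_op r f)) y) \<partial>lborel)"
      by (simp add: discount_def mult_ac)
    also have "\<dots> = ennreal (exp (- q * s)) * (\<integral>\<^sup>+r. discount q r * survive s (jump_op (trans_op r f)) y \<partial>lborel)"
      by (rule nn_integral_cmult) measurable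
    also have "(\<integral>\<^sup>+r. discount q r * survive s (jump_op (trans_op r f)) y \<partial>lborel) =
        survive s (jump_op (resolvent q f)) y"
      unfolding resolvent_def[abs_def] by (subst survive_jump_op_weighted_integral) auto
    finally show "(\<integral>\<^sup>+r\<in>{0..}. ?k s r \<partial>lborel) * indicator {0..} s =
        discount q s * survive s (jump_op (resolvent q f)) y"
      by (simp add: discount_def mult_ac)
  qed
  finally show ?thesis .
qed

lemma sojourn_survive:
  assumes "0 \<le> t" and [measurable]: "f \<in> borel_measurable SB"
  shows "sojourn 0 (survive t f) y = (\<integral>\<^sup>+u. indicator {t..} u * survive u f y \<partial>lborel)"
proof -
  have "(\<integral>\<^sup>+u. indicator {t..} u * survive u f y \<partial>lborel) =
      (\<integral>\<^sup>+s. indicator {t..} (t + s) * survive (t + s) f y \<partial>lborel)"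
    by (subst nn_integral_real_affine[where c = 1 and t = t]) auto
  also have "\<dots> = sojourn 0 (survive t f) y"
    unfolding sojourn_def survive_survive discount_def
    by (intro nn_integral_cong) (auto simp: indicator_def add.commute)
  finally show ?thesis ..
qed

lemma nn_integral_split_at:
  fixes h :: "real \<Rightarrow> ennreal"
  assumes "0 \<le> t" and [measurable]: "h \<in> borel_measurable borel"
  shows "(\<integral>\<^sup>+u. indicator {t..} u * h u \<partial>lborel) + (\<integral>\<^sup>+u. indicator {0..t} u * h u \<partial>lborel) =
    (\<integral>\<^sup>+u. discount 0 u * h u \<partial>lborel)"
proof -
  have "(\<integral>\<^sup>+u. indicator {t..} u * h u \<partial>lborel) + (\<integral>\<^sup>+u. indicator {0..t} u * h u \<partial>lborel) =
      (\<integral>\<^sup>+u. indicator {t..} u * h u + indicator {0..t} u * h u \<partial>lborel)"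
    by (rule nn_integral_add[symmetric]) measurable
  also have "\<dots> = (\<integral>\<^sup>+u. discount 0 u * h u \<partial>lborel)"
  proof (rule nn_integral_cong_AE)
    have "AE u in lborel. u \<noteq> t" by (rule AE_lborel_singleton)
    then show "AE u in lborel. indicator {t..} u * h u + indicator {0..t} u * h u = discount 0 u * h u"
      by eventually_elim (use assms(1) in \<open>auto simp: discount_def indicator_def\<close>)
  qed
  finally show ?thesis .
qed

text \<open>Shifting time by \<open>t\<close> along the flow up to the next jump loses a window of
  length \<open>t\<close> at the start and gains one after the jump. The renewal equation is used
  under \<open>sojourn 0\<close> and under the time integral of \<open>occupied\<close>; the first
  leaves jump times \<open>u \<ge> s\<close>, the second \<open>u \<le> s\<close>, and together they
  form the whole half-line.\<close>

lemma occupied_first_jump: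
  assumes y: "y \<in> states" and t: "0 \<le> t" and [measurable]: "f \<in> borel_measurable SB"
  shows "sojourn 0 (trans_op t f) y + occupied t f y =
    sojourn 0 f y + sojourn 0 (jump_op (occupied t f)) y"
proof -
  \<comment> \<open>The contribution of a first jump at time \<open>u\<close> followed by evolution
    for a time \<open>r\<close>.\<close>
  define k where "k = (\<lambda>u r. survive u (jump_op (trans_op r f)) y)"
  have k: "(\<lambda>p. k (fst p) (snd p)) \<in> borel_measurable (borel \<Otimes>\<^sub>M borel)"
    unfolding k_def by measurable
  have [measurable (raw)]: "(\<lambda>x. k (f x) (g x)) \<in> borel_measurable N"
    if [measurable]: "f \<in> borel_measurable N" "g \<in> borel_measurable N" for f g and N :: "'b measure"
    by (rule measurable_param[OF k]) measurable
  have "sojourn 0 (trans_op t f) y = sojourn 0 (\<lambda>y. survive t f y +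
      (\<integral>\<^sup>+s. indicator {0..t} s * survive s (jump_op (trans_op (t - s) f)) y \<partial>lborel)) y"
    by (rule sojourn_cong[OF _ y]) (simp add: renewal[OF _ t] mult.commute)
  also have "\<dots> = sojourn 0 (survive t f) y + sojourn 0 (\<lambda>y.
      \<integral>\<^sup>+s. indicator {0..t} s * survive s (jump_op (trans_op (t - s) f)) y \<partial>lborel) y"
    by (intro kernel_op_add[OF kernel_op_sojourn]) measurable
  also have "sojourn 0 (\<lambda>y. \<integral>\<^sup>+s. indicator {0..t} s * survive s (jump_op (trans_op (t - s) f)) y \<partial>lborel) y
      = (\<integral>\<^sup>+s. sojourn 0 (\<lambda>y. indicator {0..t} s * survive s (jump_op (trans_op (t - s) f)) y) y \<partial>lborel)"
    by (rule sojourn_integral) measurable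
  also have "\<dots> = (\<integral>\<^sup>+s. indicator {0..t} s * (\<integral>\<^sup>+u. indicator {s..} u * k u (t - s) \<partial>lborel) \<partial>lborel)"
  proof (rule nn_integral_cong)
    fix s :: real
    have "sojourn 0 (\<lambda>y. indicator {0..t} s * survive s (jump_op (trans_op (t - s) f)) y) y =
      indicator {0..t} s * sojourn 0 (survive s (jump_op (trans_op (t - s) f))) y"
      by (rule kernel_op_cmult[OF kernel_op_sojourn]) measurable
    then show "sojourn 0 (\<lambda>y. indicator {0..t} s * survive s (jump_op (trans_op (t - s) f)) y) y =
      indicator {0..t} s * (\<integral>\<^sup>+u. indicator {s..} u * k u (t - s) \<partial>lborel)"
      unfolding k_def by (cases "0 \<le> s") (auto simp: sojourn_survive)
  qed
  finally have 1: "sojourn 0 (trans_op t f) y = sojourn 0 (survive t f) y +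
    (\<integral>\<^sup>+s. indicator {0..t} s * (\<integral>\<^sup>+u. indicator {s..} u * k u (t - s) \<partial>lborel) \<partial>lborel)" .

  have "occupied t f y = (\<integral>\<^sup>+s. indicator {0..t} s * survive s f y +
      (\<integral>\<^sup>+u\<in>{0..s}. k u (s - u) \<partial>lborel) * indicator {0..t} s \<partial>lborel)"
    unfolding occupied_def k_def
    by (intro nn_integral_cong) (auto simp: renewal[OF y] indicator_def)
  also have "\<dots> = (\<integral>\<^sup>+s. indicator {0..t} s * survive s f y \<partial>lborel) +
      (\<integral>\<^sup>+s\<in>{0..t}. (\<integral>\<^sup>+u\<in>{0..s}. k u (s - u) \<partial>lborel) \<partial>lborel)"
    by (intro nn_integral_add) measurable
  also note nn_integral_triangle_flip[OF k]
  finally have 2: "occupied t f y = (\<integral>\<^sup>+s. indicator {0..t} s * survive s f y \<partial>lborel) +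
      (\<integral>\<^sup>+s\<in>{0..t}. (\<integral>\<^sup>+u\<in>{0..s}. k u (t - s) \<partial>lborel) \<partial>lborel)" .

  have 3: "sojourn 0 (survive t f) y + (\<integral>\<^sup>+s. indicator {0..t} s * survive s f y \<partial>lborel) = sojourn 0 f y"
    unfolding sojourn_survive[OF t assms(3)]
    by (subst nn_integral_split_at[OF t]) (auto simp: sojourn_def)

  have "(\<integral>\<^sup>+s. indicator {0..t} s * (\<integral>\<^sup>+u. indicator {s..} u * k u (t - s) \<partial>lborel) \<partial>lborel) +
      (\<integral>\<^sup>+s\<in>{0..t}. (\<integral>\<^sup>+u\<in>{0..s}. k u (t - s) \<partial>lborel) \<partial>lborel) =
      (\<integral>\<^sup>+s. indicator {0..t} s * (\<integral>\<^sup>+u. indicator {s..} u * k u (t - s) \<partial>lborel) +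
        (\<integral>\<^sup>+u\<in>{0..s}. k u (t - s) \<partial>lborel) * indicator {0..t} s \<partial>lborel)"
    by (rule nn_integral_add[symmetric]) measurable
  also have "\<dots> = (\<integral>\<^sup>+s. indicator {0..t} s * sojourn 0 (jump_op (trans_op (t - s) f)) y \<partial>lborel)"
  proof (rule nn_integral_cong)
    fix s :: real
    show "indicator {0..t} s * (\<integral>\<^sup>+u. indicator {s..} u * k u (t - s) \<partial>lborel) +
        (\<integral>\<^sup>+u\<in>{0..s}. k u (t - s) \<partial>lborel) * indicator {0..t} s =
      indicator {0..t} s * sojourn 0 (jump_op (trans_op (t - s) f)) y"
      using nn_integral_split_at[of s "\<lambda>u. k u (t - s)"]
      by (auto simp: indicator_def[of "{0..t}"] sojourn_def k_def mult.commute)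
  qed
  also have "\<dots> = (\<integral>\<^sup>+r. indicator {0..t} r * sojourn 0 (jump_op (trans_op r f)) y \<partial>lborel)"
    by (subst nn_integral_real_affine[where c = "-1" and t = t], measurable)
       (auto intro!: nn_integral_cong simp: indicator_def)
  also have "\<dots> = sojourn 0 (jump_op (occupied t f)) y"
    unfolding occupied_def[abs_def]
    by (rule sojourn_jump_op_weighted_integral[symmetric]) measurable
  finally show ?thesis unfolding 1 2 3[symmetric] by (simp add: ac_simps)
qed

subsection \<open>Climbing without reset\<close>

definition climb_op :: "(nat \<times> real \<Rightarrow> ennreal) \<Rightarrow> nat \<times> real \<Rightarrow> ennreal" where
  "climb_op f y = ennreal (snd y) *
    (\<integral>\<^sup>+z. indicator {z. \<not> resets y z} z * f (Suc (fst y), snd y + l (Suc (fst y)) z) \<partial>G)"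

definition reset_rate :: "nat \<times> real \<Rightarrow> ennreal" where
  "reset_rate y = ennreal (snd y) * (\<integral>\<^sup>+z. indicator {z. resets y z} z \<partial>G)"

text \<open>The transition operator of the chain of states right after jumps, killed at the first
  reset.\<close>

abbreviation (input) climb_chain :: "(nat \<times> real \<Rightarrow> ennreal) \<Rightarrow> nat \<times> real \<Rightarrow> ennreal" where
  "climb_chain \<equiv> \<lambda>f. sojourn 0 (climb_op f)"

lemma measurable_climb_op [measurable (raw)]:
  assumes f: "(\<lambda>p. f (fst p) (snd p)) \<in> borel_measurable (M \<Otimes>\<^sub>M SB)"
    and [measurable]: "h \<in> measurable M SB"
  shows "(\<lambda>x. climb_op (f x) (h x)) \<in> borel_measurable M"
proof -
  interpret G: prob_space G by (rule prob_space_G)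
  have [measurable]: "(\<lambda>q. f (fst q) (Suc (fst (h (fst q))), snd (h (fst q)) + l (Suc (fst (h (fst q)))) (snd q)))
      \<in> borel_measurable (M \<Otimes>\<^sub>M G)"
    by (rule measurable_param[OF f]) measurable
  show ?thesis unfolding climb_op_def by measurable
qed

lemma measurable_reset_rate [measurable]: "reset_rate \<in> borel_measurable SB"
proof -
  interpret G: prob_space G by (rule prob_space_G)
  show ?thesis unfolding reset_rate_def[abs_def] by measurable
qed

lemma kernel_op_climb_op: "kernel_op SB climb_op"
  unfolding kernel_op_def
proof (intro conjI ballI allI)
  fix y
  let ?j = "\<lambda>z. (Suc (fst y), snd y + l (Suc (fst y)) z)"
  have [measurable]: "?j \<in> measurable G SB" by measurable
  have [measurable]: "indicator {z. \<not> resets y z} \<in> borel_measurable G" by measurable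
  show "integral_functional SB (\<lambda>f. climb_op f y)"
    unfolding integral_functional_def climb_op_def
    by (intro exI[of _ "scale_measure (ennreal (snd y)) (distr (density G (indicator {z. \<not> resets y z})) SB ?j)"])
       (auto simp: nn_integral_distr nn_integral_scale_measure nn_integral_density)
next
  fix f :: "nat \<times> real \<Rightarrow> ennreal" assume [measurable]: "f \<in> borel_measurable SB"
  show "climb_op f \<in> borel_measurable SB" by measurable
qed

lemma kernel_op_climb_chain: "kernel_op SB climb_chain"
  by (rule kernel_op_comp[OF kernel_op_sojourn kernel_op_climb_op])

lemmas kernel_op_climb_power = kernel_op_power[OF kernel_op_climb_chain space_SB]

text \<open>Positivity of \<open>l\<close> lifts the intensity strictly above \<open>lo\<close>, and
  the flow never brings it back to \<open>lo\<close>. So the atom is not met again before a reset,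
  and sojourns after a climb have densities.\<close>

lemma climb_mem:
  "y \<in> states \<Longrightarrow> 0 \<le> z \<Longrightarrow> \<not> resets y z \<Longrightarrow> (Suc (fst y), snd y + l (Suc (fst y)) z) \<in> {1..} \<times> {lo<..<A}"
  using l_pos[of "Suc (fst y)" z] by (auto simp: resets_eq)

lemma climb_op_mono:
  assumes "\<And>y. y \<in> {1..} \<times> {lo<..<A} \<Longrightarrow> f y \<le> g y" "y \<in> states"
  shows "climb_op f y \<le> climb_op g y"
  unfolding climb_op_def
proof (intro mult_left_mono[OF nn_integral_mono])
  fix z assume "z \<in> space G"
  then show "indicator {z. \<not> resets y z} z * f (Suc (fst y), snd y + l (Suc (fst y)) z) \<le>
      indicator {z. \<not> resets y z} z * g (Suc (fst y), snd y + l (Suc (fst y)) z)"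
    using assms(1)[OF climb_mem[OF assms(2), of z]] by (cases "resets y z") (auto simp: space_G)
qed simp

lemma climb_op_cong:
  assumes "\<And>y. y \<in> {1..} \<times> {lo<..<A} \<Longrightarrow> f y = g y" "y \<in> states"
  shows "climb_op f y = climb_op g y"
  using assms by (intro antisym climb_op_mono) auto

lemma climb_power_mono:
  assumes "\<And>y. y \<in> states \<Longrightarrow> f y \<le> g y" "y \<in> states"
  shows "(climb_chain ^^ m) f y \<le> (climb_chain ^^ m) g y"
  using assms(2)
proof (induction m arbitrary: y)
  case (Suc m)
  then show ?case by (auto intro!: sojourn_mono climb_op_mono)
qed (use assms in auto)

lemma climb_power_cong:
  assumes "\<And>y. y \<in> states \<Longrightarrow> f y = g y" "y \<in> states"
  shows "(climb_chain ^^ m) f y = (climb_chain ^^ m) g y"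
  using assms by (intro antisym climb_power_mono) auto

lemma jump_op_split:
  assumes [measurable]: "f \<in> borel_measurable SB"
  shows "jump_op f y = climb_op f y + reset_rate y * f origin"
proof -
  have "(\<integral>\<^sup>+z. f (jump y z) \<partial>G) =
    (\<integral>\<^sup>+z. indicator {z. \<not> resets y z} z * f (Suc (fst y), snd y + l (Suc (fst y)) z) +
      indicator {z. resets y z} z * f origin \<partial>G)"
    by (intro nn_integral_cong) (auto simp: jump_eq)
  also have "\<dots> = (\<integral>\<^sup>+z. indicator {z. \<not> resets y z} z * f (Suc (fst y), snd y + l (Suc (fst y)) z) \<partial>G) +
      (\<integral>\<^sup>+z. indicator {z. resets y z} z * f origin \<partial>G)"
    by (intro nn_integral_add) measurable
  also have "(\<integral>\<^sup>+z. indicator {z. resets y z} z * f origin \<partial>G) =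
      (\<integral>\<^sup>+z. indicator {z. resets y z} z \<partial>G) * f origin"
    by (intro nn_integral_multc) measurable
  finally show ?thesis
    by (simp add: jump_op_def climb_op_def reset_rate_def distrib_left mult.assoc)
qed

lemma sojourn_jump_op_split:
  assumes [measurable]: "f \<in> borel_measurable SB"
  shows "sojourn q (jump_op f) y = sojourn q (climb_op f) y + sojourn q reset_rate y * f origin"
proof -
  have "jump_op f = (\<lambda>y. climb_op f y + f origin * reset_rate y)"
    by (rule ext) (simp add: jump_op_split mult.commute)
  then have "sojourn q (jump_op f) y = sojourn q (\<lambda>y. climb_op f y + f origin * reset_rate y) y"
    by simp
  also have "\<dots> = sojourn q (climb_op f) y + sojourn q (\<lambda>y. f origin * reset_rate y) y"
    by (intro kernel_op_add[OF kernel_op_sojourn]) measurable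
  also have "sojourn q (\<lambda>y. f origin * reset_rate y) y = f origin * sojourn q reset_rate y"
    by (intro kernel_op_cmult[OF kernel_op_sojourn]) measurable
  finally show ?thesis by (simp add: mult.commute)
qed

lemma jump_op_1: "jump_op (\<lambda>_. 1) y = ennreal (snd y)"
proof -
  interpret G: prob_space G by (rule prob_space_G)
  show ?thesis by (simp add: jump_op_def G.emeasure_space_1)
qed

text \<open>A next jump is certain: after the substitution by \<open>wait\<close>, this is the total
  mass of the exponential law.\<close>

lemma sojourn_jump_op_1:
  assumes y: "y \<in> states" shows "sojourn 0 (jump_op (\<lambda>_. 1)) y = 1"
proof -
  interpret E: prob_space unit_exponential by (rule prob_space_unit_exponential)
  have "1 = emeasure unit_exponential UNIV" using E.emeasure_space_1 by simp
  also have "\<dots> = (\<integral>\<^sup>+e. ennreal (exponential_density 1 e) * 1 \<partial>lborel)"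
    by (simp add: emeasure_density)
  also have "\<dots> = (\<integral>\<^sup>+s\<in>{0..}. ennreal (exp (- cum (snd y) s) * flow (snd y) s) * 1 \<partial>lborel)"
    by (rule nn_integral_wait) (use y in auto)
  also have "\<dots> = sojourn 0 (jump_op (\<lambda>_. 1)) y"
    unfolding sojourn_def
    by (intro nn_integral_cong)
       (auto simp: discount_def survive_def jump_op_1 drift_eq ennreal_mult' indicator_def)
  finally show ?thesis ..
qed

lemma sojourn_climb_op_1:
  assumes "y \<in> states"
  shows "sojourn 0 (climb_op (\<lambda>_. 1)) y + sojourn 0 reset_rate y = 1"
  using sojourn_jump_op_split[of "\<lambda>_. 1" 0 y] sojourn_jump_op_1[OF assms] by simp

lemma climb_power_Suc: "(climb_chain ^^ Suc m) f = (climb_chain ^^ m) (climb_chain f)"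
  by (simp add: funpow_Suc_right del: funpow.simps)

text \<open>The first reset occurs at one of the first \<open>m\<close> jumps or at none of them;
  formally, \<open>sojourn_climb_op_1\<close> telescopes.\<close>

lemma sum_reset_climb_power:
  assumes y: "y \<in> states"
  shows "(\<Sum>k<m. (climb_chain ^^ k) (sojourn 0 reset_rate) y) + (climb_chain ^^ m) (\<lambda>_. 1) y = 1"
proof (induction m)
  case (Suc m)
  have "(climb_chain ^^ m) (\<lambda>_. 1) y =
      (climb_chain ^^ m) (\<lambda>y. sojourn 0 (climb_op (\<lambda>_. 1)) y + sojourn 0 reset_rate y) y"
    by (rule climb_power_cong[OF _ y]) (simp add: sojourn_climb_op_1)
  also have "\<dots> = (climb_chain ^^ m) (sojourn 0 (climb_op (\<lambda>_. 1))) y +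
      (climb_chain ^^ m) (sojourn 0 reset_rate) y"
    by (rule kernel_op_add[OF kernel_op_climb_power]) measurable
  finally show ?case using Suc by (simp add: climb_power_Suc ac_simps del: funpow.simps)
qed simp

lemma origin_mem: "origin \<in> states"
  using lo_less_A by simp

lemma origin_SB [measurable]: "{origin} \<in> sets SB"
proof -
  have "{0::nat} \<times> {lo} \<in> sets SB" by (intro pair_measureI) auto
  then show ?thesis by simp
qed

subsection \<open>The probability of no reset\<close>

lemma measurable_pre_jump [measurable]:
  assumes "y \<in> states" shows "(\<lambda>\<omega>. pre_jump y \<omega> k) \<in> measurable noise SB"
proof -
  have [measurable]: "(\<lambda>\<omega>. post_jump y \<omega> k) \<in> measurable noise SB"
    by (rule measurable_post_jump) (use assms in auto)
  have [measurable]: "(\<lambda>\<omega>. wait (snd (post_jump y \<omega> k)) (fst (\<omega> k))) \<in> borel_measurable noise"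
    by (rule borel_measurable_wait) (use post_jump_mem[OF assms] in \<open>auto simp: mem_Times_iff\<close>)
  show ?thesis unfolding pre_jump_eq by measurable
qed

text \<open>The link between the path-wise notion of reset behind \<open>T_A\<close> and the
  operators: splitting off the first jump turns the event into one for the shifted noise with one
  jump less. The initial state is generalised because the induction restarts from the state after
  that jump.\<close>

lemma nn_integral_no_reset:
  assumes "y \<in> states"
  shows "(\<integral>\<^sup>+\<omega>. indicator {\<omega>. \<forall>k<m. \<not> resets (pre_jump y \<omega> k) (snd (\<omega> k))} \<omega> \<partial>noise) =
    (climb_chain ^^ m) (\<lambda>_. 1) y"
  using assms
proof (induction m arbitrary: y)
  case 0
  interpret prob_space noise by (rule prob_space_noise)
  show ?case by (simp add: emeasure_space_1)
next
  case (Suc m)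
  define x where "x = snd y"
  have x: "lo \<le> x" using Suc.prems by (auto simp: x_def)
  note [measurable] = measurable_pre_jump[OF Suc.prems]
  define h where "h = (climb_chain ^^ m) (\<lambda>_. 1)"
  have [measurable]: "h \<in> borel_measurable SB"
    unfolding h_def by (rule kernel_op_measurable[OF kernel_op_climb_power]) simp
  define g where "g = (\<lambda>p. indicator {z. \<not> resets (drift y (fst p)) z} (snd p) *
    h (jump (drift y (fst p)) (snd p)))"
  have [measurable]: "g \<in> borel_measurable (borel \<Otimes>\<^sub>M G)" unfolding g_def by measurable
  have "(\<integral>\<^sup>+\<omega>. indicator {\<omega>. \<forall>k<Suc m. \<not> resets (pre_jump y \<omega> k) (snd (\<omega> k))} \<omega> \<partial>noise) =
    (\<integral>\<^sup>+a. \<integral>\<^sup>+\<omega>. indicator {\<omega>. \<forall>k<Suc m. \<not> resets (pre_jump y \<omega> k) (snd (\<omega> k))} (case_nat a \<omega>) \<partial>noise \<partial>mark)"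
    by (rule nn_integral_noise) measurable
  also have "\<dots> = (\<integral>\<^sup>+a. g (wait x (fst a), snd a) \<partial>mark)"
  proof (intro nn_integral_cong)
    fix a assume "a \<in> space mark"
    then have a: "0 \<le> snd a" by (auto simp: space_mark)
    define w where "w = wait (snd y) (fst a)"
    have w: "0 \<le> w" using x unfolding w_def x_def by (rule wait_nonneg)
    define y' where "y' = jump (drift y w) (snd a)"
    have y': "y' \<in> states" unfolding y'_def by (intro jump_mem drift_mem Suc.prems a w)
    note shift = shift_jump_chain[OF w_def y'_def]
    have pre0: "pre_jump y (case_nat a \<omega>) 0 = drift y w" for \<omega>
      by (simp add: pre_jump_eq w_def)
    have pre: "pre_jump y (case_nat a \<omega>) (Suc k) = pre_jump y' \<omega> k" for \<omega> k
      by (simp add: pre_jump_eq shift)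
    note [measurable] = measurable_pre_jump[OF y']
    have "(\<integral>\<^sup>+\<omega>. indicator {\<omega>. \<forall>k<Suc m. \<not> resets (pre_jump y \<omega> k) (snd (\<omega> k))} (case_nat a \<omega>) \<partial>noise) =
      (\<integral>\<^sup>+\<omega>. indicator {z. \<not> resets (drift y w) z} (snd a) *
        indicator {\<omega>. \<forall>k<m. \<not> resets (pre_jump y' \<omega> k) (snd (\<omega> k))} \<omega> \<partial>noise)"
      by (intro nn_integral_cong) (simp add: indicator_def All_less_Suc2 pre0 pre)
    also have "\<dots> = indicator {z. \<not> resets (drift y w) z} (snd a) * h y'"
      unfolding h_def Suc.IH[OF y', symmetric] by (rule nn_integral_cmult) measurable
    finally show "(\<integral>\<^sup>+\<omega>. indicator {\<omega>. \<forall>k<Suc m. \<not> resets (pre_jump y \<omega> k) (snd (\<omega> k))} (case_nat a \<omega>) \<partial>noise) =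
      g (wait x (fst a), snd a)"
      by (simp add: g_def y'_def w_def x_def)
  qed
  also have "\<dots> = (\<integral>\<^sup>+s\<in>{0..}. ennreal (exp (- cum x s) * flow x s) * (\<integral>\<^sup>+z. g (s, z) \<partial>G) \<partial>lborel)"
    by (rule nn_integral_first_jump[OF x]) measurable
  also have "\<dots> = sojourn 0 (climb_op h) y"
    unfolding sojourn_def
  proof (intro nn_integral_cong)
    fix s
    have "(\<integral>\<^sup>+z. g (s, z) \<partial>G) = (\<integral>\<^sup>+z. indicator {z. \<not> resets (drift y s) z} z *
        h (Suc (fst y), flow x s + l (Suc (fst y)) z) \<partial>G)"
      by (intro nn_integral_cong) (auto simp: g_def indicator_def jump_eq drift_eq x_def)
    moreover have "ennreal (exp (- cum x s) * flow x s) = ennreal (exp (- cum x s)) * ennreal (flow x s)"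
      by (intro ennreal_mult') simp
    ultimately show "ennreal (exp (- cum x s) * flow x s) * (\<integral>\<^sup>+z. g (s, z) \<partial>G) * indicator {0..} s =
        discount 0 s * survive s (climb_op h) y"
      by (simp add: discount_def survive_def climb_op_def drift_eq x_def mult_ac)
  qed
  finally show ?case by (simp add: h_def)
qed

subsection \<open>Levels\<close>

text \<open>The factors of \<open>climb_chain\<close> in the opposite order. Acting on measures,
  \<open>climb_chain\<close> maps the law of the state after one jump to that after the next, while
  \<open>step_op\<close> maps the occupation measure of one level to that of the next.\<close>

definition step_op :: "(nat \<times> real \<Rightarrow> ennreal) \<Rightarrow> nat \<times> real \<Rightarrow> ennreal" where
  "step_op f = climb_op (sojourn 0 f)"

lemma kernel_op_step_op: "kernel_op SB step_op"
  using kernel_op_comp[OF kernel_op_climb_op kernel_op_sojourn[of 0]]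
  by (simp add: step_op_def[abs_def])

lemmas kernel_op_step_power = kernel_op_power[OF kernel_op_step_op space_SB]

lemma sojourn_step_power: "sojourn 0 ((step_op ^^ k) f) = (climb_chain ^^ k) (sojourn 0 f)"
proof (induction k)
  case (Suc k)
  then show ?case by (simp add: step_op_def)
qed simp

lemma sojourn_level_mono:
  assumes "\<And>x. x \<in> {lo..<A} \<Longrightarrow> f (n, x) \<le> g (n, x)" "x \<in> {lo..<A}"
  shows "sojourn q f (n, x) \<le> sojourn q g (n, x)"
  unfolding sojourn_def
proof (intro nn_integral_mono)
  fix s
  have "survive s f (n, x) \<le> survive s g (n, x)" if "0 \<le> s"
    unfolding survive_def drift_pair
    by (intro mult_left_mono assms(1) flow_mem assms(2) that) simp
  then show "discount q s * survive s f (n, x) \<le> discount q s * survive s g (n, x)"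
    by (cases "0 \<le> s") (auto simp: discount_def intro!: mult_left_mono)
qed

lemma climb_op_level_mono:
  assumes "\<And>x. x \<in> {lo<..<A} \<Longrightarrow> f (Suc n, x) \<le> g (Suc n, x)" "x \<in> {lo..<A}"
  shows "climb_op f (n, x) \<le> climb_op g (n, x)"
  unfolding climb_op_def
proof (intro mult_left_mono[OF nn_integral_mono])
  fix z assume "z \<in> space G"
  then show "indicator {z. \<not> resets (n, x) z} z *
        f (Suc (fst (n, x)), snd (n, x) + l (Suc (fst (n, x))) z) \<le>
      indicator {z. \<not> resets (n, x) z} z *
        g (Suc (fst (n, x)), snd (n, x) + l (Suc (fst (n, x))) z)"
    using assms(1)[of "x + l (Suc n) z"] climb_mem[of "(n, x)" z] assms(2)
    by (cases "resets (n, x) z") (auto simp: space_G)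
qed simp

text \<open>From level \<open>n\<close>, \<open>k\<close> jumps without reset lead to level
  \<open>n + k\<close> and nowhere else, so only the values there matter.\<close>

lemma climb_power_level_mono:
  assumes "\<And>x. x \<in> {lo..<A} \<Longrightarrow> f (n + k, x) \<le> g (n + k, x)" "x \<in> {lo..<A}"
  shows "(climb_chain ^^ k) f (n, x) \<le> (climb_chain ^^ k) g (n, x)"
  using assms
proof (induction k arbitrary: n x)
  case (Suc k)
  have IH: "(climb_chain ^^ k) f (Suc n, x) \<le> (climb_chain ^^ k) g (Suc n, x)" if "x \<in> {lo..<A}" for x
    by (rule Suc.IH[OF _ that]) (use Suc.prems(1) in simp)
  have step: "climb_op ((climb_chain ^^ k) f) (n, x) \<le> climb_op ((climb_chain ^^ k) g) (n, x)"
    if "x \<in> {lo..<A}" for x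
    by (rule climb_op_level_mono[OF _ that]) (rule IH, simp)
  have "sojourn 0 (climb_op ((climb_chain ^^ k) f)) (n, x) \<le>
      sojourn 0 (climb_op ((climb_chain ^^ k) g)) (n, x)"
    by (rule sojourn_level_mono) (erule step, rule Suc.prems(2))
  then show ?case by simp
qed simp

lemma nn_integral_discount_exp:
  assumes "0 < c" "0 \<le> q"
  shows "(\<integral>\<^sup>+s. discount q s * ennreal (exp (- c * s)) \<partial>lborel) = ennreal (1 / (q + c))"
proof -
  interpret E: prob_space "density lborel (exponential_density (q + c))"
    by (rule prob_space_exponential_density) (use assms in simp)
  have "discount q s * ennreal (exp (- c * s)) =
      ennreal (1 / (q + c)) * ennreal (exponential_density (q + c) s)" for s
  proof (cases "0 \<le> s")
    case True
    have "exp (- q * s) * exp (- c * s) = 1 / (q + c) * exponential_density (q + c) s"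
      using True assms by (simp add: exponential_density_def distrib_left mult_exp_exp mult.commute)
    then show ?thesis using True assms by (simp add: discount_def flip: ennreal_mult')
  qed (simp add: discount_def exponential_density_def)
  then have "(\<integral>\<^sup>+s. discount q s * ennreal (exp (- c * s)) \<partial>lborel) =
      ennreal (1 / (q + c)) * (\<integral>\<^sup>+s. ennreal (exponential_density (q + c) s) \<partial>lborel)"
    by (simp add: nn_integral_cmult)
  also have "(\<integral>\<^sup>+s. ennreal (exponential_density (q + c) s) \<partial>lborel) = 1"
    using E.emeasure_space_1 by (simp add: emeasure_density)
  finally show ?thesis by simp
qed

text \<open>At \<open>lo = \<beta>\<close> the flow rests, so the state is held for an exponential
  time of rate \<open>lo\<close>, discounted at rate \<open>q\<close>.\<close>

lemma sojourn_lo: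
  assumes "0 \<le> q" shows "sojourn q f (n, lo) = ennreal (1 / (q + lo)) * f (n, lo)"
proof -
  have "sojourn q f (n, lo) = (\<integral>\<^sup>+s. discount q s * ennreal (exp (- lo * s)) * f (n, lo) \<partial>lborel)"
    by (simp add: sojourn_def survive_def mult.assoc)
  also have "\<dots> = (\<integral>\<^sup>+s. discount q s * ennreal (exp (- lo * s)) \<partial>lborel) * f (n, lo)"
    by (rule nn_integral_multc) measurable
  finally show ?thesis unfolding nn_integral_discount_exp[OF lo_pos assms] .
qed

lemma sojourn_1_le:
  assumes y: "y \<in> states" shows "sojourn 0 (\<lambda>_. 1) y \<le> ennreal (1 / lo)"
proof -
  have "sojourn 0 (\<lambda>_. 1) y \<le> (\<integral>\<^sup>+s. discount 0 s * ennreal (exp (- lo * s)) \<partial>lborel)"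
    unfolding sojourn_def
  proof (intro nn_integral_mono)
    fix s
    show "discount 0 s * survive s (\<lambda>_. 1) y \<le> discount 0 s * ennreal (exp (- lo * s))"
      using cum_ge[of "snd y" s] y
      by (cases "0 \<le> s") (auto simp: discount_def survive_def intro!: ennreal_leI)
  qed
  also have "\<dots> = ennreal (1 / (0 + lo))" by (rule nn_integral_discount_exp[OF lo_pos]) simp
  finally show ?thesis by simp
qed

lemma climb_power_1_le: "y \<in> states \<Longrightarrow> (climb_chain ^^ m) (\<lambda>_. 1) y \<le> 1"
  by (rule order_trans[OF _ eq_refl[OF sum_reset_climb_power[of y m]]])
     (auto intro: add_increasing)

lemma climb_power_const: "(climb_chain ^^ m) (\<lambda>_. c) y = c * (climb_chain ^^ m) (\<lambda>_. 1) y"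
  using kernel_op_cmult[OF kernel_op_climb_power, of "\<lambda>_. 1" m c y] by simp

lemma climb_power_le:
  assumes f: "\<And>y. y \<in> states \<Longrightarrow> f y \<le> c" and y: "y \<in> states"
  shows "(climb_chain ^^ m) f y \<le> c"
proof -
  have "(climb_chain ^^ m) f y \<le> (climb_chain ^^ m) (\<lambda>_. c) y"
    by (rule climb_power_mono[OF f y])
  also have "\<dots> \<le> c * 1"
    unfolding climb_power_const[of m c] by (rule mult_left_mono[OF climb_power_1_le[OF y]]) simp
  finally show ?thesis by simp
qed

subsection \<open>The occupation measure of a cycle\<close>

text \<open>Normalised so that the state \<open>(0, lo)\<close> has mass one.\<close>

definition occ :: "(nat \<times> real \<Rightarrow> ennreal) \<Rightarrow> ennreal" where
  "occ f = (\<Sum>k. (step_op ^^ k) f origin)"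

lemma integral_functional_occ: "integral_functional SB occ"
  unfolding occ_def[abs_def]
  by (intro integral_functional_suminf_functional kernel_op_functional kernel_op_step_power)

text \<open>The mean holding time at the atom is \<open>1 / lo\<close>; the factor \<open>lo\<close>
  removes it, which explains the normalisation of \<open>occ\<close>.\<close>

lemma step_power_origin: "(step_op ^^ k) f origin = ennreal lo * (climb_chain ^^ k) (sojourn 0 f) origin"
proof -
  have "ennreal lo * (ennreal (1 / lo) * (step_op ^^ k) f origin) = (step_op ^^ k) f origin"
    using lo_pos by (simp add: mult.assoc[symmetric] flip: ennreal_mult')
  then show ?thesis unfolding sojourn_step_power[symmetric] by (simp add: sojourn_lo)
qed

lemma occ_eq: "occ f = ennreal lo * (\<Sum>k. (climb_chain ^^ k) (sojourn 0 f) origin)"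
  by (simp add: occ_def step_power_origin ennreal_suminf_cmult)

lemma step_power_level_mono:
  assumes "\<And>x. x \<in> {lo..<A} \<Longrightarrow> f (k, x) \<le> g (k, x)"
  shows "(step_op ^^ k) f origin \<le> (step_op ^^ k) g origin"
  unfolding step_power_origin using assms lo_less_A
  by (intro mult_left_mono climb_power_level_mono sojourn_level_mono) auto

lemma occ_level:
  assumes "\<And>k x. x \<in> {lo..<A} \<Longrightarrow> k \<noteq> n \<Longrightarrow> f (k, x) = 0"
  shows "occ f = (step_op ^^ n) f origin"
proof -
  have "(step_op ^^ k) f origin = 0" if "k \<noteq> n" for k
  proof -
    \<comment> \<open>The zero function is written as a product so that homogeneity of the kernel
      applies to it.\<close>
    have "(step_op ^^ k) f origin \<le> (step_op ^^ k) (\<lambda>_. 0 * 0) origin"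
      by (rule step_power_level_mono) (use assms that in auto)
    also have "\<dots> = 0 * (step_op ^^ k) (\<lambda>_. 0) origin"
      by (rule kernel_op_cmult[OF kernel_op_step_power]) simp
    finally show ?thesis by simp
  qed
  then show ?thesis
    unfolding occ_def by (subst suminf_finite[of "{n}"]) auto
qed

lemma occ_mono: "(\<And>y. y \<in> states \<Longrightarrow> f y \<le> g y) \<Longrightarrow> occ f \<le> occ g"
  unfolding occ_def by (intro suminf_le summableI step_power_level_mono) auto

lemma occ_cong: "(\<And>y. y \<in> states \<Longrightarrow> f y = g y) \<Longrightarrow> occ f = occ g"
  by (intro antisym occ_mono) auto

lemma occ_origin: "occ (indicator {origin}) = 1"
  by (subst occ_level[where n = 0]) auto

lemma trans_op_1: "trans_op t (\<lambda>_. 1) y = 1"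
proof -
  interpret prob_space noise by (rule prob_space_noise)
  show ?thesis by (simp add: trans_op_def emeasure_space_1)
qed

lemma trans_op_le_1:
  assumes "f \<in> borel_measurable SB" "\<And>y. f y \<le> 1" shows "trans_op t f y \<le> 1"
  using kernel_op_mono[OF kernel_op_trans_op assms(1), of "\<lambda>_. 1" t y] assms(2)
  by (simp add: trans_op_1)

lemma occupied_le:
  assumes "f \<in> borel_measurable SB" "\<And>y. f y \<le> 1" "0 \<le> t" shows "occupied t f y \<le> ennreal t"
proof -
  have "occupied t f y \<le> (\<integral>\<^sup>+s. indicator {0..t} s * 1 \<partial>lborel)"
    unfolding occupied_def using assms by (intro nn_integral_mono mult_left_mono trans_op_le_1) auto
  also have "\<dots> = ennreal t" using assms(3) by simp
  finally show ?thesis .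
qed

text \<open>Iterates \<open>occupied_first_jump\<close> over \<open>m\<close> jumps. The window
  after each jump is either carried on by climbing or, at a reset, starts in the atom and accounts
  for the term with \<open>occupied t f origin\<close>.\<close>

lemma occupied_cycle:
  assumes t: "0 \<le> t" and f [measurable]: "f \<in> borel_measurable SB" and y: "y \<in> states"
  shows "(\<Sum>k<m. (climb_chain ^^ k) (sojourn 0 (trans_op t f)) y) + occupied t f y =
    (\<Sum>k<m. (climb_chain ^^ k) (sojourn 0 f) y) + (climb_chain ^^ m) (occupied t f) y +
    (\<Sum>k<m. (climb_chain ^^ k) (sojourn 0 reset_rate) y) * occupied t f origin"
proof (induction m)
  case (Suc m)
  let ?T = "climb_chain ^^ m" and ?H = "occupied t f"
  note add = kernel_op_add[OF kernel_op_climb_power]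
  have [measurable]: "sojourn 0 (trans_op t f) \<in> borel_measurable SB" "?H \<in> borel_measurable SB"
    "sojourn 0 f \<in> borel_measurable SB" "sojourn 0 reset_rate \<in> borel_measurable SB"
    "sojourn 0 (climb_op ?H) \<in> borel_measurable SB"
    by measurable
  have "?T (sojourn 0 (trans_op t f)) y + ?T ?H y = ?T (\<lambda>y. sojourn 0 (trans_op t f) y + ?H y) y"
    by (rule add[symmetric]) measurable
  also have "\<dots> = ?T (\<lambda>y. sojourn 0 f y + (sojourn 0 (climb_op ?H) y + ?H origin * sojourn 0 reset_rate y)) y"
    by (rule climb_power_cong[OF _ y])
       (simp add: occupied_first_jump[OF _ t] sojourn_jump_op_split mult.commute)
  also have "\<dots> = ?T (sojourn 0 f) y + ?T (\<lambda>y. sojourn 0 (climb_op ?H) y + ?H origin * sojourn 0 reset_rate y) y"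
    by (rule add) measurable
  also have "?T (\<lambda>y. sojourn 0 (climb_op ?H) y + ?H origin * sojourn 0 reset_rate y) y =
      ?T (sojourn 0 (climb_op ?H)) y + ?T (\<lambda>y. ?H origin * sojourn 0 reset_rate y) y"
    by (rule add) measurable
  also have "?T (\<lambda>y. ?H origin * sojourn 0 reset_rate y) y = ?H origin * ?T (sojourn 0 reset_rate) y"
    by (rule kernel_op_cmult[OF kernel_op_climb_power]) measurable
  finally have *: "?T (sojourn 0 (trans_op t f)) y + ?T ?H y = ?T (sojourn 0 f) y +
      (?T (sojourn 0 (climb_op ?H)) y + ?H origin * ?T (sojourn 0 reset_rate) y)" .
  have "(\<Sum>k<Suc m. (climb_chain ^^ k) (sojourn 0 (trans_op t f)) y) + ?H y =
    ((\<Sum>k<m. (climb_chain ^^ k) (sojourn 0 (trans_op t f)) y) + ?H y) + ?T (sojourn 0 (trans_op t f)) y"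
    by (simp add: ac_simps)
  also have "\<dots> = (\<Sum>k<m. (climb_chain ^^ k) (sojourn 0 f) y) +
    (\<Sum>k<m. (climb_chain ^^ k) (sojourn 0 reset_rate) y) * ?H origin +
    (?T (sojourn 0 (trans_op t f)) y + ?T ?H y)"
    unfolding Suc by (simp add: ac_simps)
  also note *
  finally show ?case
    by (simp add: climb_power_Suc distrib_left distrib_right ac_simps del: funpow.simps)
qed simp

subsection \<open>Invariant measures as functionals\<close>

lemma nn_integral_discount:
  assumes "0 < q" shows "(\<integral>\<^sup>+s. discount q s \<partial>lborel) = ennreal (1 / q)"
proof -
  have "discount q s = discount 0 s * ennreal (exp (- q * s))" for s
    by (simp add: discount_def mult.commute)
  then show ?thesis using nn_integral_discount_exp[OF assms, of 0] by simp
qed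

lemma trans_op_cong:
  assumes "\<And>y. y \<in> states \<Longrightarrow> f y = g y" "0 \<le> t" shows "trans_op t f y = trans_op t g y"
  unfolding trans_op_def by (intro nn_integral_cong assms Y_mem clamp_mem) auto

lemma emeasure_transition:
  assumes y: "y \<in> states" and t: "0 \<le> t" and E: "E \<in> sets SY"
  shows "emeasure (transition t y) E = trans_op t (indicator E) y"
proof -
  have Y: "Y y t \<in> measurable noise SB"
    by (rule measurable_Y) (use y in auto)
  then have [measurable]: "Y y t \<in> measurable noise SY"
    unfolding SY_def by (intro measurable_restrict_space2) (use Y_mem[OF y _ t] in auto)
  have "emeasure (transition t y) E = (\<integral>\<^sup>+x. indicator E x \<partial>transition t y)"
    using E by (simp add: transition_def)
  also have "\<dots> = trans_op t (indicator E) y"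
    unfolding transition_def trans_op_def clamp_id[OF y]
    using E by (intro nn_integral_distr) auto
  finally show ?thesis .
qed

context
  fixes \<mu> assumes inv: "invariant_measure \<mu>"
begin

lemma invariant_sets: "sets \<mu> = sets SY"
  using inv by (simp add: invariant_measure_def)

lemma invariant_space: "space \<mu> = states"
  using sets_eq_imp_space_eq[OF invariant_sets] by (simp add: space_SY)

lemma measurable_invariant: "f \<in> borel_measurable SB \<Longrightarrow> f \<in> borel_measurable \<mu>"
  using measurable_SY measurable_cong_sets[OF invariant_sets refl] by blast

lemma invariant_functional: "integral_functional SB (\<lambda>f. \<integral>\<^sup>+y. f y \<partial>\<mu>)"
proof -
  have "(\<lambda>y. y) \<in> measurable \<mu> SB"
    using id_SY_SB measurable_cong_sets[OF invariant_sets refl] by blast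
  then show ?thesis
    unfolding integral_functional_def
    by (intro exI[of _ "distr \<mu> SB (\<lambda>y. y)"]) (auto simp: nn_integral_distr)
qed

lemma invariant_cong: "(\<And>y. y \<in> states \<Longrightarrow> f y = g y) \<Longrightarrow> (\<integral>\<^sup>+y. f y \<partial>\<mu>) = (\<integral>\<^sup>+y. g y \<partial>\<mu>)"
  by (intro nn_integral_cong) (simp add: invariant_space)

lemma invariant_mono: "(\<And>y. y \<in> states \<Longrightarrow> f y \<le> g y) \<Longrightarrow> (\<integral>\<^sup>+y. f y \<partial>\<mu>) \<le> (\<integral>\<^sup>+y. g y \<partial>\<mu>)"
  by (intro nn_integral_mono) (simp add: invariant_space)

text \<open>Invariance is given for sets in \<open>SY\<close> only. Both sides are integrals of
  \<open>f\<close> against measures on the ambient space, so agreement on indicators, cut down to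
  the state space, is enough.\<close>

lemma invariant_trans_op:
  assumes t: "0 \<le> t" and f: "f \<in> borel_measurable SB"
  shows "(\<integral>\<^sup>+y. trans_op t f y \<partial>\<mu>) = (\<integral>\<^sup>+y. f y \<partial>\<mu>)"
proof -
  have ind: "(\<integral>\<^sup>+y. trans_op t (indicator E) y \<partial>\<mu>) = (\<integral>\<^sup>+y. indicator E y \<partial>\<mu>)" if E: "E \<in> sets SB" for E
  proof -
    have E': "E \<inter> states \<in> sets SY" using E states_sets by (auto simp: sets_SY_iff)
    have "(\<integral>\<^sup>+y. trans_op t (indicator E) y \<partial>\<mu>) = (\<integral>\<^sup>+y. emeasure (transition t y) (E \<inter> states) \<partial>\<mu>)"
    proof (rule invariant_cong)
      fix y assume y: "y \<in> states"
      have "trans_op t (indicator E) y = trans_op t (indicator (E \<inter> states)) y"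
        by (rule trans_op_cong[OF _ t]) (auto simp: indicator_def)
      then show "trans_op t (indicator E) y = emeasure (transition t y) (E \<inter> states)"
        by (simp add: emeasure_transition[OF y t E'])
    qed
    also have "\<dots> = emeasure \<mu> (E \<inter> states)"
      using inv t E' by (simp add: invariant_measure_def)
    also have "\<dots> = (\<integral>\<^sup>+y. indicator (E \<inter> states) y \<partial>\<mu>)"
      using E' by (simp add: invariant_sets)
    also have "\<dots> = (\<integral>\<^sup>+y. indicator E y \<partial>\<mu>)"
      by (rule invariant_cong) (auto simp: indicator_def)
    finally show ?thesis .
  qed
  obtain \<mu>1 where 1: "sets \<mu>1 = sets SB"
      "\<And>f. f \<in> borel_measurable SB \<Longrightarrow> (\<integral>\<^sup>+y. trans_op t f y \<partial>\<mu>) = (\<integral>\<^sup>+y. f y \<partial>\<mu>1)"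
    using integral_functional_measure[OF integral_functional_comp[OF invariant_functional kernel_op_trans_op]]
    by blast
  obtain \<mu>2 where 2: "sets \<mu>2 = sets SB"
      "\<And>f. f \<in> borel_measurable SB \<Longrightarrow> (\<integral>\<^sup>+y. f y \<partial>\<mu>) = (\<integral>\<^sup>+y. f y \<partial>\<mu>2)"
    using integral_functional_measure[OF invariant_functional] by blast
  have "\<mu>1 = \<mu>2"
  proof (rule measure_eqI)
    fix E assume "E \<in> sets \<mu>1"
    then show "emeasure \<mu>1 E = emeasure \<mu>2 E"
      using ind[of E] 1 2 by simp
  qed (simp add: 1 2)
  then show ?thesis using 1(2)[OF f] 2(2)[OF f] by simp
qed

text \<open>Fubini in time and space, which is where sigma-finiteness of \<open>\<mu>\<close>
  enters; the total weight of the discount is \<open>1 / q\<close>.\<close>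

lemma invariant_resolvent:
  assumes q: "0 < q" and [measurable]: "f \<in> borel_measurable SB"
  shows "ennreal q * (\<integral>\<^sup>+y. resolvent q f y \<partial>\<mu>) = (\<integral>\<^sup>+y. f y \<partial>\<mu>)"
proof -
  interpret sigma_finite_measure \<mu> using inv by (simp add: invariant_measure_def)
  interpret pair_sigma_finite lborel \<mu> ..
  have [measurable]: "(\<lambda>y. y) \<in> measurable \<mu> SB"
    using id_SY_SB measurable_cong_sets[OF invariant_sets refl] by blast
  have "(\<integral>\<^sup>+y. resolvent q f y \<partial>\<mu>) = (\<integral>\<^sup>+t. \<integral>\<^sup>+y. discount q t * trans_op t f y \<partial>\<mu> \<partial>lborel)"
    unfolding resolvent_def by (rule Fubini') measurable
  also have "\<dots> = (\<integral>\<^sup>+t. discount q t * (\<integral>\<^sup>+y. f y \<partial>\<mu>) \<partial>lborel)"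
  proof (rule nn_integral_cong)
    fix t :: real
    have "(\<integral>\<^sup>+y. discount q t * trans_op t f y \<partial>\<mu>) = discount q t * (\<integral>\<^sup>+y. trans_op t f y \<partial>\<mu>)"
      by (rule nn_integral_cmult) measurable
    then show "(\<integral>\<^sup>+y. discount q t * trans_op t f y \<partial>\<mu>) = discount q t * (\<integral>\<^sup>+y. f y \<partial>\<mu>)"
      by (cases "0 \<le> t") (auto simp: invariant_trans_op discount_def)
  qed
  also have "\<dots> = ennreal (1 / q) * (\<integral>\<^sup>+y. f y \<partial>\<mu>)"
    by (subst nn_integral_multc) (auto simp: nn_integral_discount[OF q])
  finally show ?thesis using q by (simp add: mult.assoc[symmetric] flip: ennreal_mult')
qed

end

subsection \<open>The resolvent as a series over the jumps\<close>

lemma resolvent_bound: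
  assumes q: "0 < q" and f: "\<And>y. y \<in> states \<Longrightarrow> f y \<le> c"
  shows "resolvent q f y \<le> ennreal (1 / q) * c"
proof -
  interpret N: prob_space noise by (rule prob_space_noise)
  have "resolvent q f y \<le> (\<integral>\<^sup>+t. discount q t * c \<partial>lborel)"
    unfolding resolvent_def
  proof (intro nn_integral_mono)
    fix t
    have "trans_op t f y \<le> c" if "0 \<le> t"
    proof -
      have "trans_op t f y \<le> (\<integral>\<^sup>+\<omega>. c \<partial>noise)"
        unfolding trans_op_def by (intro nn_integral_mono f Y_mem clamp_mem that) auto
      then show ?thesis by (simp add: N.emeasure_space_1)
    qed
    then show "discount q t * trans_op t f y \<le> discount q t * c"
      by (cases "0 \<le> t") (auto simp: discount_def intro!: mult_left_mono)
  qed
  also have "\<dots> = ennreal (1 / q) * c"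
    by (subst nn_integral_multc) (auto simp: nn_integral_discount[OF q])
  finally show ?thesis .
qed

lemma resolvent_1: "0 < q \<Longrightarrow> resolvent q (\<lambda>_. 1) y = ennreal (1 / q)"
  by (simp add: resolvent_def trans_op_1 nn_integral_discount)

lemma sojourn_1_ge:
  assumes y: "y \<in> states" and q: "0 < q" shows "ennreal (1 / (q + A)) \<le> sojourn q (\<lambda>_. 1) y"
proof -
  have "ennreal (1 / (q + A)) = (\<integral>\<^sup>+s. discount q s * ennreal (exp (- A * s)) \<partial>lborel)"
    using nn_integral_discount_exp[OF A_pos, of q] q by simp
  also have "\<dots> \<le> sojourn q (\<lambda>_. 1) y"
    unfolding sojourn_def
  proof (intro nn_integral_mono)
    fix s
    show "discount q s * ennreal (exp (- A * s)) \<le> discount q s * survive s (\<lambda>_. 1) y"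
      using cum_upper[of "snd y" s] y
      by (cases "0 \<le> s") (auto simp: discount_def survive_def intro!: mult_left_mono ennreal_leI)
  qed
  finally show ?thesis .
qed

text \<open>The first-jump equation for the constant 1, whose resolvent is \<open>1 / q\<close>,
  expresses the left side through \<open>sojourn q\<close> of 1, which is at least
  \<open>1 / (q + A)\<close>. Equivalently, the next jump comes before an independent exponential
  clock of rate \<open>q\<close> with probability at most that of a jump at the maximal rate
  \<open>A\<close>.\<close>

lemma sojourn_jump_op_1_le:
  assumes y: "y \<in> states" and q: "0 < q"
  shows "sojourn q (jump_op (\<lambda>_. 1)) y \<le> ennreal (A / (q + A))"
proof -
  let ?a = "sojourn q (jump_op (\<lambda>_. 1)) y"
  have "jump_op (\<lambda>_. ennreal (1 / q)) = (\<lambda>y. ennreal (1 / q) * jump_op (\<lambda>_. 1) y)"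
    using kernel_op_cmult[OF kernel_op_jump_op, of "\<lambda>_. 1" "ennreal (1 / q)"] by auto
  then have "sojourn q (jump_op (\<lambda>_. ennreal (1 / q))) y = ennreal (1 / q) * ?a"
    using kernel_op_cmult[OF kernel_op_sojourn, of "jump_op (\<lambda>_. 1)" q "ennreal (1 / q)" y] by simp
  then have "ennreal (1 / q) = sojourn q (\<lambda>_. 1) y + ennreal (1 / q) * ?a"
    using resolvent_first_jump[OF y, of "\<lambda>_. 1" q] by (simp add: resolvent_1[OF q, abs_def])
  then have le: "ennreal (1 / (q + A)) + ennreal (1 / q) * ?a \<le> ennreal (1 / q)"
    using sojourn_1_ge[OF y q] by (metis add_right_mono)
  \<comment> \<open>Finiteness of \<open>?a\<close> is needed before the inequality can be
    rearranged in the reals.\<close>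
  then have "ennreal (1 / q) * ?a < \<top>"
    by (metis add_increasing ennreal_less_top le_less_trans order_refl zero_le)
  then have "?a \<noteq> \<top>" using q by (auto simp: ennreal_mult_top)
  then obtain r where r: "?a = ennreal r" "0 \<le> r" by (cases ?a) auto
  have "ennreal (1 / q) * ennreal r = ennreal (1 / q * r)"
    using q r by (intro ennreal_mult[symmetric]) auto
  moreover have "ennreal (1 / (q + A)) + ennreal (1 / q * r) = ennreal (1 / (q + A) + 1 / q * r)"
    using q r A_pos by (intro ennreal_plus[symmetric]) auto
  ultimately have "ennreal (1 / (q + A) + 1 / q * r) \<le> ennreal (1 / q)"
    using le r(1) by (simp only:)
  then have "1 / (q + A) + 1 / q * r \<le> 1 / q" using q by (simp add: ennreal_le_iff)
  then have "q * (1 / q * r) \<le> q * (1 / q - 1 / (q + A))"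
    using q by (intro mult_left_mono) auto
  also have "q * (1 / q - 1 / (q + A)) = A / (q + A)"
  proof -
    have "q + A \<noteq> 0" using q A_pos by simp
    then have "1 - q / (q + A) = A / (q + A)" by (simp add: field_simps)
    then show ?thesis using q by (simp add: right_diff_distrib)
  qed
  finally have "r \<le> A / (q + A)" using q by simp
  then show ?thesis unfolding r by (rule ennreal_leI)
qed

abbreviation (input) discounted_chain :: "real \<Rightarrow> (nat \<times> real \<Rightarrow> ennreal) \<Rightarrow> nat \<times> real \<Rightarrow> ennreal" where
  "discounted_chain q \<equiv> \<lambda>f. sojourn q (jump_op f)"

lemma kernel_op_discounted_chain: "kernel_op SB (discounted_chain q)"
  by (rule kernel_op_comp[OF kernel_op_sojourn kernel_op_jump_op])

lemmas kernel_op_discounted_power = kernel_op_power[OF kernel_op_discounted_chain space_SB]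

lemma discounted_power_mono:
  assumes "\<And>y. y \<in> states \<Longrightarrow> f y \<le> g y" "y \<in> states"
  shows "(discounted_chain q ^^ m) f y \<le> (discounted_chain q ^^ m) g y"
  using assms(2)
proof (induction m arbitrary: y)
  case (Suc m)
  then show ?case by (auto intro!: sojourn_mono jump_op_mono)
qed (use assms in auto)

lemma discounted_power_cong:
  assumes "\<And>y. y \<in> states \<Longrightarrow> f y = g y" "y \<in> states"
  shows "(discounted_chain q ^^ m) f y = (discounted_chain q ^^ m) g y"
  using assms by (intro antisym discounted_power_mono) auto

lemma discounted_power_Suc:
  "(discounted_chain q ^^ Suc m) f = (discounted_chain q ^^ m) (discounted_chain q f)"
  by (simp add: funpow_Suc_right del: funpow.simps)

lemma discounted_power_bound:
  assumes q: "0 < q" and f: "\<And>y. y \<in> states \<Longrightarrow> f y \<le> c" and y: "y \<in> states"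
  shows "(discounted_chain q ^^ m) f y \<le> c * ennreal ((A / (q + A)) ^ m)"
  using y
proof (induction m arbitrary: y)
  case (Suc m)
  let ?d = "c * ennreal ((A / (q + A)) ^ m)"
  have "(discounted_chain q ^^ Suc m) f y \<le> sojourn q (jump_op (\<lambda>_. ?d)) y"
    using Suc by (simp, intro sojourn_mono jump_op_mono) auto
  also have "jump_op (\<lambda>_. ?d) = (\<lambda>y. ?d * jump_op (\<lambda>_. 1) y)"
    using kernel_op_cmult[OF kernel_op_jump_op, of "\<lambda>_. 1" ?d] by auto
  also have "sojourn q (\<lambda>y. ?d * jump_op (\<lambda>_. 1) y) y = ?d * sojourn q (jump_op (\<lambda>_. 1)) y"
    by (rule kernel_op_cmult[OF kernel_op_sojourn]) measurable
  also have "\<dots> \<le> ?d * ennreal (A / (q + A))"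
    by (intro mult_left_mono sojourn_jump_op_1_le Suc.prems q) simp
  also have "\<dots> = c * ennreal ((A / (q + A)) ^ Suc m)"
  proof -
    have "ennreal ((A / (q + A)) ^ m) * ennreal (A / (q + A)) = ennreal ((A / (q + A)) ^ m * (A / (q + A)))"
      using q A_pos by (intro ennreal_mult[symmetric]) auto
    then show ?thesis by (simp only: power_Suc2 mult.assoc)
  qed
  finally show ?case .
qed (use f in auto)

lemma resolvent_partial_series:
  assumes y: "y \<in> states" and [measurable]: "f \<in> borel_measurable SB"
  shows "resolvent q f y = (\<Sum>k<m. (discounted_chain q ^^ k) (sojourn q f) y) +
    (discounted_chain q ^^ m) (resolvent q f) y"
proof (induction m)
  case (Suc m)
  have "(discounted_chain q ^^ m) (resolvent q f) y =
      (discounted_chain q ^^ m) (\<lambda>y. sojourn q f y + sojourn q (jump_op (resolvent q f)) y) y"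
    by (rule discounted_power_cong[OF _ y]) (simp add: resolvent_first_jump)
  also have "\<dots> = (discounted_chain q ^^ m) (sojourn q f) y +
      (discounted_chain q ^^ m) (sojourn q (jump_op (resolvent q f))) y"
    by (rule kernel_op_add[OF kernel_op_discounted_power]) measurable
  finally show ?case using Suc
    by (simp add: discounted_power_Suc ac_simps del: funpow.simps)
qed simp

text \<open>The remainder after \<open>m\<close> jumps decays like the \<open>m\<close>-th power of
  \<open>A / (q + A)\<close>, which requires \<open>q > 0\<close> and a bounded
  \<open>f\<close>.\<close>

lemma resolvent_series:
  assumes q: "0 < q" and y: "y \<in> states" and f: "f \<in> borel_measurable SB"
    and bound: "\<And>y. y \<in> states \<Longrightarrow> f y \<le> c" "c < \<top>"
  shows "resolvent q f y = (\<Sum>k. (discounted_chain q ^^ k) (sojourn q f) y)"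
proof -
  let ?c = "ennreal (1 / q) * c"
  have c: "?c < \<top>" using bound(2) by (simp add: ennreal_mult_less_top)
  have "(\<lambda>m. (discounted_chain q ^^ m) (resolvent q f) y) \<longlonglongrightarrow> 0"
  proof (rule tendsto_sandwich[OF _ _ tendsto_const])
    have "(\<lambda>m. ennreal ((A / (q + A)) ^ m)) \<longlonglongrightarrow> ennreal 0"
      using q A_pos by (intro tendsto_ennrealI LIMSEQ_power_zero) simp
    from ennreal_tendsto_cmult[OF c this]
    show "(\<lambda>m. ?c * ennreal ((A / (q + A)) ^ m)) \<longlonglongrightarrow> 0" by simp
    show "\<forall>\<^sub>F m in sequentially. (discounted_chain q ^^ m) (resolvent q f) y \<le> ?c * ennreal ((A / (q + A)) ^ m)"
      by (intro always_eventually allI discounted_power_bound q y resolvent_bound bound(1))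
  qed simp
  then have "(\<lambda>m. (\<Sum>k<m. (discounted_chain q ^^ k) (sojourn q f) y) +
      (discounted_chain q ^^ m) (resolvent q f) y) \<longlonglongrightarrow>
      (\<Sum>k. (discounted_chain q ^^ k) (sojourn q f) y) + 0"
    by (intro tendsto_add summable_LIMSEQ summableI)
  then show ?thesis
    unfolding resolvent_partial_series[OF y f, symmetric] by (simp add: LIMSEQ_const_iff)
qed

lemma sojourn_le:
  assumes "0 < q" and f: "\<And>y. y \<in> states \<Longrightarrow> f y \<le> c" and y: "y \<in> states"
  shows "sojourn q f y \<le> ennreal (1 / q) * c"
proof -
  have "sojourn q f y \<le> (\<integral>\<^sup>+s. discount q s * c \<partial>lborel)"
    unfolding sojourn_def
  proof (intro nn_integral_mono)
    fix s
    have "survive s f y \<le> 1 * c" if "0 \<le> s"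
      unfolding survive_def
      using cum_nonneg[of "snd y" s] y that
      by (intro mult_mono f drift_mem) auto
    then show "discount q s * survive s f y \<le> discount q s * c"
      by (cases "0 \<le> s") (auto simp: discount_def intro!: mult_left_mono)
  qed
  also have "\<dots> = ennreal (1 / q) * c"
    by (subst nn_integral_multc) (auto simp: nn_integral_discount[OF assms(1)])
  finally show ?thesis .
qed

lemma jump_op_le:
  assumes f: "\<And>y. y \<in> states \<Longrightarrow> f y \<le> c" and y: "y \<in> states"
  shows "jump_op f y \<le> ennreal A * c"
proof -
  interpret G: prob_space G by (rule prob_space_G)
  have "jump_op f y \<le> ennreal A * (\<integral>\<^sup>+z. c \<partial>G)"
    unfolding jump_op_def using y
    by (intro mult_mono nn_integral_mono f jump_mem) (auto simp: space_G intro!: ennreal_leI)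
  then show ?thesis by (simp add: G.emeasure_space_1)
qed

text \<open>The expansion of the left side over the jumps is that of \<open>resolvent q f\<close>
  without its zeroth term, the time before the first jump.\<close>

lemma resolvent_last_jump:
  assumes q: "0 < q" and y: "y \<in> states" and [measurable]: "f \<in> borel_measurable SB"
    and f: "\<And>y. y \<in> states \<Longrightarrow> f y \<le> c" "c < \<top>"
  shows "resolvent q (jump_op (sojourn q f)) y \<le> resolvent q f y"
proof -
  let ?u = "\<lambda>k. (discounted_chain q ^^ k) (sojourn q f) y"
  have "resolvent q (jump_op (sojourn q f)) y =
      (\<Sum>k. (discounted_chain q ^^ k) (sojourn q (jump_op (sojourn q f))) y)"
  proof (rule resolvent_series[OF q y])
    show "ennreal A * (ennreal (1 / q) * c) < \<top>" using f(2) by (simp add: ennreal_mult_less_top)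
  qed (measurable, intro jump_op_le sojourn_le q f(1))
  also have "\<dots> = (\<Sum>k. ?u (Suc k))" by (simp add: discounted_power_Suc del: funpow.simps)
  also have "\<dots> \<le> ?u 0 + (\<Sum>k. ?u (Suc k))" by simp
  also have "\<dots> = (\<Sum>k. ?u k)" using suminf_offset[of ?u 1] by (simp add: summableI)
  also have "\<dots> = resolvent q f y"
    by (rule resolvent_series[OF q y _ f, symmetric]) auto
  finally show ?thesis .
qed

text \<open>Discounts with rates \<open>1 / (i + 1)\<close> increase to the undiscounted weight. A
  countable sequence of rates is what monotone convergence needs.\<close>

lemma sojourn_SUP:
  assumes [measurable]: "f \<in> borel_measurable SB"
  shows "sojourn 0 f y = (SUP i. sojourn (1 / real (Suc i)) f y)"
    and "incseq (\<lambda>i. sojourn (1 / real (Suc i)) f)"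
proof -
  have mono: "discount (1 / real (Suc i)) s \<le> discount (1 / real (Suc j)) s" if "i \<le> j" for i j s
    using that by (auto simp: discount_def indicator_def field_simps intro!: ennreal_leI mult_mono)
  have SUP: "(SUP i. discount (1 / real (Suc i)) s) = discount 0 s" for s
  proof -
    have "(\<lambda>i. exp (- (1 / real (Suc i)) * s)) \<longlonglongrightarrow> exp (- 0 * s)"
      by (intro tendsto_exp tendsto_mult tendsto_minus tendsto_const LIMSEQ_inverse_real_of_nat[unfolded inverse_eq_divide])
    then have "(\<lambda>i. ennreal (exp (- (1 / real (Suc i)) * s))) \<longlonglongrightarrow> ennreal (exp (- 0 * s))"
      by (rule tendsto_ennrealI)
    then have "(\<lambda>i. discount (1 / real (Suc i)) s) \<longlonglongrightarrow> discount 0 s"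
      unfolding discount_def by (cases "0 \<le> s") simp_all
    moreover have "(\<lambda>i. discount (1 / real (Suc i)) s) \<longlonglongrightarrow> (SUP i. discount (1 / real (Suc i)) s)"
      by (rule LIMSEQ_SUP) (unfold incseq_def, intro allI impI mono)
    ultimately show ?thesis using LIMSEQ_unique by blast
  qed
  have "sojourn 0 f y = (\<integral>\<^sup>+s. (SUP i. discount (1 / real (Suc i)) s * survive s f y) \<partial>lborel)"
    unfolding sojourn_def SUP[symmetric] by (simp add: SUP_mult_right_ennreal)
  also have "\<dots> = (SUP i. sojourn (1 / real (Suc i)) f y)"
    unfolding sojourn_def
    by (intro nn_integral_monotone_convergence_SUP)
       (unfold incseq_def le_fun_def, intro allI impI mult_right_mono mono, simp, measurable)
  finally show "sojourn 0 f y = (SUP i. sojourn (1 / real (Suc i)) f y)" .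
  show "incseq (\<lambda>i. sojourn (1 / real (Suc i)) f)"
    unfolding sojourn_def[abs_def]
    by (unfold incseq_def le_fun_def, intro allI impI nn_integral_mono mult_right_mono mono) auto
qed

lemma climb_op_le_jump_op: "f \<in> borel_measurable SB \<Longrightarrow> climb_op f y \<le> jump_op f y"
  by (simp add: jump_op_split)

text \<open>A step keeps functions bounded; this feeds the induction in
  \<open>invariant_ge_partial\<close>, which applies its hypothesis to
  \<open>step_op f\<close>.\<close>

lemma step_op_le:
  assumes [measurable]: "f \<in> borel_measurable SB" and f: "\<And>y. y \<in> states \<Longrightarrow> f y \<le> c" and y: "y \<in> states"
  shows "step_op f y \<le> ennreal A * (c * ennreal (1 / lo))"
proof -
  have "sojourn 0 f y \<le> c * ennreal (1 / lo)" if "y \<in> states" for y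
  proof -
    have "sojourn 0 f y \<le> sojourn 0 (\<lambda>_. c * 1) y"
      using f by (intro sojourn_mono that) auto
    also have "\<dots> = c * sojourn 0 (\<lambda>_. 1) y"
      by (rule kernel_op_cmult[OF kernel_op_sojourn]) simp
    also have "\<dots> \<le> c * ennreal (1 / lo)"
      by (intro mult_left_mono sojourn_1_le that) simp
    finally show ?thesis .
  qed
  then have "jump_op (sojourn 0 f) y \<le> ennreal A * (c * ennreal (1 / lo))"
    by (rule jump_op_le) (use y in auto)
  moreover have "step_op f y \<le> jump_op (sojourn 0 f) y"
    unfolding step_op_def by (rule climb_op_le_jump_op) measurable
  ultimately show ?thesis by (rule order_trans[rotated])
qed

text \<open>A climb ends at a level of at least 1, so the value of \<open>f\<close> at the atom is
  never read. It can therefore be removed from \<open>f\<close> and counted separately.\<close>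

lemma step_op_off_origin:
  assumes y: "y \<in> states" shows "step_op (\<lambda>y. f y * indicator (- {origin}) y) y = step_op f y"
proof -
  have "sojourn 0 (\<lambda>y. f y * indicator (- {origin}) y) z = sojourn 0 f z"
    if "z \<in> {1..} \<times> {lo<..<A}" for z
    unfolding sojourn_def survive_def using that
    by (intro nn_integral_cong) (auto simp: drift_eq indicator_def)
  then show ?thesis unfolding step_op_def by (intro climb_op_cong y)
qed

section \<open>Invariant measures dominate the cycle measure\<close>

context
  fixes \<mu> assumes inv: "invariant_measure \<mu>"
begin

lemma invariant_jump_op_le:
  assumes [measurable]: "f \<in> borel_measurable SB" and f: "\<And>y. y \<in> states \<Longrightarrow> f y \<le> c" "c < \<top>"
  shows "(\<integral>\<^sup>+y. jump_op (sojourn 0 f) y \<partial>\<mu>) \<le> (\<integral>\<^sup>+y. f y \<partial>\<mu>)"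
proof -
  let ?q = "\<lambda>i. 1 / real (Suc i)"
  have q: "(\<integral>\<^sup>+y. jump_op (sojourn q f) y \<partial>\<mu>) \<le> (\<integral>\<^sup>+y. f y \<partial>\<mu>)" if "0 < q" for q
  proof -
    have "(\<integral>\<^sup>+y. jump_op (sojourn q f) y \<partial>\<mu>) = ennreal q * (\<integral>\<^sup>+y. resolvent q (jump_op (sojourn q f)) y \<partial>\<mu>)"
      by (rule invariant_resolvent[OF inv that, symmetric]) measurable
    also have "\<dots> \<le> ennreal q * (\<integral>\<^sup>+y. resolvent q f y \<partial>\<mu>)"
      by (intro mult_left_mono invariant_mono[OF inv] resolvent_last_jump[OF that _ _ f]) auto
    also have "\<dots> = (\<integral>\<^sup>+y. f y \<partial>\<mu>)"
      by (rule invariant_resolvent[OF inv that]) measurable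
    finally show ?thesis .
  qed
  have "sojourn 0 f = (\<lambda>y. SUP i. sojourn (?q i) f y)"
    by (rule ext) (rule sojourn_SUP(1), measurable)
  then have "(\<integral>\<^sup>+y. jump_op (sojourn 0 f) y \<partial>\<mu>) = (\<integral>\<^sup>+y. jump_op (\<lambda>y. SUP i. sojourn (?q i) f y) y \<partial>\<mu>)"
    by (rule arg_cong)
  also have "\<dots> = (SUP i. \<integral>\<^sup>+y. jump_op (sojourn (?q i) f) y \<partial>\<mu>)"
    by (rule integral_functional_SUP[OF integral_functional_comp[OF invariant_functional[OF inv] kernel_op_jump_op]])
       (measurable, rule sojourn_SUP(2), measurable)
  also have "\<dots> \<le> (\<integral>\<^sup>+y. f y \<partial>\<mu>)"
    by (intro SUP_least q) simp
  finally show ?thesis .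
qed

text \<open>The integral of \<open>f\<close> is the contribution of the atom plus the integral of
  \<open>f\<close> off the atom, and the latter is at least the integral of
  \<open>step_op f\<close>. Repeating this with \<open>step_op f\<close> in place of
  \<open>f\<close> produces one summand at a time.\<close>

lemma invariant_ge_partial:
  assumes "f \<in> borel_measurable SB" "\<And>y. y \<in> states \<Longrightarrow> f y \<le> c" "c < \<top>"
  shows "emeasure \<mu> {origin} * (\<Sum>k<m. (step_op ^^ k) f origin) \<le> (\<integral>\<^sup>+y. f y \<partial>\<mu>)"
  using assms
proof (induction m arbitrary: f c)
  case (Suc m)
  note [measurable] = Suc.prems(1)
  let ?f = "\<lambda>y. f y * indicator (- {origin}) y"
  have [measurable]: "step_op f \<in> borel_measurable SB"
    by (rule kernel_op_measurable[OF kernel_op_step_op]) measurable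
  have c: "ennreal A * (c * ennreal (1 / lo)) < \<top>"
    using Suc.prems(3) by (simp add: ennreal_mult_less_top)
  have "{origin} \<in> sets SY" using origin_SB origin_mem by (simp add: sets_SY_iff)
  then have o: "{origin} \<in> sets \<mu>" by (simp add: invariant_sets[OF inv])
  have "emeasure \<mu> {origin} * (\<Sum>k<m. (step_op ^^ k) (step_op f) origin) \<le> (\<integral>\<^sup>+y. step_op f y \<partial>\<mu>)"
    by (rule Suc.IH[OF _ step_op_le[OF Suc.prems(1,2)] c]) auto
  also have "\<dots> = (\<integral>\<^sup>+y. step_op ?f y \<partial>\<mu>)"
    by (rule invariant_cong[OF inv]) (simp add: step_op_off_origin)
  also have "\<dots> \<le> (\<integral>\<^sup>+y. jump_op (sojourn 0 ?f) y \<partial>\<mu>)"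
    unfolding step_op_def by (intro invariant_mono[OF inv] climb_op_le_jump_op) measurable
  also have "\<dots> \<le> (\<integral>\<^sup>+y. ?f y \<partial>\<mu>)"
    by (rule invariant_jump_op_le[OF _ _ Suc.prems(3)])
       (measurable, auto simp: indicator_def intro: Suc.prems(2))
  finally have 1: "emeasure \<mu> {origin} * (\<Sum>k<m. (step_op ^^ k) (step_op f) origin) \<le> (\<integral>\<^sup>+y. ?f y \<partial>\<mu>)" .
  have 2: "(\<integral>\<^sup>+y. f origin * indicator {origin} y \<partial>\<mu>) = f origin * emeasure \<mu> {origin}"
    using o by (rule nn_integral_cmult_indicator)
  have "(\<integral>\<^sup>+y. f y \<partial>\<mu>) = (\<integral>\<^sup>+y. f origin * indicator {origin} y + ?f y \<partial>\<mu>)"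
    by (intro nn_integral_cong) (auto simp: indicator_def)
  also have "\<dots> = f origin * emeasure \<mu> {origin} + (\<integral>\<^sup>+y. ?f y \<partial>\<mu>)"
    unfolding 2[symmetric]
    by (intro nn_integral_add measurable_invariant[OF inv]) measurable
  finally have "(\<integral>\<^sup>+y. f y \<partial>\<mu>) = f origin * emeasure \<mu> {origin} + (\<integral>\<^sup>+y. ?f y \<partial>\<mu>)" .
  moreover have "(\<Sum>k<Suc m. (step_op ^^ k) f origin) =
      f origin + (\<Sum>k<m. (step_op ^^ k) (step_op f) origin)"
    by (simp only: sum.lessThan_Suc_shift funpow_Suc_right comp_def) simp
  ultimately show ?case using add_left_mono[OF 1, of "f origin * emeasure \<mu> {origin}"]
    by (simp only: distrib_left mult.commute)
qed simp

lemma invariant_ge: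
  assumes "f \<in> borel_measurable SB" "\<And>y. y \<in> states \<Longrightarrow> f y \<le> c" "c < \<top>"
  shows "emeasure \<mu> {origin} * occ f \<le> (\<integral>\<^sup>+y. f y \<partial>\<mu>)"
  unfolding occ_def suminf_eq_SUP SUP_mult_left_ennreal
  using invariant_ge_partial[OF assms] by (rule SUP_least)

end

text \<open>A level is reached with probability at most 1 and then held for a mean time of at most
  \<open>1 / lo\<close>. This makes the cycle measure sigma-finite even if its total mass is
  infinite.\<close>

lemma occ_level_le:
  assumes "\<And>y. y \<in> states \<Longrightarrow> f y \<le> indicator ({n} \<times> UNIV) y" shows "occ f \<le> 1"
proof -
  have "occ f \<le> occ (indicator ({n} \<times> UNIV))" by (rule occ_mono[OF assms])
  also have "\<dots> = (step_op ^^ n) (indicator ({n} \<times> UNIV)) origin"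
    by (rule occ_level) auto
  also have "\<dots> \<le> ennreal lo * ennreal (1 / lo)"
    unfolding step_power_origin
  proof (intro mult_left_mono climb_power_le origin_mem)
    fix y assume y: "y \<in> states"
    have "sojourn 0 (indicator ({n} \<times> UNIV)) y \<le> sojourn 0 (\<lambda>_. 1) y"
      by (rule sojourn_mono[OF _ y]) (simp add: indicator_def)
    also have "\<dots> \<le> ennreal (1 / lo)" by (rule sojourn_1_le[OF y])
    finally show "sojourn 0 (indicator ({n} \<times> UNIV)) y \<le> ennreal (1 / lo)" .
  qed simp
  also have "\<dots> = 1" using lo_pos by (simp flip: ennreal_mult')
  finally show ?thesis .
qed

subsection \<open>Densities\<close>

lemma F_eq: "lo < x \<Longrightarrow> F x = exp (- x / \<alpha>) * (x - lo) powr ((\<alpha> - lo) / \<alpha>)"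
  unfolding F_def using beta_eq by simp

lemma F_pos: "lo < x \<Longrightarrow> 0 < F x"
  by (simp add: F_eq)

lemma borel_measurable_F [measurable (raw)]:
  assumes [measurable]: "f \<in> borel_measurable M"
  shows "(\<lambda>x. F (f x)) \<in> borel_measurable M"
  unfolding F_def by measurable

text \<open>With \<open>u = flow x s\<close>, the quotient \<open>F x / ((x - lo) * F u)\<close>
  equals \<open>exp (- cum x s) / (u - lo)\<close>, and \<open>\<alpha> * (u - lo)\<close> is the
  speed of the flow at \<open>u\<close>. So \<open>F\<close> encodes the probability of surviving
  from \<open>x\<close> down to \<open>u\<close>, divided by the distance \<open>u - lo\<close> that
  enters the speed.\<close>

lemma F_flow:
  assumes x: "lo < x"
  shows "F x / ((x - lo) * F (flow x s)) / \<alpha> * (\<alpha> * (x - lo) * exp (- \<alpha> * s)) = exp (- cum x s)"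
proof -
  let ?p = "(\<alpha> - lo) / \<alpha>"
  have u: "flow x s - lo = (x - lo) * exp (- \<alpha> * s)" by (simp add: flow_eq)
  have "lo < flow x s" using x by (simp add: flow_eq)
  then have "F (flow x s) = exp (- flow x s / \<alpha>) * ((x - lo) powr ?p * exp (- \<alpha> * s) powr ?p)"
    using x by (simp add: F_eq u powr_mult)
  also have "exp (- \<alpha> * s) powr ?p = exp (- (\<alpha> - lo) * s)"
    using alpha_pos by (simp add: powr_def field_simps)
  finally have Fu: "F (flow x s) = exp (- flow x s / \<alpha>) * ((x - lo) powr ?p * exp (- (\<alpha> - lo) * s))" .
  have "F x / ((x - lo) * F (flow x s)) / \<alpha> * (\<alpha> * (x - lo) * exp (- \<alpha> * s)) =
      F x / F (flow x s) * exp (- \<alpha> * s)"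
    using x alpha_pos by simp
  also have "F x / F (flow x s) = exp (- x / \<alpha>) / exp (- flow x s / \<alpha>) / exp (- (\<alpha> - lo) * s)"
    using x unfolding Fu F_eq[OF x] by simp
  also have "\<dots> * exp (- \<alpha> * s) = exp (- x / \<alpha> - - flow x s / \<alpha> - - (\<alpha> - lo) * s + - \<alpha> * s)"
    by (simp only: exp_add exp_diff)
  also have "- x / \<alpha> - - flow x s / \<alpha> - - (\<alpha> - lo) * s + - \<alpha> * s = - cum x s"
    using alpha_pos unfolding cum_def flow_eq by (simp add: field_simps)
  finally show ?thesis .
qed

lemma flow_antimono:
  assumes "lo \<le> x" "s \<le> t" shows "flow x t \<le> flow x s"
  using flow_le[of "flow x s" "t - s"] flow_ge[of x s] assms by (simp add: flow_add)

text \<open>The left end is open because the flow tends to \<open>lo\<close> without reaching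
  it.\<close>

lemma UN_flow:
  assumes x: "lo < x" shows "(\<Union>n::nat. {flow x (real n)..x}) = {lo<..x}"
proof (intro equalityI subsetI)
  fix u assume u: "u \<in> {lo<..x}"
  \<comment> \<open>Chosen so that \<open>exp (\<alpha> * n) \<ge> \<alpha> * n\<close> pushes
    \<open>(x - lo) * exp (- \<alpha> * n)\<close> below \<open>u - lo\<close>.\<close>
  obtain n :: nat where "(x - lo) / (u - lo) / \<alpha> \<le> n" using real_arch_simple by blast
  then have "(x - lo) / (u - lo) \<le> \<alpha> * n"
    using alpha_pos pos_divide_le_eq[of \<alpha> "(x - lo) / (u - lo)" "real n"] by (simp only: mult.commute)
  also have "\<dots> \<le> exp (\<alpha> * n)" using exp_ge_add_one_self[of "\<alpha> * n"] by linarith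
  finally have "x - lo \<le> exp (\<alpha> * n) * (u - lo)" using u by (simp add: field_simps)
  then have "(x - lo) * exp (- \<alpha> * n) \<le> exp (\<alpha> * n) * (u - lo) * exp (- \<alpha> * n)"
    by (intro mult_right_mono) auto
  also have "\<dots> = u - lo" by (simp add: exp_minus field_simps)
  finally have "flow x n \<le> u" by (simp add: flow_eq)
  then show "u \<in> (\<Union>n::nat. {flow x (real n)..x})" using u by auto
next
  fix u assume "u \<in> (\<Union>n::nat. {flow x (real n)..x})"
  moreover have "lo < flow x (real n)" for n using x by (simp add: flow_eq)
  ultimately show "u \<in> {lo<..x}" by (auto intro: less_le_trans)
qed

text \<open>Divided by \<open>\<alpha>\<close>, this is the density at position \<open>u < x\<close>
  of the expected time spent there, from \<open>x\<close> until the next jump.\<close>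

definition sojourn_density :: "real \<Rightarrow> real \<Rightarrow> ennreal" where
  "sojourn_density x u = ennreal (F x / ((x - lo) * F u))"

lemma borel_measurable_sojourn_density [measurable (raw)]:
  assumes [measurable]: "f \<in> borel_measurable M" "g \<in> borel_measurable M"
  shows "(\<lambda>x. sojourn_density (f x) (g x)) \<in> borel_measurable M"
  unfolding sojourn_density_def by measurable

lemma sojourn_eq_density:
  assumes x: "lo < x" and [measurable]: "f \<in> borel_measurable SB"
  shows "sojourn 0 f (n, x) = ennreal (1 / \<alpha>) *
    (\<integral>\<^sup>+u. indicator {lo<..<x} u * (sojourn_density x u * f (n, u)) \<partial>lborel)"
proof -
  define \<phi> where "\<phi> u = ennreal (1 / \<alpha>) * (sojourn_density x u * f (n, u))" for u
  have [measurable]: "\<phi> \<in> borel_measurable borel" unfolding \<phi>_def by measurable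
  let ?s = "\<lambda>s. ennreal (exp (- cum x s)) * f (n, flow x s)"
  have [measurable]: "?s \<in> borel_measurable borel" by measurable
  have fin: "(\<integral>\<^sup>+u\<in>{flow x (real N)..x}. \<phi> u \<partial>lborel) = (\<integral>\<^sup>+s\<in>{0..real N}. ?s s \<partial>lborel)" if "0 < N" for N :: nat
  proof -
    \<comment> \<open>The flow decreases, while the substitution rule is for nondecreasing maps;
      hence time is reversed.\<close>
    let ?g = "\<lambda>r. flow x (- r)" and ?g' = "\<lambda>r. \<alpha> * (x - lo) * exp (\<alpha> * r)"
    have "(\<integral>\<^sup>+u\<in>{?g (- real N)..?g 0}. \<phi> u \<partial>lborel) =
        (\<integral>\<^sup>+r\<in>{- real N..0}. \<phi> (?g r) * ennreal (?g' r) \<partial>lborel)"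
    proof (rule nn_integral_substitution_aux)
      show "(?g has_real_derivative ?g' r) (at r)" for r
        unfolding flow_eq by (auto intro!: derivative_eq_intros)
      show "continuous_on {- real N..0} ?g'" by (intro continuous_intros)
    qed (use that alpha_pos x in auto)
    also have "\<dots> = (\<integral>\<^sup>+s. \<phi> (?g (- s)) * ennreal (?g' (- s)) * indicator {- real N..0} (- s) \<partial>lborel)"
      by (subst nn_integral_real_affine[where c = "-1" and t = 0]) (auto simp: flow_eq)
    also have "\<dots> = (\<integral>\<^sup>+s\<in>{0..real N}. ?s s \<partial>lborel)"
    proof (rule nn_integral_cong)
      fix s :: real
      have pos: "0 < F x" "0 < F (flow x s)" using x by (auto intro!: F_pos simp: flow_eq)
      have "ennreal (1 / \<alpha>) * sojourn_density x (flow x s) * ennreal (?g' (- s)) =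
          ennreal (F x / ((x - lo) * F (flow x s)) / \<alpha> * (\<alpha> * (x - lo) * exp (- \<alpha> * s)))"
        unfolding sojourn_density_def using alpha_pos x pos
        by (subst ennreal_mult[symmetric], simp, simp, subst ennreal_mult[symmetric]) (auto simp: mult.commute)
      also have "\<dots> = ennreal (exp (- cum x s))"
        unfolding F_flow[OF x] ..
      finally have "ennreal (exp (- cum x s)) = ennreal (1 / \<alpha>) * sojourn_density x (flow x s) * ennreal (?g' (- s))" ..
      then have "\<phi> (?g (- s)) * ennreal (?g' (- s)) = ?s s"
        unfolding \<phi>_def by (simp only: mult_ac minus_minus)
      then show "\<phi> (?g (- s)) * ennreal (?g' (- s)) * indicator {- real N..0} (- s) = ?s s * indicator {0..real N} s"
        by (auto simp: indicator_def)
    qed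
    finally show ?thesis by simp
  qed
  have "sojourn 0 f (n, x) = (\<integral>\<^sup>+s\<in>{0..}. ?s s \<partial>lborel)"
    unfolding sojourn_def survive_def discount_def by (simp add: mult_ac)
  \<comment> \<open>\<open>Suc N\<close> keeps the intervals nondegenerate, as required by
    \<open>fin\<close>.\<close>
  also have "\<dots> = (\<integral>\<^sup>+s\<in>(\<Union>N. {0..real (Suc N)}). ?s s \<partial>lborel)"
  proof -
    have "(\<Union>N. {0..real (Suc N)}) = {0..}"
    proof (intro equalityI subsetI)
      fix s :: real assume s: "s \<in> {0..}"
      obtain N :: nat where "s \<le> N" using real_arch_simple by blast
      then have "s \<in> {0..real (Suc N)}" using s by simp
      then show "s \<in> (\<Union>N. {0..real (Suc N)})" by (rule UN_I[OF UNIV_I])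
    qed auto
    then show ?thesis by simp
  qed
  also have "\<dots> = (SUP N. \<integral>\<^sup>+s\<in>{0..real (Suc N)}. ?s s \<partial>lborel)"
    by (intro set_nn_integral_UN) (auto simp: incseq_def)
  also have "\<dots> = (SUP N. \<integral>\<^sup>+u\<in>{flow x (real (Suc N))..x}. \<phi> u \<partial>lborel)"
    by (simp only: fin[OF zero_less_Suc])
  also have "\<dots> = (\<integral>\<^sup>+u\<in>(\<Union>N. {flow x (real (Suc N))..x}). \<phi> u \<partial>lborel)"
  proof (intro set_nn_integral_UN[symmetric])
    show "incseq (\<lambda>N. {flow x (real (Suc N))..x})"
      unfolding incseq_def
    proof (intro allI impI)
      fix M N :: nat assume "M \<le> N"
      then show "{flow x (real (Suc M))..x} \<subseteq> {flow x (real (Suc N))..x}"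
        using flow_antimono[of x "real (Suc M)" "real (Suc N)"] x by simp
    qed
  qed auto
  also have "(\<Union>N. {flow x (real (Suc N))..x}) = {lo<..x}"
  proof -
    have "(\<Union>N. {flow x (real (Suc N))..x}) = (\<Union>N. {flow x (real N)..x})"
    proof (intro equalityI UN_least)
      fix N :: nat
      show "{flow x (real (Suc N))..x} \<subseteq> (\<Union>N. {flow x (real N)..x})"
        by (rule UN_upper[OF UNIV_I])
      have "{flow x (real N)..x} \<subseteq> {flow x (real (Suc N))..x}"
        using flow_antimono[of x "real N" "real (Suc N)"] x by simp
      then show "{flow x (real N)..x} \<subseteq> (\<Union>N. {flow x (real (Suc N))..x})"
        by (rule subset_trans) (rule UN_upper[OF UNIV_I])
    qed
    then show ?thesis by (simp only: UN_flow[OF x])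
  qed
  also have "(\<integral>\<^sup>+u\<in>{lo<..x}. \<phi> u \<partial>lborel) = (\<integral>\<^sup>+u. indicator {lo<..<x} u * \<phi> u \<partial>lborel)"
  proof (rule nn_integral_cong_AE)
    have "AE u in lborel. u \<noteq> x" by (rule AE_lborel_singleton)
    then show "AE u in lborel. \<phi> u * indicator {lo<..x} u = indicator {lo<..<x} u * \<phi> u"
      by eventually_elim (auto simp: indicator_def)
  qed
  also have "\<dots> = ennreal (1 / \<alpha>) *
      (\<integral>\<^sup>+u. indicator {lo<..<x} u * (sojourn_density x u * f (n, u)) \<partial>lborel)"
    unfolding \<phi>_def by (subst nn_integral_cmult[symmetric]) (auto intro!: nn_integral_cong simp: mult_ac)
  finally show ?thesis .
qed

section \<open>Jump sizes and the densities of the levels\<close>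

lemma prob_space_Gl_law: "prob_space (Gl_law (Suc n))"
proof -
  interpret G: prob_space G by (rule prob_space_G)
  show ?thesis unfolding Gl_law_def
    by (rule G.prob_space_distr) (simp add: measurable_l)
qed

lemma sets_Gl_law [simp, measurable_cong]: "sets (Gl_law n) = sets borel"
  by (simp add: Gl_law_def)

lemma nn_integral_Gl_law:
  assumes "\<phi> \<in> borel_measurable borel"
  shows "(\<integral>\<^sup>+u. \<phi> u \<partial>Gl_law (Suc n)) = (\<integral>\<^sup>+z. \<phi> (l (Suc n) z) \<partial>G)"
  unfolding Gl_law_def using assms by (intro nn_integral_distr) (auto simp: measurable_l)

lemma AE_Gl_law_pos: "AE u in Gl_law (Suc n). 0 < u"
  unfolding Gl_law_def
  by (subst AE_distr_iff) (auto simp: measurable_l space_G intro!: AE_I2 l_pos)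

lemma climb_op_Gl_law:
  assumes [measurable]: "f \<in> borel_measurable SB"
  shows "climb_op f (n, x) = ennreal x *
    (\<integral>\<^sup>+u. indicator {u. x + u < A} u * f (Suc n, x + u) \<partial>Gl_law (Suc n))"
proof -
  have "(\<integral>\<^sup>+u. indicator {u. x + u < A} u * f (Suc n, x + u) \<partial>Gl_law (Suc n)) =
      (\<integral>\<^sup>+z. indicator {u. x + u < A} (l (Suc n) z) * f (Suc n, x + l (Suc n) z) \<partial>G)"
    by (rule nn_integral_Gl_law) measurable
  also have "\<dots> = (\<integral>\<^sup>+z. indicator {z. \<not> resets (n, x) z} z * f (Suc n, x + l (Suc n) z) \<partial>G)"
    by (intro nn_integral_cong) (simp add: indicator_def resets_eq not_le)
  finally show ?thesis by (simp add: climb_op_def)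
qed

lemma borel_measurable_jump_density [measurable (raw)]:
  assumes [measurable]: "f \<in> borel_measurable borel" "g \<in> borel_measurable M"
  shows "(\<lambda>x. jump_density (Suc n) f (g x)) \<in> borel_measurable M"
proof -
  interpret prob_space "Gl_law (Suc n)" by (rule prob_space_Gl_law)
  show ?thesis unfolding jump_density_def by measurable
qed

lemma borel_measurable_pi_density [measurable]: "pi_density K0 n \<in> borel_measurable borel"
proof (induction n rule: induct_nat_012)
  case 1
  interpret prob_space "Gl_law 1" using prob_space_Gl_law[of 0] by simp
  show ?case by (subst measurable_cong[OF pi_density.simps(2)]) measurable
next
  case (ge2 n)
  note [measurable] = ge2
  show ?case by (subst measurable_cong[OF pi_density.simps(3)]) measurable
qed simp

text \<open>A jump of size \<open>u\<close> lifts \<open>x\<close> to \<open>x + u < A\<close>, and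
  the flow then passes every \<open>v\<close> in between \<open>lo\<close> and \<open>x + u\<close>.
  Fubini puts the end position outside, where a density can be read off.\<close>

lemma step_op_density:
  assumes [measurable]: "f \<in> borel_measurable SB" and x: "lo \<le> x"
  shows "step_op f (n, x) = ennreal (1 / \<alpha>) * (\<integral>\<^sup>+v. \<integral>\<^sup>+u. indicator {lo<..} v * indicator {u. v < x + u \<and> x + u < A} u *
    (ennreal x * sojourn_density (x + u) v * f (Suc n, v)) \<partial>Gl_law (Suc n) \<partial>lborel)"
proof -
  interpret L: prob_space "Gl_law (Suc n)" by (rule prob_space_Gl_law)
  interpret pair_sigma_finite lborel "Gl_law (Suc n)" ..
  have [measurable]: "sojourn 0 f \<in> borel_measurable SB" by measurable
  let ?k = "\<lambda>v u. indicator {lo<..} v * indicator {u. v < x + u \<and> x + u < A} u *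
    (ennreal x * sojourn_density (x + u) v * f (Suc n, v))"
  have "step_op f (n, x) = (\<integral>\<^sup>+u. ennreal x * (indicator {u. x + u < A} u * sojourn 0 f (Suc n, x + u)) \<partial>Gl_law (Suc n))"
    unfolding step_op_def by (subst climb_op_Gl_law) (auto simp: nn_integral_cmult)
  also have "\<dots> = (\<integral>\<^sup>+u. ennreal (1 / \<alpha>) * (\<integral>\<^sup>+v. ?k v u \<partial>lborel) \<partial>Gl_law (Suc n))"
  proof (rule nn_integral_cong_AE)
    show "AE u in Gl_law (Suc n). ennreal x * (indicator {u. x + u < A} u * sojourn 0 f (Suc n, x + u)) =
      ennreal (1 / \<alpha>) * (\<integral>\<^sup>+v. ?k v u \<partial>lborel)"
      using AE_Gl_law_pos
    proof eventually_elim
      case (elim u)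
      have "(\<integral>\<^sup>+v. ?k v u \<partial>lborel) = (\<integral>\<^sup>+v. ennreal x * (indicator {u. x + u < A} u *
          (indicator {lo<..<x + u} v * (sojourn_density (x + u) v * f (Suc n, v)))) \<partial>lborel)"
        by (intro nn_integral_cong) (auto simp: indicator_def mult_ac)
      also have "\<dots> = ennreal x * (indicator {u. x + u < A} u *
          (\<integral>\<^sup>+v. indicator {lo<..<x + u} v * (sojourn_density (x + u) v * f (Suc n, v)) \<partial>lborel))"
        by (simp add: nn_integral_cmult)
      finally show ?case using x elim by (subst sojourn_eq_density) (auto simp: mult_ac)
    qed
  qed
  also have "\<dots> = ennreal (1 / \<alpha>) * (\<integral>\<^sup>+u. \<integral>\<^sup>+v. ?k v u \<partial>lborel \<partial>Gl_law (Suc n))"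
    by (rule nn_integral_cmult) measurable
  also have "(\<integral>\<^sup>+u. \<integral>\<^sup>+v. ?k v u \<partial>lborel \<partial>Gl_law (Suc n)) = (\<integral>\<^sup>+v. \<integral>\<^sup>+u. ?k v u \<partial>Gl_law (Suc n) \<partial>lborel)"
    by (rule Fubini') (simp add: split_beta', measurable)
  finally show ?thesis .
qed

lemma pi_density_1_eq:
  "pi_density K0 (Suc 0) v = ennreal (K0 / \<alpha>) *
    (\<integral>\<^sup>+u. indicator {u. v < lo + u \<and> lo + u < A} u * sojourn_density (lo + u) v \<partial>Gl_law (Suc 0))"
  by (simp add: sojourn_density_def add.commute[of lo])

text \<open>Substituting the state \<open>x = lo + y - u\<close> before the jump.\<close>

lemma pi_density_Suc_eq:
  assumes v: "lo < v"
  shows "pi_density K0 (Suc (Suc n)) v = ennreal (1 / \<alpha>) *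
    (\<integral>\<^sup>+x. \<integral>\<^sup>+u. indicator {lo<..<A} x * indicator {u. v < x + u \<and> x + u < A} u *
      (ennreal x * sojourn_density (x + u) v * pi_density K0 (Suc n) x) \<partial>Gl_law (Suc (Suc n)) \<partial>lborel)"
proof -
  let ?L = "Gl_law (Suc (Suc n))" and ?p = "pi_density K0 (Suc n)"
  interpret L: prob_space ?L by (rule prob_space_Gl_law)
  interpret pair_sigma_finite lborel ?L ..
  let ?h = "\<lambda>w u. indicator {v..A} w * indicator {u. u + lo < w} u *
    (sojourn_density w v * (ennreal (w - u) * ?p (w - u)))"
  let ?k = "\<lambda>x u. indicator {lo<..<A} x * indicator {u. v < x + u \<and> x + u < A} u *
      (ennreal x * sojourn_density (x + u) v * ?p x)"
  define \<phi> where "\<phi> w = indicator {v..A} w * sojourn_density w v * jump_density (Suc (Suc n)) ?p w" for w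
  have [measurable]: "\<phi> \<in> borel_measurable borel" unfolding \<phi>_def by measurable
  have "(\<integral>\<^sup>+y\<in>{v - lo..A - lo}. ennreal (F (lo + y) / (y * F v)) * jump_density (Suc (Suc n)) ?p (lo + y) \<partial>lborel)
    = (\<integral>\<^sup>+y. indicator {v..A} (lo + y) * sojourn_density (lo + y) v * jump_density (Suc (Suc n)) ?p (lo + y) \<partial>lborel)"
  proof (rule nn_integral_cong)
    fix y :: real
    have "indicator {v..A} (lo + y) = (indicator {v - lo..A - lo} y :: ennreal)"
      by (auto simp: indicator_def)
    then show "ennreal (F (lo + y) / (y * F v)) * jump_density (Suc (Suc n)) ?p (lo + y) * indicator {v - lo..A - lo} y =
        indicator {v..A} (lo + y) * sojourn_density (lo + y) v * jump_density (Suc (Suc n)) ?p (lo + y)"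
      by (simp only: sojourn_density_def add_diff_cancel_left' mult_ac)
  qed
  also have "\<dots> = (\<integral>\<^sup>+y. \<phi> (lo + 1 * y) \<partial>lborel)" by (simp add: \<phi>_def)
  also have "\<dots> = (\<integral>\<^sup>+w. \<phi> w \<partial>lborel)"
    using nn_integral_real_affine[of \<phi> 1 lo] by simp
  also have "\<dots> = (\<integral>\<^sup>+w. \<integral>\<^sup>+u. ?h w u \<partial>?L \<partial>lborel)"
    unfolding jump_density_def \<phi>_def
    by (rule nn_integral_cong, subst nn_integral_cmult[symmetric], measurable) (simp only: mult_ac)
  also have "\<dots> = (\<integral>\<^sup>+u. \<integral>\<^sup>+w. ?h w u \<partial>lborel \<partial>?L)"
    by (rule Fubini'[symmetric]) (simp add: split_beta', measurable)
  also have "\<dots> = (\<integral>\<^sup>+u. \<integral>\<^sup>+x. ?k x u \<partial>lborel \<partial>?L)"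
  proof (rule nn_integral_cong_AE)
    show "AE u in ?L. (\<integral>\<^sup>+w. ?h w u \<partial>lborel) = (\<integral>\<^sup>+x. ?k x u \<partial>lborel)"
      using AE_Gl_law_pos
    proof eventually_elim
      case (elim u)
      have "(\<integral>\<^sup>+w. ?h w u \<partial>lborel) = (\<integral>\<^sup>+x. ?h (u + x) u \<partial>lborel)"
        by (subst nn_integral_real_affine[where c = 1 and t = u]) auto
      also have "\<dots> = (\<integral>\<^sup>+x. ?k x u \<partial>lborel)"
      proof (rule nn_integral_cong_AE)
        \<comment> \<open>The recursion integrates over a closed interval, whereas here
          \<open>x + u\<close> lies strictly between \<open>v\<close> and \<open>A\<close>; only the
          two end points differ. The bound \<open>x < A\<close> follows from
          \<open>u > 0\<close>.\<close>
        have "AE x in lborel. x \<noteq> v - u" "AE x in lborel. x \<noteq> A - u" by (rule AE_lborel_singleton)+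
        then show "AE x in lborel. ?h (u + x) u = ?k x u"
          by eventually_elim (use elim in \<open>auto simp: indicator_def mult_ac add.commute\<close>)
      qed
      finally show ?case .
    qed
  qed
  also have "\<dots> = (\<integral>\<^sup>+x. \<integral>\<^sup>+u. ?k x u \<partial>?L \<partial>lborel)"
    by (rule Fubini') (simp add: split_beta', measurable)
  finally show ?thesis by simp
qed

text \<open>\<open>K0 / lo\<close> is the mass of the atom. The induction peels off the last step by
  passing from \<open>f\<close> to \<open>step_op f\<close>, hence the generalisation over
  \<open>f\<close>; by duality, this step acts on the density of one level and yields the density of
  the next.\<close>

lemma step_power_density:
  assumes K0: "0 < K0" and "f \<in> borel_measurable SB"
  shows "ennreal (K0 / lo) * (step_op ^^ Suc n) f origin =
    (\<integral>\<^sup>+x. indicator {lo<..<A} x * (pi_density K0 (Suc n) x * f (Suc n, x)) \<partial>lborel)"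
  using assms(2)
proof (induction n arbitrary: f)
  case 0
  note [measurable] = 0
  interpret L: prob_space "Gl_law (Suc 0)" by (rule prob_space_Gl_law)
  have c: "ennreal (K0 / lo) * (ennreal (1 / \<alpha>) * ennreal lo) = ennreal (K0 / \<alpha>)"
    using K0 lo_pos alpha_pos by (simp flip: ennreal_mult)
  let ?L0 = "Gl_law (Suc 0)"
  let ?b = "\<lambda>v u. indicator {u. v < lo + u \<and> lo + u < A} u :: ennreal"
  let ?d = "\<lambda>v u. indicator {lo<..} v * ?b v u * (ennreal lo * sojourn_density (lo + u) v * f (Suc 0, v))"
  let ?e = "\<lambda>v u. indicator {lo<..<A} v * f (Suc 0, v) * (?b v u * sojourn_density (lo + u) v)"
  have "(step_op ^^ Suc 0) f origin = ennreal (1 / \<alpha>) * (\<integral>\<^sup>+v. \<integral>\<^sup>+u. ?d v u \<partial>?L0 \<partial>lborel)"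
    using step_op_density[of f lo 0] by simp
  also have "(\<integral>\<^sup>+v. \<integral>\<^sup>+u. ?d v u \<partial>?L0 \<partial>lborel) =
      (\<integral>\<^sup>+v. ennreal lo * (\<integral>\<^sup>+u. ?e v u \<partial>?L0) \<partial>lborel)"
  proof (rule nn_integral_cong)
    fix v
    have "(\<integral>\<^sup>+u. ?d v u \<partial>?L0)
      = (\<integral>\<^sup>+u. ennreal lo * ?e v u \<partial>?L0)"
    proof (rule nn_integral_cong)
      fix u
      \<comment> \<open>The condition \<open>v < lo + u < A\<close> already forces
        \<open>v < A\<close>.\<close>
      have "indicator {lo<..} v * ?b v u = indicator {lo<..<A} v * ?b v u" by (auto simp: indicator_def)
      then have "?d v u =
        indicator {lo<..<A} v * ?b v u * (ennreal lo * sojourn_density (lo + u) v * f (Suc 0, v))"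
        by (simp only:)
      also have "\<dots> = ennreal lo * ?e v u" by (simp only: mult_ac)
      finally show "?d v u =
        ennreal lo * ?e v u" .
    qed
    also have "\<dots> = ennreal lo * (\<integral>\<^sup>+u. ?e v u \<partial>?L0)"
      by (rule nn_integral_cmult) measurable
    finally show "(\<integral>\<^sup>+u. ?d v u \<partial>?L0) =
      ennreal lo * (\<integral>\<^sup>+u. ?e v u \<partial>?L0)" .
  qed
  also have "\<dots> = ennreal lo * (\<integral>\<^sup>+v. \<integral>\<^sup>+u. ?e v u \<partial>?L0 \<partial>lborel)"
    by (rule nn_integral_cmult) measurable
  finally have "ennreal (K0 / lo) * (step_op ^^ Suc 0) f origin =
      ennreal (K0 / \<alpha>) * (\<integral>\<^sup>+v. (\<integral>\<^sup>+u. ?e v u \<partial>?L0) \<partial>lborel)"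
    by (simp only: c[symmetric] mult.assoc)
  also have "\<dots> = (\<integral>\<^sup>+v. ennreal (K0 / \<alpha>) * (\<integral>\<^sup>+u. ?e v u \<partial>?L0) \<partial>lborel)"
    by (rule nn_integral_cmult[symmetric]) measurable
  also have "\<dots> = (\<integral>\<^sup>+x. indicator {lo<..<A} x * (pi_density K0 (Suc 0) x * f (Suc 0, x)) \<partial>lborel)"
  proof (rule nn_integral_cong)
    fix v
    have eq: "(\<integral>\<^sup>+u. ?e v u \<partial>?L0) =
      indicator {lo<..<A} v * f (Suc 0, v) *
        (\<integral>\<^sup>+u. ?b v u * sojourn_density (lo + u) v \<partial>?L0)"
      by (rule nn_integral_cmult) measurable
    show "ennreal (K0 / \<alpha>) * (\<integral>\<^sup>+u. ?e v u \<partial>?L0) =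
      indicator {lo<..<A} v * (pi_density K0 (Suc 0) v * f (Suc 0, v))"
    proof (cases "lo < v")
      case True
      show ?thesis
        unfolding pi_density_1_eq eq by (simp only: mult_ac)
    qed (simp add: eq)
  qed
  finally show ?case .
next
  case (Suc n)
  note [measurable] = Suc.prems
  let ?L = "Gl_law (Suc (Suc n))" and ?p = "pi_density K0 (Suc n)"
  interpret L: prob_space ?L by (rule prob_space_Gl_law)
  have [measurable]: "step_op f \<in> borel_measurable SB"
    by (rule kernel_op_measurable[OF kernel_op_step_op]) measurable
  let ?w = "\<lambda>v. indicator {lo<..<A} v * f (Suc (Suc n), v)"
  let ?d = "\<lambda>x v u. indicator {lo<..} v * indicator {u. v < x + u \<and> x + u < A} u *
      (ennreal x * sojourn_density (x + u) v * f (Suc (Suc n), v))"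
  let ?k = "\<lambda>x v u. indicator {lo<..<A} x * indicator {u. v < x + u \<and> x + u < A} u *
      (ennreal x * sojourn_density (x + u) v * ?p x)"
  have "ennreal (K0 / lo) * (step_op ^^ Suc (Suc n)) f origin =
      ennreal (K0 / lo) * (step_op ^^ Suc n) (step_op f) origin"
    by (simp add: funpow_Suc_right[of "Suc n"] del: funpow.simps)
  also have "\<dots> = (\<integral>\<^sup>+x. indicator {lo<..<A} x * (?p x * step_op f (Suc n, x)) \<partial>lborel)"
    by (rule Suc.IH) measurable
  also have "\<dots> = (\<integral>\<^sup>+x. \<integral>\<^sup>+v. ennreal (1 / \<alpha>) * (?w v * (\<integral>\<^sup>+u. ?k x v u \<partial>?L)) \<partial>lborel \<partial>lborel)"
  proof (rule nn_integral_cong)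
    fix x :: real
    show "indicator {lo<..<A} x * (?p x * step_op f (Suc n, x)) =
      (\<integral>\<^sup>+v. ennreal (1 / \<alpha>) * (?w v * (\<integral>\<^sup>+u. ?k x v u \<partial>?L)) \<partial>lborel)"
    proof (cases "x \<in> {lo<..<A}")
      case True
      have "(\<integral>\<^sup>+v. ennreal (1 / \<alpha>) * (?w v * (\<integral>\<^sup>+u. ?k x v u \<partial>?L)) \<partial>lborel)
        = (\<integral>\<^sup>+v. ?p x * (ennreal (1 / \<alpha>) * (\<integral>\<^sup>+u. ?d x v u \<partial>?L)) \<partial>lborel)"
      proof (rule nn_integral_cong)
        fix v :: real
        have "?w v * (\<integral>\<^sup>+u. ?k x v u \<partial>?L) =
            (\<integral>\<^sup>+u. ?w v * ?k x v u \<partial>?L)"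
          by (rule nn_integral_cmult[symmetric]) measurable
        also have "\<dots> = (\<integral>\<^sup>+u. ?p x * (?d x v u) \<partial>?L)"
        proof (rule nn_integral_cong)
          fix u
          let ?b = "indicator {u. v < x + u \<and> x + u < A} u :: ennreal"
          have b: "indicator {lo<..<A} v * ?b = indicator {lo<..} v * ?b"
            by (auto simp: indicator_def)
          have "?w v * ?k x v u =
            indicator {lo<..<A} v * ?b * (f (Suc (Suc n), v) * (ennreal x * sojourn_density (x + u) v * ?p x))"
            using True by (simp add: mult_ac)
          also have "\<dots> = ?p x * (indicator {lo<..} v * ?b * (ennreal x * sojourn_density (x + u) v * f (Suc (Suc n), v)))"
            unfolding b by (simp only: mult_ac)
          finally show "?w v * ?k x v u =
            ?p x * (indicator {lo<..} v * ?b * (ennreal x * sojourn_density (x + u) v * f (Suc (Suc n), v)))" .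
        qed
        also have "\<dots> = ?p x * (\<integral>\<^sup>+u. ?d x v u \<partial>?L)"
          by (rule nn_integral_cmult) measurable
        finally show "ennreal (1 / \<alpha>) * (?w v * (\<integral>\<^sup>+u. ?k x v u \<partial>?L)) =
          ?p x * (ennreal (1 / \<alpha>) * (\<integral>\<^sup>+u. ?d x v u \<partial>?L))"
          by (simp add: mult.left_commute)
      qed
      also have "\<dots> = ?p x * (ennreal (1 / \<alpha>) * (\<integral>\<^sup>+v. \<integral>\<^sup>+u. ?d x v u \<partial>?L \<partial>lborel))"
      proof -
        let ?j = "\<lambda>v. \<integral>\<^sup>+u. ?d x v u \<partial>?L"
        have [measurable]: "?j \<in> borel_measurable lborel" by measurable
        have "(\<integral>\<^sup>+v. ?p x * (ennreal (1 / \<alpha>) * ?j v) \<partial>lborel) = ?p x * (\<integral>\<^sup>+v. ennreal (1 / \<alpha>) * ?j v \<partial>lborel)"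
          by (rule nn_integral_cmult) measurable
        also have "(\<integral>\<^sup>+v. ennreal (1 / \<alpha>) * ?j v \<partial>lborel) = ennreal (1 / \<alpha>) * (\<integral>\<^sup>+v. ?j v \<partial>lborel)"
          by (rule nn_integral_cmult) measurable
        finally show ?thesis .
      qed
      also have "\<dots> = ?p x * step_op f (Suc n, x)"
        using step_op_density[OF Suc.prems, of x "Suc n"] True by simp
      finally show ?thesis using True by simp
    qed simp
  qed
  \<comment> \<open>With \<open>v\<close> outside, the inner integral is the right-hand side of the
    recursion for the density at \<open>v\<close>.\<close>
  also have "\<dots> = (\<integral>\<^sup>+v. \<integral>\<^sup>+x. ennreal (1 / \<alpha>) * (?w v * (\<integral>\<^sup>+u. ?k x v u \<partial>?L)) \<partial>lborel \<partial>lborel)"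
    by (rule lborel_pair.Fubini') (simp add: split_beta', measurable)
  also have "\<dots> = (\<integral>\<^sup>+x. indicator {lo<..<A} x * (pi_density K0 (Suc (Suc n)) x * f (Suc (Suc n), x)) \<partial>lborel)"
  proof (rule nn_integral_cong)
    fix v :: real
    have eq: "(\<integral>\<^sup>+x. ennreal (1 / \<alpha>) * (?w v * (\<integral>\<^sup>+u. ?k x v u \<partial>?L)) \<partial>lborel) =
      ennreal (1 / \<alpha>) * (?w v * (\<integral>\<^sup>+x. \<integral>\<^sup>+u. ?k x v u \<partial>?L \<partial>lborel))"
    proof -
      let ?j = "\<lambda>x. \<integral>\<^sup>+u. ?k x v u \<partial>?L"
      have [measurable]: "?j \<in> borel_measurable lborel" by measurable
      have "(\<integral>\<^sup>+x. ennreal (1 / \<alpha>) * (?w v * ?j x) \<partial>lborel) =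
        ennreal (1 / \<alpha>) * (\<integral>\<^sup>+x. ?w v * ?j x \<partial>lborel)"
        by (rule nn_integral_cmult) measurable
      also have "(\<integral>\<^sup>+x. ?w v * ?j x \<partial>lborel) =
        ?w v * (\<integral>\<^sup>+x. ?j x \<partial>lborel)"
        by (rule nn_integral_cmult) measurable
      finally show ?thesis .
    qed
    show "(\<integral>\<^sup>+x. ennreal (1 / \<alpha>) * (?w v * (\<integral>\<^sup>+u. ?k x v u \<partial>?L)) \<partial>lborel) =
      indicator {lo<..<A} v * (pi_density K0 (Suc (Suc n)) v * f (Suc (Suc n), v))"
    proof (cases "lo < v")
      case True
      then show ?thesis
        unfolding pi_density_Suc_eq[OF True] eq by (simp only: mult_ac)
    qed (simp add: eq)
  qed
  finally show ?case .
qed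

end

section \<open>Consequences of certain resets\<close>

locale recurrent_at_reset_level = drift_to_reset_level +
  assumes reset_sure: "\<And>y. y \<in> space SY \<Longrightarrow> \<P>(\<omega> in noise. T_A y \<omega> < \<infinity>) = 1"
begin

text \<open>The events of no reset among the first \<open>m\<close> jumps decrease to the event of
  no reset at all, on which \<open>T_A\<close> is infinite.\<close>

lemma no_reset_tendsto_0:
  assumes y: "y \<in> states"
  shows "(\<lambda>m. (climb_chain ^^ m) (\<lambda>_. 1) y) \<longlonglongrightarrow> 0"
proof -
  interpret prob_space noise by (rule prob_space_noise)
  note [measurable] = measurable_pre_jump[OF y]
  let ?N = "\<lambda>m. {\<omega> \<in> space noise. \<forall>k<m. \<not> resets (pre_jump y \<omega> k) (snd (\<omega> k))}"
  have eq: "emeasure noise (?N m) = (climb_chain ^^ m) (\<lambda>_. 1) y" for m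
  proof -
    have "emeasure noise (?N m) = (\<integral>\<^sup>+\<omega>. indicator (?N m) \<omega> \<partial>noise)" by simp
    also have "\<dots> = (\<integral>\<^sup>+\<omega>. indicator {\<omega>. \<forall>k<m. \<not> resets (pre_jump y \<omega> k) (snd (\<omega> k))} \<omega> \<partial>noise)"
      by (intro nn_integral_cong) (simp add: indicator_def)
    finally show ?thesis by (simp add: nn_integral_no_reset[OF y])
  qed
  have "(\<lambda>m. emeasure noise (?N m)) \<longlonglongrightarrow> emeasure noise (\<Inter>m. ?N m)"
    by (intro Lim_emeasure_decseq) (auto simp: decseq_def)
  also have "emeasure noise (\<Inter>m. ?N m) = 0"
  proof -
    have "AE \<omega> in noise. \<omega> \<in> {\<omega> \<in> space noise. T_A y \<omega> < \<infinity>}"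
      using reset_sure[of y] y by (intro AE_prob_1) (simp add: space_SY)
    then have "AE \<omega> in noise. \<omega> \<notin> (\<Inter>m. ?N m)"
    proof eventually_elim
      case (elim \<omega>)
      have "{k. resets (pre_jump y \<omega> k) (snd (\<omega> k))} \<noteq> {}"
      proof
        assume "{k. resets (pre_jump y \<omega> k) (snd (\<omega> k))} = {}"
        \<comment> \<open>The infimum over the empty set is \<infinity>.\<close>
        then have "T_A y \<omega> = \<infinity>" unfolding T_A_def by (simp add: top_ereal_def)
        with elim show False by simp
      qed
      then show ?case by blast
    qed
    then have "emeasure noise {\<omega> \<in> space noise. \<omega> \<in> (\<Inter>m. ?N m)} = 0"
      by (intro emeasure_eq_0_AE) simp
    moreover have "{\<omega> \<in> space noise. \<omega> \<in> (\<Inter>m. ?N m)} = (\<Inter>m. ?N m)" by blast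
    ultimately show ?thesis by simp
  qed
  finally show ?thesis by (simp add: eq)
qed

text \<open>The limit of \<open>occupied_cycle\<close> from the atom as \<open>m\<close> grows: the
  windows still climbing are bounded by \<open>t\<close> times the probability of no reset, and the
  reset probabilities sum to 1. Both sides then contain \<open>occupied t f origin\<close>, which is
  at most \<open>t\<close> for \<open>f \<le> 1\<close> and can be cancelled although the sums may
  be infinite.\<close>

lemma occ_trans_op:
  assumes t: "0 \<le> t" and f [measurable]: "f \<in> borel_measurable SB" and f1: "\<And>y. f y \<le> 1"
  shows "occ (trans_op t f) = occ f"
proof -
  let ?H = "occupied t f"
  let ?a = "\<lambda>k. (climb_chain ^^ k) (sojourn 0 (trans_op t f)) origin"
  let ?b = "\<lambda>k. (climb_chain ^^ k) (sojourn 0 f) origin"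
  let ?r = "\<lambda>m. \<Sum>k<m. (climb_chain ^^ k) (sojourn 0 reset_rate) origin"
  let ?T = "\<lambda>m. (climb_chain ^^ m) (\<lambda>_. 1) origin"
  have H: "?H y \<le> ennreal t" for y by (rule occupied_le[OF f f1 t])
  have T: "?T \<longlonglongrightarrow> 0" by (rule no_reset_tendsto_0[OF origin_mem])
  have TH: "(\<lambda>m. (climb_chain ^^ m) ?H origin) \<longlonglongrightarrow> 0"
  proof (rule tendsto_sandwich[OF _ _ tendsto_const])
    have "(climb_chain ^^ m) ?H origin \<le> ennreal t * ?T m" for m
    proof -
      have "(climb_chain ^^ m) ?H origin \<le> (climb_chain ^^ m) (\<lambda>_. ennreal t * 1) origin"
        using H by (intro climb_power_mono origin_mem) auto
      also have "\<dots> = ennreal t * ?T m"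
        by (rule kernel_op_cmult[OF kernel_op_climb_power]) simp
      finally show ?thesis .
    qed
    then show "\<forall>\<^sub>F m in sequentially. (climb_chain ^^ m) ?H origin \<le> ennreal t * ?T m" by simp
    show "(\<lambda>m. ennreal t * ?T m) \<longlonglongrightarrow> 0"
      using ennreal_tendsto_cmult[OF _ T, of "ennreal t"] by simp
  qed simp
  have "?r \<longlonglongrightarrow> (\<Sum>k. (climb_chain ^^ k) (sojourn 0 reset_rate) origin)"
    by (intro summable_LIMSEQ summableI)
  then have "(\<lambda>m. ?r m + ?T m) \<longlonglongrightarrow> (\<Sum>k. (climb_chain ^^ k) (sojourn 0 reset_rate) origin) + 0"
    by (intro tendsto_add T)
  then have "(\<Sum>k. (climb_chain ^^ k) (sojourn 0 reset_rate) origin) = 1"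
    by (simp add: sum_reset_climb_power[OF origin_mem] LIMSEQ_const_iff)
  then have r: "?r \<longlonglongrightarrow> 1"
    using summable_LIMSEQ[OF summableI] by metis
  have H_fin: "?H origin < \<top>" using H[of origin] by (simp add: le_less_trans)
  have b: "(\<lambda>m. (\<Sum>k<m. ?b k) + (climb_chain ^^ m) ?H origin + ?H origin * ?r m) \<longlonglongrightarrow>
      (\<Sum>k. ?b k) + 0 + ?H origin * 1"
    by (intro tendsto_add TH summable_LIMSEQ summableI ennreal_tendsto_cmult H_fin r)
  have "(\<lambda>m. (\<Sum>k<m. ?a k) + ?H origin) \<longlonglongrightarrow> (\<Sum>k. ?a k) + ?H origin"
    by (intro tendsto_add tendsto_const summable_LIMSEQ summableI)
  then have a: "(\<lambda>m. (\<Sum>k<m. ?b k) + (climb_chain ^^ m) ?H origin + ?H origin * ?r m) \<longlonglongrightarrow>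
      (\<Sum>k. ?a k) + ?H origin"
    unfolding occupied_cycle[OF t f origin_mem] by (simp only: mult.commute)
  have "(\<Sum>k. ?b k) + ?H origin = (\<Sum>k. ?a k) + ?H origin"
    using LIMSEQ_unique[OF b a] by simp
  then have "(\<Sum>k. ?b k) = (\<Sum>k. ?a k)"
    using H_fin ennreal_add_left_cancel[of "?H origin"] by (auto simp: add.commute)
  then show ?thesis by (simp add: occ_eq)
qed

lemma cycle_measure:
  obtains \<mu> where "invariant_measure \<mu>" "\<And>f. f \<in> borel_measurable SB \<Longrightarrow> (\<integral>\<^sup>+y. f y \<partial>\<mu>) = occ f"
proof -
  obtain \<nu> where \<nu>: "sets \<nu> = sets SB" "\<And>f. f \<in> borel_measurable SB \<Longrightarrow> occ f = (\<integral>\<^sup>+y. f y \<partial>\<nu>)"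
    using integral_functional_measure[OF integral_functional_occ] by blast
  have space_\<nu>: "space \<nu> = UNIV" using sets_eq_imp_space_eq[OF \<nu>(1)] by simp
  define \<mu> where "\<mu> = restrict_space \<nu> states"
  have sets: "sets \<mu> = sets SY"
    unfolding \<mu>_def sets_SY by (rule sets_restrict_space_cong[OF \<nu>(1)])
  have space: "space \<mu> = states" using sets_eq_imp_space_eq[OF sets] by (simp add: space_SY)
  have int: "(\<integral>\<^sup>+y. f y \<partial>\<mu>) = occ f" if [measurable]: "f \<in> borel_measurable SB" for f
  proof -
    have "(\<integral>\<^sup>+y. f y \<partial>\<mu>) = (\<integral>\<^sup>+y. f y * indicator states y \<partial>\<nu>)"
      unfolding \<mu>_def using states_sets \<nu>(1) space_\<nu> by (intro nn_integral_restrict_space) simp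
    also have "\<dots> = occ (\<lambda>y. f y * indicator states y)" by (rule \<nu>(2)[symmetric]) measurable
    also have "\<dots> = occ f" by (rule occ_cong) simp
    finally show ?thesis .
  qed
  have em: "emeasure \<mu> E = occ (indicator E)" if E: "E \<in> sets SY" for E
  proof -
    have [measurable]: "E \<in> sets SB" using E by (simp add: sets_SY_iff)
    have "emeasure \<mu> E = (\<integral>\<^sup>+y. indicator E y \<partial>\<mu>)" using E by (simp add: sets)
    also have "\<dots> = occ (indicator E)" by (rule int) measurable
    finally show ?thesis .
  qed
  have "invariant_measure \<mu>"
    unfolding invariant_measure_def
  proof (intro conjI allI impI ballI)
    have L: "{n} \<times> {lo..<A} \<in> sets SY" for n
      by (simp add: sets_SY_iff) auto
    show "sigma_finite_measure \<mu>"
    proof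
      show "\<exists>\<A>. countable \<A> \<and> \<A> \<subseteq> sets \<mu> \<and> \<Union> \<A> = space \<mu> \<and> (\<forall>a\<in>\<A>. emeasure \<mu> a \<noteq> \<infinity>)"
      \<comment> \<open>The levels cover the state space, and each has mass at most 1.\<close>
      proof (intro exI[of _ "range (\<lambda>n. {n} \<times> {lo..<A})"] conjI ballI)
        fix a assume "a \<in> range (\<lambda>n::nat. {n} \<times> {lo..<A})"
        then obtain n where a: "a = {n} \<times> {lo..<A}" by blast
        have "emeasure \<mu> a \<le> 1"
          unfolding a em[OF L] by (rule occ_level_le[of _ n]) (auto simp: indicator_def)
        also have "\<dots> < \<infinity>" by simp
        finally show "emeasure \<mu> a \<noteq> \<infinity>" by simp
      qed (use L in \<open>auto simp: sets space\<close>)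
    qed
    have "1 = occ (indicator {origin})" by (simp add: occ_origin)
    also have "\<dots> \<le> occ (indicator states)"
      by (rule occ_mono) (simp add: indicator_def)
    also have "\<dots> = emeasure \<mu> (space \<mu>)"
      unfolding space by (rule em[symmetric]) (simp add: sets_SY_iff)
    finally show "emeasure \<mu> (space \<mu>) \<noteq> 0" by auto
    fix t :: real and B assume t: "0 \<le> t" and B: "B \<in> sets SY"
    have [measurable]: "B \<in> sets SB" using B by (simp add: sets_SY_iff)
    have "(\<integral>\<^sup>+y. emeasure (transition t y) B \<partial>\<mu>) = (\<integral>\<^sup>+y. trans_op t (indicator B) y \<partial>\<mu>)"
      by (intro nn_integral_cong) (simp add: space emeasure_transition[OF _ t B])
    also have "\<dots> = occ (trans_op t (indicator B))" by (rule int) measurable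
    also have "\<dots> = occ (indicator B)" by (rule occ_trans_op[OF t]) (auto simp: indicator_def)
    finally show "(\<integral>\<^sup>+y. emeasure (transition t y) B \<partial>\<mu>) = emeasure \<mu> B"
      by (simp add: em[OF B])
  qed (fact sets)
  then show ?thesis using int by (rule that)
qed

text \<open>Follows the path until its first reset, where it starts afresh from the atom. It is an
  inequality because visits to the atom before the reset are dropped; with \<open>q = 0\<close> the
  factor is the plain probability of a reset.\<close>

lemma resolvent_0_origin_ge:
  assumes y: "y \<in> states"
  shows "(\<Sum>k<m. (climb_chain ^^ k) (sojourn 0 reset_rate) y) * resolvent 0 (indicator {origin}) origin +
    (climb_chain ^^ m) (resolvent 0 (indicator {origin})) y \<le> resolvent 0 (indicator {origin}) y"
proof (induction m)
  case (Suc m)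
  let ?T = "climb_chain ^^ m" and ?U = "resolvent 0 (indicator {origin})"
  have "?T (sojourn 0 reset_rate) y * ?U origin + ?T (sojourn 0 (climb_op ?U)) y =
      ?T (\<lambda>y. ?U origin * sojourn 0 reset_rate y) y + ?T (sojourn 0 (climb_op ?U)) y"
    by (subst kernel_op_cmult[OF kernel_op_climb_power]) (auto simp: mult.commute)
  also have "\<dots> = ?T (\<lambda>y. ?U origin * sojourn 0 reset_rate y + sojourn 0 (climb_op ?U) y) y"
    by (rule kernel_op_add[OF kernel_op_climb_power, symmetric]) measurable
  also have "\<dots> \<le> ?T ?U y"
  proof (rule climb_power_mono[OF _ y])
    fix y assume y: "y \<in> states"
    have "?U y = sojourn 0 (indicator {origin}) y + sojourn 0 (jump_op ?U) y"
      by (rule resolvent_first_jump[OF y]) measurable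
    also have "sojourn 0 (jump_op ?U) y = sojourn 0 (climb_op ?U) y + sojourn 0 reset_rate y * ?U origin"
      by (rule sojourn_jump_op_split) measurable
    finally show "?U origin * sojourn 0 reset_rate y + sojourn 0 (climb_op ?U) y \<le> ?U y"
      by (simp add: ac_simps add_increasing)
  qed
  finally have "?T (sojourn 0 reset_rate) y * ?U origin + ?T (sojourn 0 (climb_op ?U)) y \<le> ?T ?U y" .
  then have "(\<Sum>k<m. (climb_chain ^^ k) (sojourn 0 reset_rate) y) * ?U origin +
      (?T (sojourn 0 reset_rate) y * ?U origin + ?T (sojourn 0 (climb_op ?U)) y) \<le>
      (\<Sum>k<m. (climb_chain ^^ k) (sojourn 0 reset_rate) y) * ?U origin + ?T ?U y"
    by (rule add_left_mono)
  also note Suc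
  finally show ?case
    by (simp add: climb_power_Suc distrib_left distrib_right ac_simps del: funpow.simps)
qed simp

text \<open>Every state reaches the atom with positive probability by a reset, and the atom is held
  for a positive time.\<close>

lemma resolvent_origin_pos:
  assumes y: "y \<in> states" shows "0 < resolvent 1 (indicator {origin}) y"
proof -
  let ?U = "\<lambda>q. resolvent q (indicator {origin})"
  have "0 < ennreal (1 / lo)" using lo_pos by simp
  also have "\<dots> = sojourn 0 (indicator {origin}) origin" by (simp add: sojourn_lo)
  also have "\<dots> \<le> ?U 0 origin"
    by (subst resolvent_first_jump[OF origin_mem]) auto
  finally have o: "0 < ?U 0 origin" .
  have "\<exists>m. (climb_chain ^^ m) (\<lambda>_. 1) y < 1"
    using order_tendstoD(2)[OF no_reset_tendsto_0[OF y], of 1] by (auto simp: eventually_sequentially)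
  then obtain m where m: "(climb_chain ^^ m) (\<lambda>_. 1) y < 1" ..
  then have "(\<Sum>k<m. (climb_chain ^^ k) (sojourn 0 reset_rate) y) \<noteq> 0"
    using sum_reset_climb_power[OF y, of m] by (metis add_0 less_irrefl)
  then have "0 < (\<Sum>k<m. (climb_chain ^^ k) (sojourn 0 reset_rate) y) * ?U 0 origin"
    using o by (simp add: ennreal_zero_less_mult_iff zero_less_iff_neq_zero)
  also have "\<dots> \<le> ?U 0 y"
    using resolvent_0_origin_ge[OF y, of m] by (rule order_trans[rotated]) simp
  finally have U0: "0 < ?U 0 y" .
  \<comment> \<open>The weights for \<open>q = 1\<close> and \<open>q = 0\<close> vanish at the same
    times, so \<open>?U 1 y = 0\<close> would give \<open>?U 0 y = 0\<close>.\<close>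
  have "?U 1 y \<noteq> 0"
  proof
    assume "?U 1 y = 0"
    then have "AE t in lborel. discount 1 t * trans_op t (indicator {origin}) y = 0"
      unfolding resolvent_def by (subst (asm) nn_integral_0_iff_AE) auto
    then have "AE t in lborel. discount 0 t * trans_op t (indicator {origin}) y = 0"
      by eventually_elim (auto simp: discount_def)
    then have "?U 0 y = 0"
      unfolding resolvent_def by (subst nn_integral_0_iff_AE) auto
    with U0 show False by simp
  qed
  then show ?thesis by (simp add: zero_less_iff_neq_zero)
qed

text \<open>The excess of an invariant measure over the multiple of the cycle measure with the same mass at
  \<open>(0, lo)\<close> vanishes, because \<open>resolvent 1 (indicator {(0, lo)})\<close> is positive and has the same
  integral with respect to both measures.\<close>

lemma invariant_eq_occ:
  assumes inv: "invariant_measure \<mu>"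
  shows "0 < emeasure \<mu> {origin}" "emeasure \<mu> {origin} < \<top>"
    and "f \<in> borel_measurable SB \<Longrightarrow> (\<integral>\<^sup>+y. f y \<partial>\<mu>) = emeasure \<mu> {origin} * occ f"
proof -
  define h where "h = resolvent 1 (indicator {origin})"
  define c where "c = emeasure \<mu> {origin}"
  have h [measurable]: "h \<in> borel_measurable SB" unfolding h_def by measurable
  have h_pos: "0 < h y" if "y \<in> states" for y
    unfolding h_def by (rule resolvent_origin_pos[OF that])
  have h_le: "h y \<le> 1" for y
    using resolvent_bound[of 1 "indicator {origin}" 1 y] by (simp add: h_def indicator_def)
  note sets = invariant_sets[OF inv] and space = invariant_space[OF inv]
  interpret sigma_finite_measure \<mu> using inv by (simp add: invariant_measure_def)
  have "{origin} \<in> sets SY" using origin_SB origin_mem by (simp add: sets_SY_iff)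
  then have o: "{origin} \<in> sets \<mu>" by (simp add: sets)
  have h_int: "(\<integral>\<^sup>+y. h y \<partial>\<mu>) = c"
  proof -
    have "ennreal 1 * (\<integral>\<^sup>+y. h y \<partial>\<mu>) = (\<integral>\<^sup>+y. indicator {origin} y \<partial>\<mu>)"
      unfolding h_def by (rule invariant_resolvent[OF inv]) auto
    then show ?thesis using o by (simp add: c_def)
  qed
  obtain \<mu>0 where \<mu>0: "invariant_measure \<mu>0" "\<And>f. f \<in> borel_measurable SB \<Longrightarrow> (\<integral>\<^sup>+y. f y \<partial>\<mu>0) = occ f"
    using cycle_measure by blast
  note sets0 = invariant_sets[OF \<mu>0(1)] and space0 = invariant_space[OF \<mu>0(1)]
  have h_occ: "occ h = 1"
  proof -
    have "ennreal 1 * (\<integral>\<^sup>+y. h y \<partial>\<mu>0) = (\<integral>\<^sup>+y. indicator {origin} y \<partial>\<mu>0)"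
      unfolding h_def by (rule invariant_resolvent[OF \<mu>0(1)]) auto
    then show ?thesis using \<mu>0(2)[OF h] \<mu>0(2)[of "indicator {origin}"] by (simp add: occ_origin)
  qed
  \<comment> \<open>Sigma-finiteness places the atom in some set of finite measure.\<close>
  have c_fin: "c < \<top>"
  proof -
    obtain B :: "nat \<Rightarrow> (nat \<times> real) set" where B: "range B \<subseteq> sets \<mu>" "(\<Union>i. B i) = space \<mu>"
      "\<And>i. emeasure \<mu> (B i) \<noteq> \<infinity>"
      using sigma_finite by blast
    obtain i where "origin \<in> B i" using B(2) origin_mem space by blast
    then have "emeasure \<mu> {origin} \<le> emeasure \<mu> (B i)" using B(1) by (intro emeasure_mono) auto
    then show ?thesis using B(3)[of i] by (auto simp: c_def less_top top_unique)
  qed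
  then show "emeasure \<mu> {origin} < \<top>" by (simp add: c_def)
  have "c \<noteq> 0"
  proof
    assume "c = 0"
    then have "AE y in \<mu>. h y = 0"
      using h_int measurable_invariant[OF inv h] by (simp add: nn_integral_0_iff_AE)
    then have "AE y in \<mu>. False"
      using AE_space
    proof eventually_elim
      case (elim y)
      then show ?case using h_pos[of y] space by auto
    qed
    then have "emeasure \<mu> (space \<mu>) = 0"
      using emeasure_eq_0_AE[where P = "\<lambda>_. True" and M = \<mu>] by simp
    then show False using inv by (simp add: invariant_measure_def)
  qed
  then show "0 < emeasure \<mu> {origin}" by (simp add: c_def zero_less_iff_neq_zero)
  have eq: "(\<integral>\<^sup>+y. h y * indicator E y \<partial>\<mu>) = c * occ (\<lambda>y. h y * indicator E y)" if E: "E \<in> sets SB" for E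
  proof -
    note [measurable] = E
    let ?a = "\<lambda>E. \<integral>\<^sup>+y. h y * indicator E y \<partial>\<mu>" and ?b = "\<lambda>E. c * occ (\<lambda>y. h y * indicator E y)"
    have ge: "?b E \<le> ?a E" if [measurable]: "E \<in> sets SB" for E
      unfolding c_def
      by (rule invariant_ge[OF inv, where c = 1]) (measurable, auto simp: indicator_def h_le)
    have split: "h y * indicator E y + h y * indicator (- E) y = h y" for y
      by (simp add: indicator_def)
    have E': "- E \<in> sets SB" using sets.compl_sets[OF E] by (simp add: Compl_eq_Diff_UNIV)
    note [measurable] = E'
    have "?a E + ?a (- E) = (\<integral>\<^sup>+y. h y * indicator E y + h y * indicator (- E) y \<partial>\<mu>)"
      by (intro nn_integral_add[symmetric] measurable_invariant[OF inv]) measurable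
    also have "\<dots> = c" unfolding split by (rule h_int)
    finally have a: "?a E + ?a (- E) = c" .
    have "occ (\<lambda>y. h y * indicator E y + h y * indicator (- E) y) =
        occ (\<lambda>y. h y * indicator E y) + occ (\<lambda>y. h y * indicator (- E) y)"
      by (rule integral_functional_add[OF integral_functional_occ]) measurable
    then have b: "?b E + ?b (- E) = c"
      unfolding split h_occ by (simp flip: distrib_left)
    \<comment> \<open>On \<open>E\<close> and on its complement \<open>?a\<close> dominates
      \<open>?b\<close>, while both totals equal the finite number \<open>c\<close>; so neither
      inequality can be strict.\<close>
    have "?a E + ?a (- E) = ?b E + ?b (- E)"
      by (rule trans[OF a b[symmetric]])
    also have "\<dots> \<le> ?b E + ?a (- E)"
      by (intro add_left_mono ge E')
    finally have "?a (- E) + ?a E \<le> ?a (- E) + ?b E"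
      by (simp only: add.commute)
    moreover have "?a (- E) \<noteq> \<infinity>" using a c_fin by auto
    ultimately have "?a E \<le> ?b E" by (simp only: ennreal_add_left_cancel_le) simp
    with ge[OF E] show ?thesis by (rule antisym[rotated])
  qed
  have scale_meas: "borel_measurable (scale_measure c \<mu>0) = (borel_measurable \<mu>0 :: (_ \<Rightarrow> ennreal) set)"
    by (intro measurable_cong_sets) simp_all
  have dens: "density \<mu> h = density (scale_measure c \<mu>0) h"
  proof (rule measure_eqI)
    fix E assume "E \<in> sets (density \<mu> h)"
    then have E: "E \<in> sets SY" by (simp add: sets)
    then have [measurable]: "E \<in> sets SB" by (simp add: sets_SY_iff)
    have m: "h \<in> borel_measurable \<mu>" "h \<in> borel_measurable (scale_measure c \<mu>0)"
      using measurable_invariant[OF inv h] measurable_invariant[OF \<mu>0(1) h] by (simp_all add: scale_meas)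
    have m0: "(\<lambda>y. h y * indicator E y) \<in> borel_measurable \<mu>0"
      by (intro measurable_invariant[OF \<mu>0(1)]) measurable
    show "emeasure (density \<mu> h) E = emeasure (density (scale_measure c \<mu>0) h) E"
      using E m m0 eq[of E] by (simp add: emeasure_density sets sets0 nn_integral_scale_measure \<mu>0(2))
  qed (simp add: sets sets0)
  show "(\<integral>\<^sup>+y. f y \<partial>\<mu>) = emeasure \<mu> {origin} * occ f" if f [measurable]: "f \<in> borel_measurable SB"
  proof -
    \<comment> \<open>As \<open>0 < h \<le> 1\<close>, the weight \<open>h\<close> can be divided
      out, which extends equality from \<open>h\<close>-weighted indicators to all nonnegative
      measurable functions.\<close>
    have cancel: "h y * (f y / h y) = f y" if "y \<in> states" for y
    proof -
      have "h y \<noteq> \<top>" using h_le[of y] by (auto simp: top_unique)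
      then show ?thesis
        using h_pos[OF that] ennreal_mult_divide_eq[of "h y" "f y"]
        by (simp add: ennreal_times_divide mult.commute)
    qed
    have m: "h \<in> borel_measurable \<mu>" "h \<in> borel_measurable (scale_measure c \<mu>0)"
      using measurable_invariant[OF inv h] measurable_invariant[OF \<mu>0(1) h] by (simp_all add: scale_meas)
    have fh: "(\<lambda>y. f y / h y) \<in> borel_measurable SB" by measurable
    have fm: "(\<lambda>y. f y / h y) \<in> borel_measurable \<mu>" "(\<lambda>y. f y / h y) \<in> borel_measurable \<mu>0"
        "(\<lambda>y. f y / h y) \<in> borel_measurable (scale_measure c \<mu>0)" "h \<in> borel_measurable \<mu>0"
      using measurable_invariant[OF inv fh] measurable_invariant[OF \<mu>0(1) fh] measurable_invariant[OF \<mu>0(1) h]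
      by (simp_all add: scale_meas)
    have "(\<integral>\<^sup>+y. f y \<partial>\<mu>) = (\<integral>\<^sup>+y. h y * (f y / h y) \<partial>\<mu>)"
      by (rule invariant_cong[OF inv]) (simp add: cancel)
    also have "\<dots> = (\<integral>\<^sup>+y. f y / h y \<partial>density \<mu> h)"
      using m fm by (simp add: nn_integral_density)
    also have "\<dots> = (\<integral>\<^sup>+y. h y * (f y / h y) \<partial>scale_measure c \<mu>0)"
      unfolding dens using m fm by (simp add: nn_integral_density)
    also have "\<dots> = c * (\<integral>\<^sup>+y. h y * (f y / h y) \<partial>\<mu>0)"
      by (intro nn_integral_scale_measure borel_measurable_times_ennreal fm)
    also have "(\<integral>\<^sup>+y. h y * (f y / h y) \<partial>\<mu>0) = (\<integral>\<^sup>+y. f y \<partial>\<mu>0)"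
      by (rule invariant_cong[OF \<mu>0(1)]) (simp add: cancel)
    also have "\<dots> = occ f" by (rule \<mu>0(2)[OF f])
    finally show ?thesis by (simp add: c_def)
  qed
qed

text \<open>A cycle contains one reset almost surely. The value is \<open>lo\<close> and not 1
  because \<open>occ\<close> gives the atom mass one instead of its mean holding time. This yields
  the formula for \<open>K0\<close>.\<close>

lemma occ_reset_rate: "occ reset_rate = ennreal lo"
proof -
  let ?r = "\<lambda>m. \<Sum>k<m. (climb_chain ^^ k) (sojourn 0 reset_rate) origin"
  have "(\<lambda>m. ?r m + (climb_chain ^^ m) (\<lambda>_. 1) origin) \<longlonglongrightarrow>
      (\<Sum>k. (climb_chain ^^ k) (sojourn 0 reset_rate) origin) + 0"
    by (intro tendsto_add no_reset_tendsto_0 origin_mem summable_LIMSEQ summableI)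
  then show ?thesis
    unfolding sum_reset_climb_power[OF origin_mem] occ_eq by (simp add: LIMSEQ_const_iff)
qed

section \<open>The components of an invariant measure\<close>

lemma space_component: "space (component \<mu> n) = {lo..<A}"
  by (simp add: component_def space_restrict_space)

lemma sets_component: "sets (component \<mu> n) = sets (restrict_space borel {lo..<A})"
  by (simp add: component_def)

lemma nn_integral_component:
  assumes inv: "invariant_measure \<mu>" and [measurable]: "g \<in> borel_measurable borel"
  shows "(\<integral>\<^sup>+x. g x \<partial>component \<mu> n) = emeasure \<mu> {origin} * (step_op ^^ n) (\<lambda>y. g (snd y)) origin"
proof -
  note sets = invariant_sets[OF inv] and space = invariant_space[OF inv]
  have "{n} \<times> {lo..<A} \<in> sets SY" by (simp add: sets_SY_iff) auto
  moreover have "{n} \<times> {lo..<A} \<inter> space \<mu> = {n} \<times> {lo..<A}" unfolding space by auto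
  ultimately have L: "{n} \<times> {lo..<A} \<inter> space \<mu> \<in> sets \<mu>" by (simp only: sets)
  have snd_\<mu>: "snd \<in> borel_measurable \<mu>"
  proof -
    have "snd \<in> borel_measurable SY" by (rule measurable_SY) simp
    then show ?thesis using measurable_cong_sets[OF sets refl] by blast
  qed
  have snd': "snd \<in> measurable (restrict_space \<mu> ({n} \<times> {lo..<A})) (restrict_space borel {lo..<A})"
    by (intro measurable_restrict_space2 measurable_restrict_space1 snd_\<mu>)
       (auto simp: space_restrict_space)
  have "(\<integral>\<^sup>+x. g x \<partial>component \<mu> n) = (\<integral>\<^sup>+y. g (snd y) \<partial>restrict_space \<mu> ({n} \<times> {lo..<A}))"
    unfolding component_def by (rule nn_integral_distr[OF snd']) (simp add: measurable_restrict_space1)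
  also have "\<dots> = (\<integral>\<^sup>+y. g (snd y) * indicator ({n} \<times> {lo..<A}) y \<partial>\<mu>)"
    by (rule nn_integral_restrict_space[OF L])
  also have "\<dots> = emeasure \<mu> {origin} * occ (\<lambda>y. g (snd y) * indicator ({n} \<times> {lo..<A}) y)"
    by (rule invariant_eq_occ(3)[OF inv]) measurable
  also have "occ (\<lambda>y. g (snd y) * indicator ({n} \<times> {lo..<A}) y) =
      (step_op ^^ n) (\<lambda>y. g (snd y) * indicator ({n} \<times> {lo..<A}) y) origin"
    by (rule occ_level) auto
  also have "\<dots> = (step_op ^^ n) (\<lambda>y. g (snd y)) origin"
    by (intro antisym step_power_level_mono) auto
  finally show ?thesis .
qed

text \<open>A reset occurs already when \<open>A\<close> is hit exactly, hence the left limit; the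
  jump out of level \<open>n\<close> uses \<open>l (n + 1)\<close>, hence the shifted index.\<close>

lemma Gl_bar_left_reset_rate:
  assumes x: "0 \<le> x" shows "ennreal (x * Gl_bar_left (n + 1) (A - x)) = reset_rate (n, x)"
proof -
  interpret L: prob_space "Gl_law (Suc n)" by (rule prob_space_Gl_law)
  have "ennreal (x * Gl_bar_left (n + 1) (A - x)) = ennreal x * emeasure (Gl_law (Suc n)) {A - x..}"
    using x by (simp add: Gl_bar_left_eq L.emeasure_eq_measure ennreal_mult')
  also have "emeasure (Gl_law (Suc n)) {A - x..} = (\<integral>\<^sup>+u. indicator {A - x..} u \<partial>Gl_law (Suc n))"
    by simp
  also have "\<dots> = (\<integral>\<^sup>+z. indicator {A - x..} (l (Suc n) z) \<partial>G)"
    by (rule nn_integral_Gl_law) simp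
  also have "\<dots> = (\<integral>\<^sup>+z. indicator {z. resets (n, x) z} z \<partial>G)"
    by (intro nn_integral_cong) (auto simp: indicator_def resets_eq)
  finally show ?thesis by (simp add: reset_rate_def)
qed

lemma invariant_measure_characterization:
  assumes inv: "invariant_measure \<mu>"
  shows "\<exists>K0::real. K0 > 0 \<and>
    (AE x in component \<mu> 0. x = lo) \<and>
    emeasure (component \<mu> 0) {lo} = ennreal (K0 / lo) \<and>
    (\<forall>n\<ge>1. component \<mu> n = density (restrict_space lborel {lo..<A})
       (\<lambda>x. indicator {lo<..<A} x * pi_density K0 n x)) \<and>
    ennreal K0 = (\<Sum>n. \<integral>\<^sup>+x. ennreal (x * Gl_bar_left (n + 1) (A - x)) \<partial>component \<mu> n)"
proof -
  define c where "c = enn2real (emeasure \<mu> {origin})"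
  have c: "emeasure \<mu> {origin} = ennreal c"
    using invariant_eq_occ(2)[OF inv] by (simp add: c_def)
  have c_pos: "0 < c"
    using invariant_eq_occ(1)[OF inv] unfolding c by simp
  \<comment> \<open>The mass of the atom times its exit rate, that is, the flux of jumps out of the
    atom.\<close>
  define K0 where "K0 = c * lo"
  have K0: "0 < K0" "K0 / lo = c" using c_pos lo_pos by (auto simp: K0_def)
  note int = nn_integral_component[OF inv, unfolded c]
  have lo_sets: "{lo} \<in> sets (component \<mu> 0)"
    using lo_less_A by (auto simp: sets_component sets_restrict_space_iff)
  have em: "emeasure (component \<mu> n) E = ennreal c * (step_op ^^ n) (\<lambda>y. indicator E (snd y)) origin"
    if E: "E \<in> sets (component \<mu> n)" for n E
  proof -
    have "E \<in> sets borel" using E by (auto simp: sets_component sets_restrict_space_iff)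
    then have "(\<integral>\<^sup>+x. indicator E x \<partial>component \<mu> n) = ennreal c * (step_op ^^ n) (\<lambda>y. indicator E (snd y)) origin"
      by (intro int) simp
    then show ?thesis using E by simp
  qed
  show ?thesis
  proof (intro exI[of _ K0] conjI allI impI)
    show "0 < K0" by (rule K0)
    show "emeasure (component \<mu> 0) {lo} = ennreal (K0 / lo)"
      by (simp add: em[OF lo_sets] K0)
    show "AE x in component \<mu> 0. x = lo"
    proof (rule AE_I)
      show "{x \<in> space (component \<mu> 0). \<not> x = lo} \<subseteq> space (component \<mu> 0) - {lo}" by auto
      show N: "space (component \<mu> 0) - {lo} \<in> sets (component \<mu> 0)"
        using lo_sets by (rule sets.compl_sets)
      \<comment> \<open>At level 0 no step is taken, so the component is \<open>c\<close> times
        evaluation at the atom.\<close>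
      show "emeasure (component \<mu> 0) (space (component \<mu> 0) - {lo}) = 0"
        unfolding em[OF N] by simp
    qed
  next
    fix n :: nat assume "1 \<le> n"
    then obtain m where n: "n = Suc m" by (cases n) auto
    let ?d = "\<lambda>x. indicator {lo<..<A} x * pi_density K0 n x"
    show "component \<mu> n = density (restrict_space lborel {lo..<A}) ?d"
    proof (rule measure_eqI)
      show "sets (component \<mu> n) = sets (density (restrict_space lborel {lo..<A}) ?d)"
        by (simp add: sets_component cong: sets_restrict_space_cong)
      fix E assume E: "E \<in> sets (component \<mu> n)"
      then have E': "E \<in> sets borel" "E \<subseteq> {lo..<A}" "E \<in> sets (restrict_space lborel {lo..<A})"
        by (auto simp: sets_component sets_restrict_space_iff)
      note [measurable] = E'(1)
      have "emeasure (component \<mu> n) E = ennreal (K0 / lo) * (step_op ^^ Suc m) (\<lambda>y. indicator E (snd y)) origin"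
        using em[OF E] by (simp only: K0(2) n)
      also have "\<dots> = (\<integral>\<^sup>+x. indicator {lo<..<A} x * (pi_density K0 (Suc m) x * indicator E (snd (Suc m, x))) \<partial>lborel)"
        by (rule step_power_density[OF K0(1)]) measurable
      also have "\<dots> = (\<integral>\<^sup>+x. ?d x * indicator E x * indicator {lo..<A} x \<partial>lborel)"
        using E'(2) by (intro nn_integral_cong) (auto simp: indicator_def n)
      also have "\<dots> = (\<integral>\<^sup>+x. ?d x * indicator E x \<partial>restrict_space lborel {lo..<A})"
        by (rule nn_integral_restrict_space[symmetric]) simp
      also have "\<dots> = emeasure (density (restrict_space lborel {lo..<A}) ?d) E"
      proof (rule emeasure_density[symmetric])
        show "?d \<in> borel_measurable (restrict_space lborel {lo..<A})"
          by (rule measurable_restrict_space1) measurable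
      qed (fact E'(3))
      finally show "emeasure (component \<mu> n) E = emeasure (density (restrict_space lborel {lo..<A}) ?d) E" .
    qed
  next
    have "(\<integral>\<^sup>+x. ennreal (x * Gl_bar_left (n + 1) (A - x)) \<partial>component \<mu> n) =
        ennreal c * (step_op ^^ n) reset_rate origin" for n
    proof -
      have "(\<integral>\<^sup>+x. ennreal (x * Gl_bar_left (n + 1) (A - x)) \<partial>component \<mu> n) =
          (\<integral>\<^sup>+x. reset_rate (n, x) \<partial>component \<mu> n)"
        using lo_pos by (intro nn_integral_cong Gl_bar_left_reset_rate) (auto simp: space_component)
      also have "\<dots> = ennreal c * (step_op ^^ n) (\<lambda>y. reset_rate (n, snd y)) origin"
        by (rule int) measurable
      also have "(step_op ^^ n) (\<lambda>y. reset_rate (n, snd y)) origin = (step_op ^^ n) reset_rate origin"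
        by (intro antisym step_power_level_mono) auto
      finally show ?thesis .
    qed
    then have "(\<Sum>n. \<integral>\<^sup>+x. ennreal (x * Gl_bar_left (n + 1) (A - x)) \<partial>component \<mu> n) = ennreal c * occ reset_rate"
      by (simp add: occ_def ennreal_suminf_cmult)
    then show "ennreal K0 = (\<Sum>n. \<integral>\<^sup>+x. ennreal (x * Gl_bar_left (n + 1) (A - x)) \<partial>component \<mu> n)"
      using c_pos lo_pos by (simp add: occ_reset_rate K0_def ennreal_mult')
  qed
qed

end

theorem theorem4p3:
  fixes \<alpha> \<beta> A lo :: real and G :: "real measure" and l :: "nat \<Rightarrow> real \<Rightarrow> real"
  assumes "resetting_self_exciting \<alpha> \<beta> A lo G l"
    and "\<And>y. y \<in> space (resetting_self_exciting.SY A lo) \<Longrightarrow>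
           \<P>(\<omega> in resetting_self_exciting.noise G.
              resetting_self_exciting.T_A \<alpha> \<beta> A lo l y \<omega> < \<infinity>) = 1"
    and "\<alpha> > 0" and "\<beta> = lo"
  shows "(\<exists>\<mu>. resetting_self_exciting.invariant_measure \<alpha> \<beta> A lo G l \<mu>) \<and>
    (\<forall>\<mu>. resetting_self_exciting.invariant_measure \<alpha> \<beta> A lo G l \<mu> \<longrightarrow>
      (\<exists>K0::real. K0 > 0 \<and>
        (AE x in resetting_self_exciting.component A lo \<mu> 0. x = lo) \<and>
        emeasure (resetting_self_exciting.component A lo \<mu> 0) {lo} = ennreal (K0 / lo) \<and>
        (\<forall>n\<ge>1. resetting_self_exciting.component A lo \<mu> n =
           density (restrict_space lborel {lo..<A})
             (\<lambda>x. indicator {lo<..<A} x *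
               resetting_self_exciting.pi_density \<alpha> \<beta> A lo G l K0 n x)) \<and>
        ennreal K0 = (\<Sum>n. \<integral>\<^sup>+x.
           ennreal (x * resetting_self_exciting.Gl_bar_left G l (n + 1) (A - x))
             \<partial>resetting_self_exciting.component A lo \<mu> n)))"
proof -
  interpret resetting_self_exciting \<alpha> \<beta> A lo G l by (fact assms(1))
  interpret recurrent_at_reset_level \<alpha> \<beta> A lo G l
    by unfold_locales (fact assms(3), fact assms(4), fact assms(2))
  show ?thesis
  proof (intro conjI allI impI)
    show "\<exists>\<mu>. invariant_measure \<mu>" by (rule cycle_measure) (rule exI)
  qed (rule invariant_measure_characterization)
qed

end
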